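(* Let $\mathbb{K}$ be a field of characteristic $0$, let $S=\mathbb{K}[x_1,\dots,x_l]$ with the standard grading, let $I$ be a homogeneous ideal of $S$ and let $1\le k\le l$. Then the graded ring $S/I$ has the $k$-WLP if and only if for every $0\le d\le\operatorname{reg}(I)$ and $0\le j\le k-1$ $$\mathcal{M}_{S/I}(l-j-1,d)=\max\{\mathcal{M}_{S/I}(l-j,d)-\mathcal{M}_{S/I}(l-j,d-1),\,0\},$$ where $\mathcal{M}_{S/I}(l-j,-1)=0$.
   Context: $\operatorname{HF}(S/I,d)=\dim_{\mathbb{K}}(S/I)_d$. The sectional matrix of $S/I$ is $\mathcal{M}_{S/I}(i,d)=\operatorname{HF}(S/(I+\langle\ell_1,\dots,\ell_{l-i}\rangle),d)$ for $1\le i\le l$, $d\ge0$, where $\ell_1,\dots,\ell_{l-i}$ are generic linear forms of $S$ (the value is constant on a nonempty Zariski open set of choices); in particular $\mathcal{M}_{S/I}(l,d)=\operatorname{HF}(S/I,d)$. The same formula is used for $i=0$ (that is, $\mathcal{M}_{S/I}(0,d)=\operatorname{HF}(S/(I+\langle x_1,\dots,x_l\rangle),d)$). $\operatorname{reg}(I)$ is the Castelnuovo–Mumford regularity of $I$: the maximum of the numbers $d_i-i$, where $d_i=\max\{j\mid\beta_{i,j}(I)\neq0\}$ and $\beta_{i,j}(I)$ are the graded Betti numbers of $I$ (this definition presupposes $I\ne0$). A linear map is full-rank if it is injective or surjective. A graded ring $R=\bigoplus_{i\ge0}R_i$ over $\mathbb{K}$ with $\dim_{\mathbb{K}}R_i<\infty$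 (not necessarily Artinian) has the WLP with Lefschetz element $\ell\in R_1$ if $\times\ell\colon R_i\to R_{i+1}$ is full-rank for all $i\ge 0$. For $k\ge1$, $R$ has the $k$-WLP if there exist $\ell_1,\dots,\ell_k\in R_1$ such that $R$ has the WLP with Lefschetz element $\ell_1$ and, for all $i=2,\dots,k$, $R/\langle\ell_1,\dots,\ell_{i-1}\rangle$ has the WLP with Lefschetz element (the class of) $\ell_i$. *)

theory Defs
  imports
    "HOL-Library.Poly_Mapping"
    "HOL-Library.FuncSet"
    "HOL-Library.Cardinality"
    "HOL-Algebra.QuotRing"
    "HOL-Algebra.Embedded_Algebras"
    "HOL-Algebra.Algebraic_Closure_Type"
begin

section \<open>The polynomial ring\<close>

text \<open>
  The variables are the elements of a type \<open>'x\<close> (of class \<open>finite\<close> where the ring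
  \<open>S = K[x\<^sub>1, \<dots>, x\<^sub>l]\<close> is meant, so that \<open>l = CARD('x)\<close>).
  A monomial is its exponent vector.
\<close>

type_synonym ('x, 'k) mpoly = "('x \<Rightarrow>\<^sub>0 nat) \<Rightarrow>\<^sub>0 'k"

abbreviation poly_ring :: "('x::finite, 'k::field) mpoly ring"  (\<open>\<S>\<close>)
  where "\<S> \<equiv> ring_of_type_algebra"

definition mpoly_const :: "'k::field \<Rightarrow> ('x, 'k) mpoly"
  where "mpoly_const c = Poly_Mapping.single 0 c"

definition mpoly_var :: "'x \<Rightarrow> ('x, 'k::field) mpoly"
  where "mpoly_var x = Poly_Mapping.single (Poly_Mapping.single x 1) 1"

definition mon_deg :: "('x::finite \<Rightarrow>\<^sub>0 nat) \<Rightarrow> nat"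
  where "mon_deg m = (\<Sum>x\<in>UNIV. Poly_Mapping.lookup m x)"

definition homog_part :: "nat \<Rightarrow> ('x::finite, 'k::field) mpoly set"
  where "homog_part d = {f. \<forall>m\<in>Poly_Mapping.keys f. mon_deg m = d}"

definition homogeneous_ideal :: "('x::finite, 'k::field) mpoly set \<Rightarrow> bool"
  where "homogeneous_ideal I \<longleftrightarrow>
    ideal I \<S> \<and> (\<exists>G \<subseteq> (\<Union>d. homog_part d). I = Idl\<^bsub>\<S>\<^esub> G)"

section \<open>Quotients and Hilbert functions\<close>

text \<open>A grading of a ring \<open>R\<close> is given by its components \<open>G i\<close>, \<open>i \<ge> 0\<close>.\<close>

definition quot_grading ::
    "('a, 'b) ring_scheme \<Rightarrow> 'a set \<Rightarrow> (nat \<Rightarrow> 'a set) \<Rightarrow> nat \<Rightarrow> 'a set set"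
  where "quot_grading R J G d = (\<lambda>f. J +>\<^bsub>R\<^esub> f) ` G d"

text \<open>The dimension is taken over the image of \<open>K\<close> in \<open>S/I\<close>.\<close>

definition HF :: "('x::finite, 'k::field) mpoly set \<Rightarrow> nat \<Rightarrow> nat"
  where "HF I d =
    ring.dim (\<S> Quot I) (range (\<lambda>c. I +>\<^bsub>\<S>\<^esub> mpoly_const c)) (quot_grading \<S> I homog_part d)"

section \<open>The sectional matrix\<close>

definition mpoly_eval :: "('v \<Rightarrow> 'k::field) \<Rightarrow> ('v, 'k) mpoly \<Rightarrow> 'k"
  where "mpoly_eval a p =
    (\<Sum>m\<in>Poly_Mapping.keys p. Poly_Mapping.lookup p m *
       (\<Prod>v\<in>Poly_Mapping.keys m. a v ^ Poly_Mapping.lookup m v))"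

text \<open>
  Zariski open subsets of the affine space with coordinates in \<open>V\<close>, whose points are the
  functions in \<open>V \<rightarrow>\<^sub>E UNIV\<close>: complements of the zero sets of families of polynomials in the
  variables \<open>V\<close>.
\<close>

definition zariski_open :: "'v set \<Rightarrow> ('v \<Rightarrow> 'k::field) set \<Rightarrow> bool"
  where "zariski_open V U \<longleftrightarrow>
    (\<exists>P. (\<forall>p\<in>P. \<forall>m\<in>Poly_Mapping.keys p. Poly_Mapping.keys m \<subseteq> V) \<and>
         U = {a \<in> V \<rightarrow>\<^sub>E UNIV. \<exists>p\<in>P. mpoly_eval a p \<noteq> 0})"

definition linear_form :: "('x::finite \<Rightarrow> 'k::field) \<Rightarrow> ('x, 'k) mpoly"
  where "linear_form c = (\<Sum>x\<in>UNIV. mpoly_const (c x) * mpoly_var x)"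

text \<open>A sequence of \<open>n\<close> linear forms is a point of the affine space with coordinates
  \<open>{..<n} \<times> UNIV\<close>.\<close>

definition generic_value ::
    "nat \<Rightarrow> ((nat \<Rightarrow> ('x::finite, 'k::field) mpoly) \<Rightarrow> 'b) \<Rightarrow> 'b"
  where "generic_value n F =
    (THE h. \<exists>U. zariski_open ({..<n} \<times> UNIV) U \<and> U \<noteq> {} \<and>
       (\<forall>a\<in>U. F (\<lambda>i. linear_form (\<lambda>x. a (i, x))) = h))"

definition sectional_matrix :: "('x::finite, 'k::field) mpoly set \<Rightarrow> nat \<Rightarrow> nat \<Rightarrow> nat"
  where "sectional_matrix I i d =
    generic_value (CARD('x) - i)
      (\<lambda>ls. HF (I <+>\<^bsub>\<S>\<^esub> Idl\<^bsub>\<S>\<^esub> (ls ` {..<CARD('x) - i})) d)"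

section \<open>Graded Betti numbers and regularity\<close>

text \<open>Elements of \<open>S\<^sup>n\<close> are sequences vanishing from index \<open>n\<close> on.\<close>

definition free_module :: "nat \<Rightarrow> (nat \<Rightarrow> ('x::finite, 'k::field) mpoly) set"
  where "free_module n = {v. \<forall>q\<ge>n. v q = 0}"

definition matrix_map ::
    "nat \<Rightarrow> nat \<Rightarrow> (nat \<Rightarrow> nat \<Rightarrow> ('x::finite, 'k::field) mpoly) \<Rightarrow>
     (nat \<Rightarrow> ('x, 'k) mpoly) \<Rightarrow> nat \<Rightarrow> ('x, 'k) mpoly"
  where "matrix_map n' n A v = (\<lambda>p. if p < n' then \<Sum>q<n. A p q * v q else 0)"

definition augmentation ::
    "nat \<Rightarrow> (nat \<Rightarrow> ('x::finite, 'k::field) mpoly) \<Rightarrow> (nat \<Rightarrow> ('x, 'k) mpoly) \<Rightarrow> ('x, 'k) mpoly"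
  where "augmentation n g v = (\<Sum>q<n. g q * v q)"

text \<open>
  A minimal graded free resolution
  \<open>\<dots> \<rightarrow> F\<^sub>2 \<rightarrow> F\<^sub>1 \<rightarrow> F\<^sub>0 \<rightarrow> I \<rightarrow> 0\<close> of \<open>I\<close>:
  \<open>F\<^sub>i\<close> is the direct sum of the \<open>S(- a i q)\<close>, \<open>q < r i\<close>; the map
  \<open>F\<^sub>0 \<rightarrow> I\<close> is given by the generators \<open>g\<close>, the map \<open>F\<^sub>i\<^sub>+\<^sub>1 \<rightarrow> F\<^sub>i\<close> by the matrix
  \<open>D i\<close>. The maps are homogeneous of degree 0, and the entries of the matrices \<open>D i\<close> lie in
  \<open>\<langle>x\<^sub>1, \<dots>, x\<^sub>l\<rangle>\<close>. As \<open>I\<close> is contained in \<open>S\<close>, the shifts are natural numbers.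
\<close>

definition min_graded_resolution ::
    "('x::finite, 'k::field) mpoly set \<Rightarrow> (nat \<Rightarrow> nat) \<Rightarrow> (nat \<Rightarrow> nat \<Rightarrow> nat) \<Rightarrow>
     (nat \<Rightarrow> ('x, 'k) mpoly) \<Rightarrow> (nat \<Rightarrow> nat \<Rightarrow> nat \<Rightarrow> ('x, 'k) mpoly) \<Rightarrow> bool"
  where "min_graded_resolution I r a g D \<longleftrightarrow>
    (\<forall>q<r 0. g q \<in> homog_part (a 0 q)) \<and>
    (\<forall>i. \<forall>p<r i. \<forall>q<r (Suc i).
       D i p q \<in> (if a i p \<le> a (Suc i) q then homog_part (a (Suc i) q - a i p) else {0})) \<and>
    augmentation (r 0) g ` free_module (r 0) = I \<and>
    {v \<in> free_module (r 0). augmentation (r 0) g v = 0} =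
      matrix_map (r 0) (r 1) (D 0) ` free_module (r 1) \<and>
    (\<forall>i. {v \<in> free_module (r (Suc i)). matrix_map (r i) (r (Suc i)) (D i) v = (\<lambda>_. 0)} =
      matrix_map (r (Suc i)) (r (Suc (Suc i))) (D (Suc i)) ` free_module (r (Suc (Suc i)))) \<and>
    (\<forall>i. \<forall>p<r i. \<forall>q<r (Suc i). D i p q \<in> Idl\<^bsub>\<S>\<^esub> (range mpoly_var))"

text \<open>Minimal graded free resolutions are unique up to isomorphism, so the choice of the
  resolution does not matter.\<close>

definition graded_betti :: "('x::finite, 'k::field) mpoly set \<Rightarrow> nat \<Rightarrow> nat \<Rightarrow> nat"
  where "graded_betti I = (SOME \<beta>. \<exists>r a g D. min_graded_resolution I r a g D \<and>
    \<beta> = (\<lambda>i j. card {q. q < r i \<and> a i q = j}))"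

text \<open>Meaningful for \<open>I \<noteq> 0\<close> only. Only indices \<open>i\<close> with \<open>\<beta>\<^sub>i\<^sub>,\<^sub>j \<noteq> 0\<close> for some \<open>j\<close> count.\<close>

definition regularity :: "('x::finite, 'k::field) mpoly set \<Rightarrow> int"
  where "regularity I =
    Max {int (Max {j. graded_betti I i j \<noteq> 0}) - int i | i. \<exists>j. graded_betti I i j \<noteq> 0}"

section \<open>The weak Lefschetz property\<close>

definition full_rank :: "('a \<Rightarrow> 'b) \<Rightarrow> 'a set \<Rightarrow> 'b set \<Rightarrow> bool"
  where "full_rank f A B \<longleftrightarrow> inj_on f A \<or> f ` A = B"

definition WLP_with :: "('a, 'b) ring_scheme \<Rightarrow> (nat \<Rightarrow> 'a set) \<Rightarrow> 'a \<Rightarrow> bool"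
  where "WLP_with R G l \<longleftrightarrow>
    l \<in> G 1 \<and> (\<forall>i. full_rank (\<lambda>f. l \<otimes>\<^bsub>R\<^esub> f) (G i) (G (Suc i)))"

definition k_WLP :: "('a, 'b) ring_scheme \<Rightarrow> (nat \<Rightarrow> 'a set) \<Rightarrow> nat \<Rightarrow> bool"
  where "k_WLP R G k \<longleftrightarrow>
    (\<exists>ls :: nat \<Rightarrow> 'a. (\<forall>i\<in>{1..k}. ls i \<in> G 1) \<and> WLP_with R G (ls 1) \<and>
      (\<forall>i\<in>{2..k}. let J = Idl\<^bsub>R\<^esub> (ls ` {1..<i}) in
         WLP_with (R Quot J) (quot_grading R J G) (J +>\<^bsub>R\<^esub> ls i)))"

end

theory Submission
  imports Defs "HOL-Library.Countable"
begin

text \<open>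
  For a homogeneous ideal \<open>J\<close> and a linear form \<open>y\<close>, \<open>HF(S/(J + \<langle>y\<rangle>), d + 1)\<close> is at least the
  maximum of \<open>HF(S/J, d + 1) - HF(S/J, d)\<close> and \<open>0\<close>, with equality iff multiplication by \<open>y\<close> from
  degree \<open>d\<close> to \<open>d + 1\<close> of \<open>S/J\<close> has full rank. The entries of the sectional matrix are the minima
  of \<open>HF(S/(I + \<langle>y\<^sub>1, \<dots>, y\<^sub>n\<rangle>), d)\<close> over all linear forms, and generic forms attain them. By
  induction on \<open>n\<close>, forms witnessing the \<open>k\<close>-WLP attain the minima as well, which gives the equations
  in all degrees. Conversely the equations in degrees up to \<open>reg(I)\<close> show that generic forms
  have full rank between these degrees. Beyond, multiplication by a generic form is injective:
  let \<open>F\<close> be the minimal free resolution of \<open>S/I\<close>. Generic forms are almost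
  regular, so the homology of \<open>F/\<langle>y\<^sub>1, \<dots>, y\<^sub>n\<rangle>F\<close> vanishes in large degrees (homological
  index at least \<open>1\<close>). For \<open>n = l\<close> it lives in the degrees of the generators of the \<open>F\<^sub>i\<close>, which are at most
  \<open>reg(I) + i - 1\<close>, and the long exact sequences of multiplication by \<open>y\<^sub>n\<close> transport this bound to all
  smaller \<open>n\<close>.
\<close>

section \<open>Polynomials and their homogeneous components\<close>

text \<open>The forms need not be regular on the successive quotients of \<open>S/I\<close>, so the
  homology of the reduced resolution does not vanish outright. What carries the bound to smaller
  \<open>n\<close> is propagation: beyond the bound, vanishing for \<open>n + 1\<close> forms, one
  index and one degree higher, makes multiplication by the next form injective on the homology for
  \<open>n\<close> forms. A nonzero class would then survive in all higher degrees, against the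
  eventual vanishing. Index and degree move up together, which is why the bound has slope one, as in
  the definition of regularity.

  At index \<open>0\<close> the bound says that multiplication out of degree \<open>d\<close> is
  injective for \<open>d \<ge> reg(I)\<close>; the equation in degree
  \<open>d + 1 \<le> reg(I)\<close> governs the map out of \<open>d < reg(I)\<close>. So the two
  ranges fit together exactly. The equation in degree \<open>0\<close> always holds.

  \<open>regularity\<close> is a maximum over Betti numbers chosen by \<open>SOME\<close>: the
  existence of a minimal resolution gives this choice a meaning, and its finite length, obtained
  from the same homology modules, makes the set under the maximum finite.\<close>

abbreviation lookup where "lookup \<equiv> Poly_Mapping.lookup"
abbreviation keys where "keys \<equiv> Poly_Mapping.keys"
abbreviation single where "single \<equiv> Poly_Mapping.single"

lemma sum_singles: "(\<Sum>m\<in>keys f. single m (lookup f m)) = f"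
proof (rule poly_mapping_eqI)
  fix k
  have "lookup (\<Sum>m\<in>keys f. single m (lookup f m)) k
      = (\<Sum>m\<in>keys f. if m = k then lookup f k else 0)"
    unfolding lookup_sum by (intro sum.cong) (auto simp: lookup_single when_def)
  also have "\<dots> = lookup f k" by (auto simp: in_keys_iff)
  finally show "lookup (\<Sum>m\<in>keys f. single m (lookup f m)) k = lookup f k" .
qed

lemma mult_eq_sum_singles:
  fixes f g :: "'a::comm_monoid_add \<Rightarrow>\<^sub>0 'b::comm_semiring_0"
  shows "f * g = (\<Sum>m\<in>keys f. \<Sum>n\<in>keys g. single (m + n) (lookup f m * lookup g n))"
  by (subst (1) sum_singles[symmetric, of f], subst (1) sum_singles[symmetric, of g])
     (simp add: sum_product mult_single)

lemma mon_deg_0 [simp]: "mon_deg 0 = 0" and mon_deg_add: "mon_deg (m + n) = mon_deg m + mon_deg n"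
  by (simp_all add: mon_deg_def lookup_add sum.distrib)

lemma mon_deg_single [simp]: "mon_deg (single x n) = n"
proof -
  have "(\<Sum>y\<in>UNIV. lookup (single x n) y) = (\<Sum>y\<in>UNIV. if x = y then n else 0)"
    by (intro sum.cong) (auto simp: lookup_single when_def)
  thus ?thesis by (simp add: mon_deg_def)
qed

lemma mon_deg_eq_0_iff [simp]: "mon_deg m = 0 \<longleftrightarrow> m = 0"
  by (auto simp: mon_deg_def intro: poly_mapping_eqI)

lemma finite_mon_deg: "finite {m :: 'x::finite \<Rightarrow>\<^sub>0 nat. mon_deg m = d}"
proof (rule finite_imageD)
  show "inj_on lookup {m :: 'x::finite \<Rightarrow>\<^sub>0 nat. mon_deg m = d}"
    by (meson inj_onI poly_mapping_eq_iff)
  have "lookup m x \<le> d" if "mon_deg m = d" for m :: "'x \<Rightarrow>\<^sub>0 nat" and x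
    using that member_le_sum[of x UNIV "lookup m"] by (auto simp: mon_deg_def)
  hence "lookup ` {m :: 'x \<Rightarrow>\<^sub>0 nat. mon_deg m = d} \<subseteq> (UNIV :: 'x set) \<rightarrow>\<^sub>E {..d}"
    by auto
  thus "finite (lookup ` {m :: 'x \<Rightarrow>\<^sub>0 nat. mon_deg m = d})"
    by (rule finite_subset) (simp add: finite_PiE)
qed

lemma mpoly_const_add: "mpoly_const (a + b) = mpoly_const a + mpoly_const b"
  and mpoly_const_mult: "mpoly_const (a * b) = mpoly_const a * mpoly_const b"
  and mpoly_const_0 [simp]: "mpoly_const 0 = 0"
  and mpoly_const_1 [simp]: "mpoly_const 1 = 1"
  and mpoly_const_uminus: "mpoly_const (- a) = - mpoly_const a"
  by (simp_all add: mpoly_const_def single_add mult_single single_uminus)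

lemma lookup_const_mult [simp]: "lookup (mpoly_const c * f) m = c * lookup f m"
  by (simp add: mpoly_const_def mult_map_scale_conv_mult[symmetric] Poly_Mapping.map.rep_eq when_def)

lemma single_eq_const_mult: "single m c = mpoly_const c * single m 1"
  by (simp add: mpoly_const_def mult_single)

lemma homog_part_0 [simp]: "0 \<in> homog_part d"
  and homog_part_add: "f \<in> homog_part d \<Longrightarrow> g \<in> homog_part d \<Longrightarrow> f + g \<in> homog_part d"
  and homog_part_diff: "f \<in> homog_part d \<Longrightarrow> g \<in> homog_part d \<Longrightarrow> f - g \<in> homog_part d"
  by (auto simp: homog_part_def in_keys_iff lookup_add lookup_minus)

lemma lookup_homog_eq_0: "f \<in> homog_part d \<Longrightarrow> mon_deg m \<noteq> d \<Longrightarrow> lookup f m = 0"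
  by (metis (mono_tags, lifting) homog_part_def in_keys_iff mem_Collect_eq)

lemma homog_part_sum: "(\<And>i. i \<in> A \<Longrightarrow> f i \<in> homog_part d) \<Longrightarrow> sum f A \<in> homog_part d"
  by (induction A rule: infinite_finite_induct) (auto intro: homog_part_add)

lemma homog_part_mult: "f \<in> homog_part d \<Longrightarrow> g \<in> homog_part e \<Longrightarrow> f * g \<in> homog_part (d + e)"
  using keys_mult[of f g] by (force simp: homog_part_def mon_deg_add)

lemma homog_part_single: "single m c \<in> homog_part (mon_deg m)"
  by (simp add: homog_part_def)

lemma homog_part_const: "mpoly_const c \<in> homog_part 0"
  by (simp add: homog_part_def mpoly_const_def)

lemma homog_part_var: "mpoly_var x \<in> homog_part 1"
  by (simp add: homog_part_def mpoly_var_def)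

lemma homog_part_const_mult: "f \<in> homog_part d \<Longrightarrow> mpoly_const c * f \<in> homog_part d"
  using homog_part_mult[OF homog_part_const] by force

lemma linear_form_homog: "linear_form c \<in> homog_part 1"
  unfolding linear_form_def by (intro homog_part_sum homog_part_const_mult homog_part_var)

lemma mon_deg_1E:
  assumes "mon_deg m = 1" obtains x where "m = single x 1"
proof -
  from assms obtain x where x: "lookup m x = 1" and o: "\<And>y. y \<noteq> x \<Longrightarrow> lookup m y = 0"
    by (auto simp: mon_deg_def sum_eq_Suc0_iff)
  have "m = single x 1"
    by (rule poly_mapping_eqI) (use x o in \<open>auto simp: lookup_single when_def\<close>)
  thus ?thesis using that by blast
qed

lemma single_key_eq_iff [simp]: "c \<noteq> 0 \<Longrightarrow> single x c = single y c \<longleftrightarrow> x = y"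
  by (metis keys_single the_elem_eq)

lemma lookup_linear_form [simp]: "lookup (linear_form c) (single x (Suc 0)) = c x"
proof -
  have "lookup (linear_form c) (single x (Suc 0)) = (\<Sum>y\<in>UNIV. if y = x then c x else 0)"
    unfolding linear_form_def lookup_sum mpoly_var_def
    by (intro sum.cong) (auto simp: lookup_single when_def)
  thus ?thesis by simp
qed

lemma homog_1_linear_form:
  assumes "f \<in> homog_part 1"
  shows "f = linear_form (\<lambda>x. lookup f (single x 1))"
proof (rule poly_mapping_eqI)
  fix m show "lookup f m = lookup (linear_form (\<lambda>x. lookup f (single x 1))) m"
  proof (cases "mon_deg m = 1")
    case True thus ?thesis by (elim mon_deg_1E) simp
  next
    case False thus ?thesis
      using lookup_homog_eq_0[OF assms] lookup_homog_eq_0[OF linear_form_homog] by simp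
  qed
qed

section \<open>Homogeneous components of a polynomial\<close>

definition hcomp :: "nat \<Rightarrow> ('x::finite, 'k::field) mpoly \<Rightarrow> ('x, 'k) mpoly" where
  "hcomp d f = Poly_Mapping.mapp (\<lambda>m c. c when mon_deg m = d) f"

lemma lookup_hcomp [simp]: "lookup (hcomp d f) m = (lookup f m when mon_deg m = d)"
  by (auto simp: hcomp_def lookup_mapp when_def in_keys_iff)

lemma hcomp_0 [simp]: "hcomp d 0 = 0"
  and hcomp_add: "hcomp d (f + g) = hcomp d f + hcomp d g"
  and hcomp_diff: "hcomp d (f - g) = hcomp d f - hcomp d g"
  by (auto intro!: poly_mapping_eqI simp: lookup_add lookup_minus when_def)

lemma hcomp_sum: "hcomp d (sum f A) = (\<Sum>i\<in>A. hcomp d (f i))"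
  by (induction A rule: infinite_finite_induct) (auto simp: hcomp_add)

lemma hcomp_homog [intro, simp]: "hcomp d f \<in> homog_part d"
  by (auto simp: homog_part_def in_keys_iff when_def split: if_splits)

lemma hcomp_of_homog: "f \<in> homog_part d \<Longrightarrow> hcomp e f = (if e = d then f else 0)"
  using lookup_homog_eq_0[of f d] by (intro poly_mapping_eqI) (auto simp: when_def)

lemma hcomp_of_homog_same: "f \<in> homog_part d \<Longrightarrow> hcomp d f = f"
  by (simp add: hcomp_of_homog)

lemma sum_hcomp: "\<exists>N. f = (\<Sum>d<N. hcomp d f)"
proof
  \<comment> \<open>For \<open>f = 0\<close> this is the maximum of the empty set; its value is then
    irrelevant, all components being \<open>0\<close>.\<close>
  let ?N = "Suc (Max (mon_deg ` keys f))"
  show "f = (\<Sum>d<?N. hcomp d f)"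
  proof (rule poly_mapping_eqI)
    fix m
    have "lookup (\<Sum>d<?N. hcomp d f) m = (\<Sum>d<?N. if d = mon_deg m then lookup f m else 0)"
      unfolding lookup_sum by (intro sum.cong) (auto simp: when_def)
    also have "\<dots> = lookup f m"
    proof (cases "m \<in> keys f")
      case True
      hence "mon_deg m < ?N" by (auto simp: less_Suc_eq_le)
      thus ?thesis by simp
    qed (auto simp: in_keys_iff)
    finally show "lookup f m = lookup (\<Sum>d<?N. hcomp d f) m" by simp
  qed
qed

lemma hcomp_mult:
  assumes "f \<in> homog_part a"
  shows "hcomp e (f * g) = (if a \<le> e then f * hcomp (e - a) g else 0)"
proof -
  obtain N where N: "g = (\<Sum>d<N. hcomp d g)" using sum_hcomp by blast
  have *: "hcomp e (f * hcomp d g) = (if e = a + d then f * hcomp d g else 0)" for d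
    using hcomp_of_homog[OF homog_part_mult[OF assms hcomp_homog]] by simp
  have "hcomp e (f * g) = (\<Sum>d<N. if e = a + d then f * hcomp d g else 0)"
    by (subst N) (simp add: sum_distrib_left hcomp_sum *)
  also have "\<dots> = (if a \<le> e then f * hcomp (e - a) g else 0)"
  proof (cases "a \<le> e")
    case True
    hence "(\<Sum>d<N. if e = a + d then f * hcomp d g else 0)
        = (\<Sum>d<N. if d = e - a then f * hcomp (e - a) g else 0)" by (intro sum.cong) auto
    also have "\<dots> = f * hcomp (e - a) g"
    proof (cases "e - a < N")
      case False
      have "hcomp (e - a) g = (\<Sum>d<N. hcomp (e - a) (hcomp d g))" by (subst N) (simp add: hcomp_sum)
      also have "\<dots> = 0"
        using False by (intro sum.neutral) (auto simp: hcomp_of_homog[OF hcomp_homog])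
      finally show ?thesis using False by simp
    qed simp
    finally show ?thesis using True by simp
  qed (auto intro!: sum.neutral)
  finally show ?thesis .
qed

subsection \<open>Evaluation and substitution\<close>

definition mon_val :: "('v \<Rightarrow> 'r::comm_ring_1) \<Rightarrow> ('v \<Rightarrow>\<^sub>0 nat) \<Rightarrow> 'r" where
  "mon_val s m = (\<Prod>v\<in>keys m. s v ^ lookup m v)"

text \<open>Target ring and coefficient map stay abstract, so that one set of homomorphism laws
  serves both evaluation at a point (\<open>mpoly_eval\<close>) and substitution of polynomials for
  the variables.\<close>

definition ev :: "('k::field \<Rightarrow> 'r::comm_ring_1) \<Rightarrow> ('v \<Rightarrow> 'r) \<Rightarrow> ('v, 'k) mpoly \<Rightarrow> 'r" where
  "ev c s f = (\<Sum>m\<in>keys f. c (lookup f m) * mon_val s m)"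

lemma mon_val_superset:
  "finite A \<Longrightarrow> keys m \<subseteq> A \<Longrightarrow> mon_val s m = (\<Prod>v\<in>A. s v ^ lookup m v)"
  unfolding mon_val_def by (rule prod.mono_neutral_left) (auto simp: in_keys_iff)

lemma mon_val_0 [simp]: "mon_val s 0 = 1"
  by (simp add: mon_val_def)

lemma mon_val_single [simp]: "mon_val s (single v n) = s v ^ n"
  by (cases "n = 0") (auto simp: mon_val_def)

lemma mon_val_add: "mon_val s (m + n) = mon_val s m * mon_val s n"
proof -
  let ?A = "keys m \<union> keys n"
  have "keys (m + n) \<subseteq> ?A" by (rule keys_add)
  thus ?thesis
    by (simp add: mon_val_superset[of ?A] lookup_add power_add prod.distrib)
qed

locale coeff_hom =
  fixes c :: "'k::field \<Rightarrow> 'r::comm_ring_1"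
  assumes c0: "c 0 = 0" and c1: "c 1 = 1"
    and cadd: "c (a + b) = c a + c b" and cmult: "c (a * b) = c a * c b"
begin

context
  notes [simp] = c0 c1
begin

lemma ev_superset:
  "finite A \<Longrightarrow> keys f \<subseteq> A \<Longrightarrow> ev c s f = (\<Sum>m\<in>A. c (lookup f m) * mon_val s m)"
  unfolding ev_def by (rule sum.mono_neutral_left) (auto simp: in_keys_iff)

lemma ev_0 [simp]: "ev c s 0 = 0"
  by (simp add: ev_def)

lemma ev_single [simp]: "ev c s (single m a) = c a * mon_val s m"
  by (cases "a = 0") (auto simp: ev_def)

lemma ev_add: "ev c s (f + g) = ev c s f + ev c s g"
proof -
  let ?A = "keys f \<union> keys g"
  have "keys (f + g) \<subseteq> ?A" by (rule keys_add)
  thus ?thesis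
    by (simp add: ev_superset[of ?A] lookup_add cadd ring_distribs sum.distrib)
qed

lemma ev_sum: "ev c s (sum f A) = (\<Sum>i\<in>A. ev c s (f i))"
  by (induction A rule: infinite_finite_induct) (auto simp: ev_add)

lemma ev_mult: "ev c s (f * g) = ev c s f * ev c s g"
  by (simp add: mult_eq_sum_singles ev_sum ev_def[of c s f] ev_def[of c s g] sum_product
      mon_val_add cmult mult_ac)

lemma ev_1 [simp]: "ev c s 1 = 1"
  using ev_single[of s 0 1] by (simp del: ev_single)

lemma ev_const [simp]: "ev c s (mpoly_const a) = c a"
  by (simp add: mpoly_const_def)

lemma ev_var [simp]: "ev c s (mpoly_var x) = s x"
  by (simp add: mpoly_var_def)

end

end

interpretation coeff_const: coeff_hom mpoly_const
  by standard (auto simp: mpoly_const_add mpoly_const_mult)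

interpretation coeff_id: coeff_hom "\<lambda>x::'k::field. x"
  by standard auto

lemma mpoly_eval_ev: "mpoly_eval a p = ev (\<lambda>x. x) a p"
  by (simp add: mpoly_eval_def ev_def mon_val_def)

lemma mpoly_eval_const [simp]: "mpoly_eval a (mpoly_const k) = k"
  and mpoly_eval_var [simp]: "mpoly_eval a (mpoly_var v) = a v"
  and mpoly_eval_add: "mpoly_eval a (p + q) = mpoly_eval a p + mpoly_eval a q"
  and mpoly_eval_mult: "mpoly_eval a (p * q) = mpoly_eval a p * mpoly_eval a q"
  unfolding mpoly_eval_ev
  by (rule coeff_id.ev_const coeff_id.ev_var coeff_id.ev_add coeff_id.ev_mult)+

subsection \<open>Leading monomials\<close>

text \<open>Numbering the variables compares monomials lexicographically.\<close>

definition mkey :: "('x::finite \<Rightarrow>\<^sub>0 nat) \<Rightarrow> (nat \<Rightarrow>\<^sub>0 nat)" where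
  "mkey m = (\<Sum>x\<in>UNIV. single (to_nat x) (lookup m x))"

lemma lookup_mkey: "lookup (mkey m) (to_nat x) = lookup m x"
proof -
  have "lookup (mkey m) (to_nat x) = (\<Sum>y\<in>UNIV. if y = x then lookup m x else 0)"
    unfolding mkey_def lookup_sum by (intro sum.cong) (auto simp: lookup_single when_def)
  thus ?thesis by simp
qed

lemma inj_mkey: "inj mkey"
  by (rule injI, rule poly_mapping_eqI) (metis lookup_mkey)

lemma mkey_add: "mkey (m + n) = mkey m + mkey n"
  by (simp add: mkey_def lookup_add single_add sum.distrib)

definition lead :: "('x::finite, 'k::field) mpoly \<Rightarrow> ('x \<Rightarrow>\<^sub>0 nat)" where
  "lead f = arg_max_on mkey (keys f)"

lemma
  assumes "f \<noteq> 0"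
  shows lead_in_keys: "lead f \<in> keys f"
    and lead_max: "m \<in> keys f \<Longrightarrow> mkey m \<le> mkey (lead f)"
proof -
  have ne: "finite (mkey ` keys f)" "mkey ` keys f \<noteq> {}" using assms by auto
  then obtain m where m: "m \<in> keys f" "mkey m = Max (mkey ` keys f)"
    using Max_in[OF ne] by (metis imageE)
  have "is_arg_max mkey (\<lambda>x. x \<in> keys f) m"
    unfolding is_arg_max_linorder using m Max_ge[OF ne(1)] by (metis imageI)
  hence "is_arg_max mkey (\<lambda>x. x \<in> keys f) (lead f)"
    unfolding lead_def arg_max_on_def arg_max_def by (rule someI)
  thus "lead f \<in> keys f" "m \<in> keys f \<Longrightarrow> mkey m \<le> mkey (lead f)" for m
    unfolding is_arg_max_linorder by auto
qed

lemma lead_eqI: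
  assumes "m \<in> keys f" "\<And>n. n \<in> keys f \<Longrightarrow> mkey n \<le> mkey m"
  shows "lead f = m"
proof -
  have "f \<noteq> 0" using assms by auto
  from lead_in_keys[OF this] lead_max[OF this] assms have "mkey (lead f) = mkey m"
    by (intro antisym) auto
  thus ?thesis using inj_mkey by (auto dest: injD)
qed

text \<open>The order given by \<open>mkey\<close> is compatible with addition, so a monomial of
  \<open>f\<close> and one of \<open>g\<close> add up to the sum of the leading ones only if both
  are leading. Hence nothing can cancel there, and the polynomial ring is a domain.\<close>

lemma lookup_mult_lead:
  assumes "f \<noteq> 0" "g \<noteq> 0"
  shows "lookup (f * g) (lead f + lead g) = lookup f (lead f) * lookup g (lead g)"
proof -
  have *: "m + n = lead f + lead g \<longleftrightarrow> m = lead f \<and> n = lead g" if "m \<in> keys f" "n \<in> keys g" for m n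
  proof
    assume e: "m + n = lead f + lead g"
    have "mkey m \<le> mkey (lead f)" "mkey n \<le> mkey (lead g)"
      using lead_max assms that by auto
    moreover have "mkey m + mkey n = mkey (lead f) + mkey (lead g)"
      using e by (metis mkey_add)
    ultimately have "mkey m = mkey (lead f)" "mkey n = mkey (lead g)"
      by (metis add_less_le_mono order_le_imp_less_or_eq order_less_irrefl,
          metis add_le_less_mono order_le_imp_less_or_eq order_less_irrefl)
    thus "m = lead f \<and> n = lead g" using inj_mkey by (auto dest: injD)
  qed auto
  have "lookup (f * g) (lead f + lead g) =
     (\<Sum>m\<in>keys f. \<Sum>n\<in>keys g. if m = lead f \<and> n = lead g then lookup f m * lookup g n else 0)"
    unfolding mult_eq_sum_singles[of f g] lookup_sum
    by (intro sum.cong refl) (auto simp: lookup_single when_def *)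
  also have "\<dots> = (\<Sum>m\<in>keys f. if m = lead f then
      (\<Sum>n\<in>keys g. if n = lead g then lookup f (lead f) * lookup g (lead g) else 0) else 0)"
    (is "_ = (\<Sum>m\<in>_. ?R m)")
  proof (rule sum.cong[OF refl])
    fix m
    show "(\<Sum>n\<in>keys g. if m = lead f \<and> n = lead g then lookup f m * lookup g n else 0) = ?R m"
    proof (cases "m = lead f")
      case True
      show ?thesis unfolding True by (simp only: simp_thms if_True) (rule sum.cong, auto)
    next
      case False
      thus ?thesis by (simp only: simp_thms if_False sum.neutral_const)
    qed
  qed
  also have "\<dots> = lookup f (lead f) * lookup g (lead g)"
    by (simp add: sum.delta lead_in_keys assms)
  finally show ?thesis .
qed

lemma mpoly_mult_eq_0_iff: "(f :: ('x::finite, 'k::field) mpoly) * g = 0 \<longleftrightarrow> f = 0 \<or> g = 0"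
proof
  assume fg: "f * g = 0"
  show "f = 0 \<or> g = 0"
  proof (rule ccontr)
    assume "\<not> (f = 0 \<or> g = 0)"
    hence "lookup f (lead f) * lookup g (lead g) = 0" "f \<noteq> 0" "g \<noteq> 0"
      using lookup_mult_lead[of f g] fg by auto
    thus False using lead_in_keys[of f] lead_in_keys[of g] by (auto simp: in_keys_iff)
  qed
qed auto

lemma lead_mult:
  assumes "f \<noteq> 0" "g \<noteq> 0"
  shows "lead (f * g) = lead f + lead g"
proof (rule lead_eqI)
  show "lead f + lead g \<in> keys (f * g)"
    using lookup_mult_lead[OF assms] lead_in_keys[OF assms(1)] lead_in_keys[OF assms(2)]
    by (auto simp: in_keys_iff)
  fix n assume "n \<in> keys (f * g)"
  then obtain a b where "n = a + b" "a \<in> keys f" "b \<in> keys g" using keys_mult[of f g] by auto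
  thus "mkey n \<le> mkey (lead f + lead g)"
    using lead_max[OF assms(1), of a] lead_max[OF assms(2), of b] by (simp add: mkey_add add_mono)
qed

lemma lead_single: "c \<noteq> 0 \<Longrightarrow> lead (single m c) = m"
  by (rule lead_eqI) auto

section \<open>Homogeneous ideals\<close>

definition is_idl :: "'a::comm_ring_1 set \<Rightarrow> bool" where
  "is_idl J \<longleftrightarrow> 0 \<in> J \<and> (\<forall>f\<in>J. \<forall>g\<in>J. f + g \<in> J) \<and> (\<forall>f\<in>J. \<forall>c. c * f \<in> J)"

lemma is_idlI:
  "0 \<in> J \<Longrightarrow> (\<And>f g. f \<in> J \<Longrightarrow> g \<in> J \<Longrightarrow> f + g \<in> J) \<Longrightarrow> (\<And>f c. f \<in> J \<Longrightarrow> c * f \<in> J) \<Longrightarrow> is_idl J"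
  by (auto simp: is_idl_def)

lemma
  assumes "is_idl J"
  shows idl_0: "0 \<in> J" and idl_add: "f \<in> J \<Longrightarrow> g \<in> J \<Longrightarrow> f + g \<in> J"
    and idl_mult: "f \<in> J \<Longrightarrow> c * f \<in> J" and idl_mult2: "f \<in> J \<Longrightarrow> f * c \<in> J"
  using assms by (auto simp: is_idl_def mult.commute)

lemma idl_uminus: "is_idl J \<Longrightarrow> f \<in> J \<Longrightarrow> - f \<in> J"
  using idl_mult[of J f "- 1"] by simp

lemma idl_diff: "is_idl J \<Longrightarrow> f \<in> J \<Longrightarrow> g \<in> J \<Longrightarrow> f - g \<in> J"
  using idl_add[of J f "- g"] idl_uminus[of J g] by simp

lemma idl_sum: "is_idl J \<Longrightarrow> (\<And>i. i \<in> A \<Longrightarrow> f i \<in> J) \<Longrightarrow> sum f A \<in> J"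
  by (induction A rule: infinite_finite_induct) (auto intro: idl_add idl_0)

lemma idl_diff_cancel: "is_idl J \<Longrightarrow> f - g \<in> J \<Longrightarrow> g \<in> J \<Longrightarrow> f \<in> J"
  using idl_add[of J "f - g" g] by simp

lemma carrier_poly_ring [simp]:
  "carrier ring_of_type_algebra = UNIV"
  "x \<oplus>\<^bsub>ring_of_type_algebra\<^esub> y = x + y" "x \<otimes>\<^bsub>ring_of_type_algebra\<^esub> y = x * y"
  "\<zero>\<^bsub>ring_of_type_algebra\<^esub> = 0" "\<one>\<^bsub>ring_of_type_algebra\<^esub> = 1"
  by (simp_all add: ring_of_type_algebra_def)

lemma ideal_iff_is_idl: "ideal J ring_of_type_algebra \<longleftrightarrow> is_idl (J :: 'a::comm_ring_1 set)"
proof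
  assume "ideal J ring_of_type_algebra"
  then interpret ideal J "ring_of_type_algebra :: 'a ring" .
  show "is_idl J"
    using additive_subgroup.zero_closed[OF is_additive_subgroup]
      additive_subgroup.a_closed[OF is_additive_subgroup] I_l_closed
    by (intro is_idlI) auto
next
  assume J: "is_idl J"
  interpret cring "ring_of_type_algebra :: 'a ring" by (rule cring_from_type_algebra)
  show "ideal J ring_of_type_algebra"
  proof (rule idealI)
    show "subgroup J (add_monoid ring_of_type_algebra)"
    proof (rule add.subgroupI)
      show "J \<noteq> {}" using idl_0[OF J] by auto
      fix a assume a: "a \<in> J"
      have "\<ominus>\<^bsub>ring_of_type_algebra\<^esub> a = - a"
        by (rule minus_equality) auto
      thus "\<ominus>\<^bsub>ring_of_type_algebra\<^esub> a \<in> J"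
        using idl_uminus[OF J a] by simp
    qed (use idl_add[OF J] in auto)
  qed (use J ring_axioms in \<open>auto intro: idl_mult idl_mult2\<close>)
qed

lemma is_idl_genideal: "is_idl (Idl\<^bsub>ring_of_type_algebra\<^esub> (G :: 'a::comm_ring_1 set))"
  and genideal_base: "G \<subseteq> Idl\<^bsub>ring_of_type_algebra\<^esub> G"
  and genideal_least: "is_idl J \<Longrightarrow> G \<subseteq> J \<Longrightarrow> Idl\<^bsub>ring_of_type_algebra\<^esub> G \<subseteq> J"
proof -
  interpret cring "ring_of_type_algebra :: 'a ring" by (rule cring_from_type_algebra)
  show "is_idl (Idl\<^bsub>ring_of_type_algebra\<^esub> G)"
    using genideal_ideal[of G] by (simp add: ideal_iff_is_idl)
  show "G \<subseteq> Idl\<^bsub>ring_of_type_algebra\<^esub> G" by (rule genideal_self) simp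
  show "is_idl J \<Longrightarrow> G \<subseteq> J \<Longrightarrow> Idl\<^bsub>ring_of_type_algebra\<^esub> G \<subseteq> J"
    by (rule genideal_minimal) (simp_all add: ideal_iff_is_idl)
qed

text \<open>Closure under components, rather than generation by forms: in this shape homogeneity
  passes directly to colon ideals, to sums with a form and to unions of chains.\<close>

definition hidl :: "('x::finite, 'k::field) mpoly set \<Rightarrow> bool" where
  "hidl J \<longleftrightarrow> is_idl J \<and> (\<forall>f\<in>J. \<forall>d. hcomp d f \<in> J)"

lemma hidl_is_idl: "hidl J \<Longrightarrow> is_idl J"
  and hidl_hcomp: "hidl J \<Longrightarrow> f \<in> J \<Longrightarrow> hcomp d f \<in> J"
  by (auto simp: hidl_def)

lemma idl_hcomp_mult:
  assumes J: "is_idl J" and f: "\<And>d. hcomp d f \<in> J"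
  shows "hcomp d (c * f) \<in> J"
proof -
  obtain N where N: "c = (\<Sum>a<N. hcomp a c)" using sum_hcomp by blast
  have "hcomp d (c * f) = (\<Sum>a<N. hcomp d (hcomp a c * f))"
    by (subst N) (simp add: sum_distrib_right hcomp_sum)
  also have "\<dots> \<in> J"
    by (intro idl_sum[OF J]) (auto simp: hcomp_mult[OF hcomp_homog] intro: idl_mult[OF J] idl_0[OF J] f)
  finally show ?thesis .
qed

lemma idl_of_hcomps: "is_idl J \<Longrightarrow> (\<And>d. hcomp d f \<in> J) \<Longrightarrow> f \<in> J"
  by (metis idl_sum sum_hcomp)

text \<open>The polynomials all of whose components lie in \<open>I\<close> form an ideal; it
  contains the homogeneous generators, hence all of \<open>I\<close>.\<close>

lemma homogeneous_ideal_hidl: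
  assumes "homogeneous_ideal I" shows "hidl I"
proof -
  obtain G where G: "G \<subseteq> (\<Union>d. homog_part d)" "I = Idl\<^bsub>\<S>\<^esub> G" and I: "is_idl I"
    using assms by (auto simp: homogeneous_ideal_def ideal_iff_is_idl)
  let ?J = "{f. \<forall>d. hcomp d f \<in> I}"
  have "is_idl ?J"
    by (intro is_idlI) (auto simp: hcomp_add idl_0[OF I] intro: idl_add[OF I] idl_hcomp_mult[OF I])
  moreover have "G \<subseteq> ?J"
  proof
    fix f assume f: "f \<in> G"
    then obtain e where e: "f \<in> homog_part e" using G by auto
    have "f \<in> I" using f genideal_base[of G] G(2) by auto
    thus "f \<in> ?J" by (auto simp: hcomp_of_homog[OF e] idl_0[OF I])
  qed
  ultimately have "I \<subseteq> ?J" unfolding G(2) by (rule genideal_least)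
  thus ?thesis using I by (auto simp: hidl_def)
qed

section \<open>Adjoining elements to an ideal\<close>

definition adj :: "'a::comm_ring_1 set \<Rightarrow> 'a \<Rightarrow> 'a set" where
  "adj J f = {g + c * f | g c. g \<in> J}"

text \<open>The generators enter one at a time, so that an induction on \<open>n\<close> adds a
  single form per step. For \<open>J = {0}\<close> this is the ideal generated by the first
  \<open>n\<close> terms of \<open>y\<close>.\<close>

primrec adjn :: "'a::comm_ring_1 set \<Rightarrow> (nat \<Rightarrow> 'a) \<Rightarrow> nat \<Rightarrow> 'a set" where
  "adjn J y 0 = J"
| "adjn J y (Suc n) = adj (adjn J y n) (y n)"

lemma adjI: "g \<in> J \<Longrightarrow> g + c * f \<in> adj J f"
  by (auto simp: adj_def)

lemma adjE: "h \<in> adj J f \<Longrightarrow> (\<And>g c. g \<in> J \<Longrightarrow> h = g + c * f \<Longrightarrow> P) \<Longrightarrow> P"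
  by (auto simp: adj_def)

lemma is_idl_adj: assumes "is_idl J" shows "is_idl (adj J f)"
proof (rule is_idlI)
  show "0 \<in> adj J f" using adjI[OF idl_0[OF assms], of 0 f] by simp
next
  fix g h assume "g \<in> adj J f" "h \<in> adj J f"
  thus "g + h \<in> adj J f"
    by (elim adjE) (metis (no_types, lifting) adjI assms idl_add add.assoc add.left_commute ring_distribs(2))
next
  fix g c assume "g \<in> adj J f"
  thus "c * g \<in> adj J f"
    by (elim adjE) (metis adjI assms idl_mult mult.assoc ring_distribs(1))
qed

lemma subset_adj: "J \<subseteq> adj J f"
  using adjI[where c = 0 and f = f] by fastforce

lemma in_adj: "is_idl J \<Longrightarrow> c * f \<in> adj J f"
  using adjI[OF idl_0, of J c f] by simp

lemma in_adj1: "is_idl J \<Longrightarrow> f \<in> adj J f"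
  using in_adj[of J 1 f] by simp

lemma adj_least: "is_idl K \<Longrightarrow> J \<subseteq> K \<Longrightarrow> f \<in> K \<Longrightarrow> adj J f \<subseteq> K"
  by (auto simp: adj_def intro!: idl_add idl_mult)

lemma hidl_adj:
  assumes "hidl J" "f \<in> homog_part e" shows "hidl (adj J f)"
  unfolding hidl_def
proof (intro conjI ballI allI)
  show "is_idl (adj J f)" using assms by (simp add: hidl_is_idl is_idl_adj)
  fix h d assume "h \<in> adj J f"
  then obtain g c where g: "g \<in> J" "h = g + c * f" by (rule adjE)
  have "hcomp d h = hcomp d g + (if e \<le> d then hcomp (d - e) c else 0) * f"
    using hcomp_mult[OF assms(2), of d c] by (simp add: g(2) hcomp_add mult.commute)
  thus "hcomp d h \<in> adj J f" using hidl_hcomp[OF assms(1) g(1)] by (metis adjI)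
qed

lemma is_idl_adjn: "is_idl J \<Longrightarrow> is_idl (adjn J y n)"
  by (induction n) (auto intro: is_idl_adj)

lemma hidl_adjn: "hidl J \<Longrightarrow> (\<And>i. i < n \<Longrightarrow> y i \<in> homog_part (e i)) \<Longrightarrow> hidl (adjn J y n)"
  by (induction n) (auto intro: hidl_adj)

lemma subset_adjn: "J \<subseteq> adjn J y n"
  using subset_adj by (induction n) fastforce+

lemma adjn_mono: "i \<le> n \<Longrightarrow> adjn J y i \<subseteq> adjn J y n"
  using subset_adj by (induction n) (fastforce simp: le_Suc_eq)+

lemma in_adjn: "is_idl J \<Longrightarrow> i < n \<Longrightarrow> y i \<in> adjn J y n"
  using adjn_mono[of "Suc i" n J y] in_adj1[OF is_idl_adjn, of J "y i" y i] by auto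

lemma adjn_least: "is_idl K \<Longrightarrow> J \<subseteq> K \<Longrightarrow> (\<And>i. i < n \<Longrightarrow> y i \<in> K) \<Longrightarrow> adjn J y n \<subseteq> K"
proof (induction n)
  case (Suc n)
  thus ?case using adj_least[of K "adjn J y n" "y n"] by simp
qed auto

lemma adjn_cong: "(\<And>i. i < n \<Longrightarrow> y i = z i) \<Longrightarrow> adjn J y n = adjn J z n"
  by (induction n) auto

lemma is_idl_zero: "is_idl {0}"
  by (auto simp: is_idl_def)

lemma hidl_zero: "hidl {0}"
  by (auto simp: hidl_def is_idl_zero)

lemma adjn_zero_sum: "f \<in> adjn {0} y n \<Longrightarrow> \<exists>c. f = (\<Sum>i<n. c i * y i)"
proof (induction n arbitrary: f)
  case (Suc n)
  then obtain g d where g: "g \<in> adjn {0} y n" "f = g + d * y n" by (auto elim: adjE)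
  then obtain c where "g = (\<Sum>i<n. c i * y i)" using Suc by blast
  hence "f = (\<Sum>i<Suc n. (if i = n then d else c i) * y i)" using g by simp
  thus ?case by (rule exI[of _ "\<lambda>i. if i = n then d else c i"])
qed auto

lemma add_idl_genideal:
  assumes I: "is_idl I"
  shows "I <+>\<^bsub>ring_of_type_algebra\<^esub> Idl\<^bsub>ring_of_type_algebra\<^esub> (y ` {..<n}) = adjn I y n" (is "?L = _")
proof
  let ?G = "Idl\<^bsub>ring_of_type_algebra\<^esub> (y ` {..<n})"
  have L: "?L = {a + b | a b. a \<in> I \<and> b \<in> ?G}" by (auto simp: set_add_def')
  have "?G \<subseteq> adjn I y n"
    by (rule genideal_least[OF is_idl_adjn[OF I]]) (auto intro: in_adjn[OF I])
  thus "?L \<subseteq> adjn I y n" unfolding L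
    using subset_adjn[of I y n] by (auto intro!: idl_add[OF is_idl_adjn[OF I]])
  interpret cring "ring_of_type_algebra :: 'a ring" by (rule cring_from_type_algebra)
  have "is_idl ?L"
    using add_ideals[of I ?G] I is_idl_genideal[of "y ` {..<n}"] by (simp add: ideal_iff_is_idl)
  moreover have "I \<subseteq> ?L" unfolding L using idl_0[OF is_idl_genideal[of "y ` {..<n}"]] by force
  moreover have "y i \<in> ?L" if "i < n" for i
  proof -
    have "y i \<in> ?G" using that genideal_base[of "y ` {..<n}"] by auto
    moreover have "y i = 0 + y i" by simp
    ultimately show ?thesis unfolding L using idl_0[OF I] by blast
  qed
  ultimately show "adjn I y n \<subseteq> ?L" by (rule adjn_least)
qed

text \<open>Every monomial other than \<open>1\<close> is divisible by a variable. Minimality of a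
  resolution thus becomes the vanishing of the constant terms of matrix entries.\<close>

lemma in_maximal_iff:
  "f \<in> Idl\<^bsub>\<S>\<^esub> (range mpoly_var) \<longleftrightarrow> lookup (f :: ('x::finite, 'k::field) mpoly) 0 = 0"
proof
  let ?J = "{f :: ('x, 'k) mpoly. lookup f 0 = 0}"
  have "lookup (c * f) 0 = 0" if "lookup f 0 = 0" for c f :: "('x, 'k) mpoly"
  proof (rule ccontr)
    assume "\<not> ?thesis"
    hence "0 \<in> keys (c * f)" by (simp add: in_keys_iff)
    then obtain a b where "0 = a + b" "b \<in> keys f" using keys_mult[of c f] by auto
    moreover from this have "b = 0" by (metis add_is_0 mon_deg_0 mon_deg_add mon_deg_eq_0_iff)
    ultimately show False using that by (auto simp: in_keys_iff)
  qed
  hence "is_idl ?J" by (intro is_idlI) (auto simp: lookup_add)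
  moreover have "range mpoly_var \<subseteq> ?J"
    using lookup_homog_eq_0[OF homog_part_var, of 0] by auto
  ultimately have "Idl\<^bsub>\<S>\<^esub> (range mpoly_var) \<subseteq> ?J" by (rule genideal_least)
  thus "f \<in> Idl\<^bsub>\<S>\<^esub> (range mpoly_var) \<Longrightarrow> lookup f 0 = 0" by auto
next
  assume f: "lookup f 0 = 0"
  note M = is_idl_genideal[of "range mpoly_var :: ('x, 'k) mpoly set"]
  have "single m (lookup f m) \<in> Idl\<^bsub>\<S>\<^esub> (range mpoly_var)" if "m \<in> keys f" for m
  proof -
    have "m \<noteq> 0" using that f by (auto simp: in_keys_iff)
    then obtain x where x: "lookup m x \<noteq> 0" by (metis poly_mapping_eqI lookup_zero)
    have "m = (m - single x 1) + single x 1"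
      using x by (intro poly_mapping_eqI) (auto simp: lookup_add lookup_minus lookup_single when_def)
    hence "single m (lookup f m) = single (m - single x 1) (lookup f m) * mpoly_var x"
      by (metis mpoly_var_def mult_single mult.right_neutral)
    moreover have "mpoly_var x \<in> Idl\<^bsub>\<S>\<^esub> (range mpoly_var :: ('x, 'k) mpoly set)"
      by (rule subsetD[OF genideal_base rangeI])
    ultimately show ?thesis by (metis idl_mult[OF M])
  qed
  hence "(\<Sum>m\<in>keys f. single m (lookup f m)) \<in> Idl\<^bsub>\<S>\<^esub> (range mpoly_var)"
    by (rule idl_sum[OF M])
  thus "f \<in> Idl\<^bsub>\<S>\<^esub> (range mpoly_var)" by (simp add: sum_singles)
qed

subsection \<open>The Noetherian property\<close>

lemma mono_subseq_nat:
  fixes s :: "nat \<Rightarrow> nat"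
  obtains r :: "nat \<Rightarrow> nat" where "strict_mono r" "mono (\<lambda>n. s (r n))"
proof -
  obtain r :: "nat \<Rightarrow> nat" where r: "strict_mono r" "monoseq (\<lambda>n. s (r n))"
    using seq_monosub[of s] by auto
  show thesis
  proof (cases "incseq (\<lambda>n. s (r n))")
    case True thus thesis using r that by blast
  next
    case False
    hence dec: "decseq (\<lambda>n. s (r n))" using r(2) by (simp add: monoseq_iff)
    \<comment> \<open>A decreasing sequence of naturals is constant from any index at which it takes
      its least value.\<close>
    define i where "i = (ARG_MIN (\<lambda>n. s (r n)) n. True)"
    have i: "s (r i) \<le> s (r n)" for n
      unfolding i_def by (rule arg_min_nat_le) simp
    have "s (r (n + i)) = s (r i)" for n
      using dec i by (intro antisym) (auto simp: decseq_def)
    hence "mono (\<lambda>n. s (r (n + i)))" by (simp add: mono_def)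
    moreover have "strict_mono (\<lambda>n. r (n + i))"
      using r(1) by (auto simp: strict_mono_def)
    ultimately show thesis using that[of "\<lambda>n. r (n + i)"] by blast
  qed
qed

lemma mono_subseq_nat_family:
  fixes s :: "nat \<Rightarrow> 'x \<Rightarrow> nat"
  assumes "finite A"
  shows "\<exists>r :: nat \<Rightarrow> nat. strict_mono r \<and> (\<forall>x\<in>A. mono (\<lambda>n. s (r n) x))"
  using assms
proof (induction A rule: finite_induct)
  case empty show ?case by (rule exI[of _ id]) (auto simp: strict_mono_def)
next
  case (insert x A)
  then obtain r :: "nat \<Rightarrow> nat" where r: "strict_mono r" "\<forall>x\<in>A. mono (\<lambda>n. s (r n) x)" by blast
  obtain t :: "nat \<Rightarrow> nat" where t: "strict_mono t" "mono (\<lambda>n. s (r (t n)) x)"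
    using mono_subseq_nat[of "\<lambda>n. s (r n) x"] by blast
  have "mono (\<lambda>n. s (r (t n)) z)" if "z \<in> A" for z
    using r(2) t(1) that by (auto simp: mono_def strict_mono_less_eq)
  moreover have "strict_mono (\<lambda>n. r (t n))" using r(1) t(1) by (auto simp: strict_mono_def)
  ultimately show ?case using t(2) by (intro exI[of _ "\<lambda>n. r (t n)"]) auto
qed

text \<open>Without a finite base, picking greedily a monomial (\<open>nx\<close>) not divisible by
  those picked before (\<open>S n\<close>) never stops. A subsequence of the picks is monotone in
  every exponent, so its first term divides the second.\<close>

lemma dickson:
  fixes A :: "('x::finite \<Rightarrow>\<^sub>0 nat) set"
  shows "\<exists>B\<subseteq>A. finite B \<and> (\<forall>a\<in>A. \<exists>b\<in>B. \<exists>c. a = b + c)"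
proof (rule ccontr)
  assume "\<not> ?thesis"
  hence nb: "\<exists>a\<in>A. \<forall>b\<in>B. \<forall>c. a \<noteq> b + c" if "finite B" "B \<subseteq> A" for B using that by metis
  define nx where "nx B = (SOME a. a \<in> A \<and> (\<forall>b\<in>B. \<forall>c. a \<noteq> b + c))" for B
  have nx: "nx B \<in> A" "b \<in> B \<Longrightarrow> nx B \<noteq> b + c" if "finite B" "B \<subseteq> A" for B b c
    using someI_ex[of "\<lambda>a. a \<in> A \<and> (\<forall>b\<in>B. \<forall>c. a \<noteq> b + c)"] nb[OF that] unfolding nx_def by blast+
  define S where "S n = rec_nat {} (\<lambda>_ B. insert (nx B) B) n" for n :: nat
  have S0: "S 0 = {}" and SS: "S (Suc n) = insert (nx (S n)) (S n)" for n by (simp_all add: S_def)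
  have S: "finite (S n) \<and> S n \<subseteq> A" for n
    by (induction n) (auto simp: S0 SS nx)
  have Smono: "S m \<subseteq> S n" if "m \<le> n" for m n
    using that by (induction n) (auto simp: le_Suc_eq SS)
  obtain r :: "nat \<Rightarrow> nat" where r: "strict_mono r" "\<forall>x\<in>UNIV. mono (\<lambda>n. lookup (nx (S (r n))) x)"
    using mono_subseq_nat_family[of UNIV "\<lambda>n. lookup (nx (S n))"] by auto
  let ?a = "nx (S (r 0))" and ?b = "nx (S (r 1))"
  have "lookup ?a x \<le> lookup ?b x" for x using r(2) by (auto simp: mono_def)
  hence "?b = ?a + (?b - ?a)"
    by (intro poly_mapping_eqI) (simp add: lookup_add lookup_minus)
  moreover have "?a \<in> S (r 1)"
    using Smono[of "Suc (r 0)" "r 1"] r(1) by (auto simp: SS strict_mono_def Suc_le_eq)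
  ultimately show False using nx(2) S by blast
qed

text \<open>Division within one degree: subtracting a multiple of \<open>h\<close> cancels the
  leading monomial of \<open>f\<close>. As only finitely many monomials have degree
  \<open>d\<close>, the number of those below the leading one is a measure that decreases.\<close>

lemma hidl_eq_of_leads:
  assumes J: "hidl (J :: ('x::finite, 'k::field) mpoly set)" "hidl J'" and "J \<subseteq> J'"
    and h: "\<And>f d. f \<in> J' \<Longrightarrow> f \<in> homog_part d \<Longrightarrow> f \<noteq> 0 \<Longrightarrow>
      \<exists>h\<in>J \<inter> homog_part d. h \<noteq> 0 \<and> lead h = lead f"
  shows "J' = J"
proof
  note idl = hidl_is_idl[OF J(1)] hidl_is_idl[OF J(2)]
  let ?below = "\<lambda>d f. {m :: 'x \<Rightarrow>\<^sub>0 nat. mon_deg m = d \<and> mkey m < mkey (lead f)}"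
  have "f \<in> J" if "f \<in> J'" "f \<in> homog_part d" for f d
    using that
  proof (induction "card (?below d f)" arbitrary: f rule: less_induct)
    case less
    show ?case
    proof (cases "f = 0")
      case True thus ?thesis by (simp add: idl_0[OF idl(1)])
    next
      case False
      then obtain h where h: "h \<in> J" "h \<in> homog_part d" "h \<noteq> 0" "lead h = lead f"
        using h less.prems by blast
      define k where "k = lookup f (lead f) / lookup h (lead f)"
      have hk: "lookup h (lead f) \<noteq> 0" using lead_in_keys[OF h(3)] h(4) by (simp add: in_keys_iff)
      define g where "g = f - mpoly_const k * h"
      have g0: "lookup g (lead f) = 0" using hk by (simp add: g_def lookup_minus k_def)
      have g: "g \<in> J'" "g \<in> homog_part d"
        using less.prems h assms(3)
        by (auto simp: g_def intro!: idl_diff[OF idl(2)] idl_mult[OF idl(2)] homog_part_diff homog_part_const_mult)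
      have "g \<in> J"
      proof (cases "g = 0")
        case True thus ?thesis by (simp add: idl_0[OF idl(1)])
      next
        case g_nz: False
        have "lead g \<in> keys f \<or> lead g \<in> keys h"
          using lead_in_keys[OF g_nz] by (auto simp: in_keys_iff g_def lookup_minus)
        hence "mkey (lead g) \<le> mkey (lead f)"
          using lead_max[OF False] lead_max[OF h(3)] h(4) by auto
        moreover have "lead g \<noteq> lead f" using lead_in_keys[OF g_nz] g0 by (auto simp: in_keys_iff)
        hence "mkey (lead g) \<noteq> mkey (lead f)" using inj_mkey by (auto dest: injD)
        ultimately have lt: "mkey (lead g) < mkey (lead f)" by simp
        have "mon_deg (lead g) = d"
          using lead_in_keys[OF g_nz] g(2) by (auto simp: homog_part_def)
        hence "lead g \<in> ?below d f" using lt by simp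
        moreover have "lead g \<notin> ?below d g" by simp
        moreover have "?below d g \<subseteq> ?below d f"
          using lt by (auto intro: order_less_trans)
        ultimately have "?below d g \<subset> ?below d f"
          by blast
        moreover have "finite (?below d f)"
          by (rule finite_subset[OF _ finite_mon_deg[of d]]) auto
        ultimately have "card (?below d g) < card (?below d f)"
          by (intro psubset_card_mono)
        thus ?thesis using less.hyps g by blast
      qed
      moreover have "f = g + mpoly_const k * h" by (simp add: g_def)
      ultimately show ?thesis using h(1) idl_add[OF idl(1)] idl_mult[OF idl(1)] by metis
    qed
  qed
  thus "J' \<subseteq> J" using hidl_hcomp[OF J(2)] idl_of_hcomps[OF idl(1)] by blast
qed fact

text \<open>A Groebner basis: Dickson's lemma gives finitely many leading monomials of forms in
  \<open>J\<close> that divide all others, and the corresponding forms generate by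
  \<open>hidl_eq_of_leads\<close>.\<close>

lemma hidl_finitely_generated:
  assumes J: "hidl (J :: ('a::finite, 'b::field) mpoly set)"
  obtains n g e where "\<And>i. i < n \<Longrightarrow> g i \<in> homog_part (e i)" "adjn {0} g n = J"
proof -
  define A where "A = {lead f | f d. f \<in> J \<and> f \<in> homog_part d \<and> f \<noteq> 0}"
  obtain B where B: "finite B" "B \<subseteq> A" "\<And>a. a \<in> A \<Longrightarrow> \<exists>b\<in>B. \<exists>c. a = b + c"
    using dickson[of A] by metis
  have "\<forall>b\<in>B. \<exists>f. f \<in> J \<and> f \<in> homog_part (mon_deg b) \<and> f \<noteq> 0 \<and> lead f = b"
  proof
    fix b assume "b \<in> B"
    then obtain f d where f: "f \<in> J" "f \<in> homog_part d" "f \<noteq> 0" "b = lead f"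
      using B(2) by (auto simp: A_def)
    moreover have "mon_deg b = d" using f lead_in_keys[of f] by (auto simp: homog_part_def)
    ultimately show "\<exists>f. f \<in> J \<and> f \<in> homog_part (mon_deg b) \<and> f \<noteq> 0 \<and> lead f = b" by auto
  qed
  then obtain F where F: "\<And>b. b \<in> B \<Longrightarrow> F b \<in> J \<and> F b \<in> homog_part (mon_deg b) \<and> F b \<noteq> 0 \<and> lead (F b) = b"
    by metis
  obtain \<beta> where \<beta>: "bij_betw \<beta> {0..<card B} B"
    using ex_bij_betw_nat_finite[OF B(1)] by blast
  have \<beta>B: "i < card B \<Longrightarrow> \<beta> i \<in> B" for i using \<beta> by (auto simp: bij_betw_def)
  define g where "g i = F (\<beta> i)" for i
  let ?J0 = "adjn {0} g (card B)"
  have hom: "g i \<in> homog_part (mon_deg (\<beta> i))" if "i < card B" for i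
    using F \<beta>B that by (simp add: g_def)
  have J0: "hidl ?J0" by (rule hidl_adjn[OF hidl_zero hom])
  have "?J0 \<subseteq> J"
    using J F \<beta>B by (intro adjn_least) (auto simp: g_def hidl_is_idl idl_0)
  moreover have "\<exists>h\<in>?J0 \<inter> homog_part d. h \<noteq> 0 \<and> lead h = lead f"
    if f: "f \<in> J" "f \<in> homog_part d" "f \<noteq> 0" for f d
  proof -
    have "lead f \<in> A" using f by (auto simp: A_def)
    then obtain b c where b: "b \<in> B" "lead f = b + c" using B(3) by blast
    then obtain i where i: "i < card B" "\<beta> i = b"
      using \<beta> by (metis atLeastLessThan_iff bij_betw_iff_bijections)
    let ?h = "single c 1 * F b"
    have c: "single c (1 :: 'b) \<noteq> 0" by (metis keys_single keys_zero insert_not_empty zero_neq_one)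
    have "F b \<in> ?J0" using in_adjn[OF is_idl_zero i(1), of g] by (simp add: g_def i)
    hence "?h \<in> ?J0" by (rule idl_mult[OF hidl_is_idl[OF J0]])
    moreover have "lead ?h = lead f" using F[OF b(1)] b(2)
      by (subst lead_mult[OF c]) (auto simp: lead_single add.commute)
    moreover have "mon_deg (lead f) = d" using f lead_in_keys[of f] by (auto simp: homog_part_def)
    hence "mon_deg c + mon_deg b = d" by (simp add: b(2) mon_deg_add)
    hence "?h \<in> homog_part d"
      using homog_part_mult[OF homog_part_single[of c 1], of "F b" "mon_deg b"] F[OF b(1)] by auto
    moreover have "?h \<noteq> 0" using F[OF b(1)] c by (auto simp: mpoly_mult_eq_0_iff)
    ultimately show ?thesis by auto
  qed
  ultimately have "J = ?J0" by (intro hidl_eq_of_leads[OF J0 J])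
  thus thesis using that[of "card B" g "\<lambda>i. mon_deg (\<beta> i)"] hom by simp
qed

text \<open>The ascending chain condition, put as well-foundedness of the reversed inclusion so that
  it can serve as a rule for Noetherian induction.\<close>

lemma wf_hidl: "wf {(J', J). hidl J \<and> hidl J' \<and> J \<subset> (J' :: ('x::finite, 'k::field) mpoly set)}"
  unfolding wf_iff_no_infinite_down_chain
proof
  assume "\<exists>C. \<forall>i. (C (Suc i), C i) \<in> {(J', J). hidl J \<and> hidl J' \<and> J \<subset> (J' :: ('x, 'k) mpoly set)}"
  then obtain C :: "nat \<Rightarrow> ('x, 'k) mpoly set" where C: "\<And>i. hidl (C i)" "\<And>i. C i \<subset> C (Suc i)"
    by blast
  have mono: "C i \<subseteq> C j" if "i \<le> j" for i j
    using that C(2) by (induction j) (auto simp: le_Suc_eq)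
  have "hidl (\<Union>i. C i)"
    unfolding hidl_def
  proof (intro conjI is_idlI)
    fix f g assume "f \<in> (\<Union>i. C i)" "g \<in> (\<Union>i. C i)"
    then obtain i j where "f \<in> C i" "g \<in> C j" by blast
    hence "f \<in> C (max i j)" "g \<in> C (max i j)" using mono[of i "max i j"] mono[of j "max i j"] by auto
    thus "f + g \<in> (\<Union>i. C i)" using idl_add[OF hidl_is_idl[OF C(1)]] by blast
  next
    show "\<forall>f\<in>\<Union>i. C i. \<forall>d. hcomp d f \<in> (\<Union>i. C i)" using C(1) hidl_hcomp by blast
  qed (use C(1) in \<open>auto intro: idl_0 idl_mult hidl_is_idl\<close>)
  then obtain n g e where g: "adjn {0} g n = (\<Union>i. C i)"
    using hidl_finitely_generated by (metis (no_types, lifting))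
  have "\<exists>m. \<forall>i<n. g i \<in> C m"
  proof -
    have "\<exists>m. g i \<in> C m" if "i < n" for i using in_adjn[OF is_idl_zero that, of g] g by auto
    then obtain m where m: "\<And>i. i < n \<Longrightarrow> g i \<in> C (m i)" by metis
    have "g i \<in> C (Max (m ` {..<n}))" if "i < n" for i
      using m[OF that] mono[of "m i" "Max (m ` {..<n})"] that by auto
    thus ?thesis by blast
  qed
  then obtain m where "\<forall>i<n. g i \<in> C m" by blast
  hence "(\<Union>i. C i) \<subseteq> C m"
    unfolding g[symmetric] using C(1) by (intro adjn_least) (auto simp: hidl_is_idl idl_0)
  thus False using C(2)[of m] by blast
qed

section \<open>Graded submodules of free modules and minimal resolutions\<close>

text \<open>\<open>gcomp a e v\<close> is the component of degree \<open>e\<close> of a vector \<open>v\<close> in the direct sum of the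
  \<open>S(- a q)\<close>.\<close>

definition gcomp :: "(nat \<Rightarrow> nat) \<Rightarrow> nat \<Rightarrow> (nat \<Rightarrow> ('x::finite, 'k::field) mpoly) \<Rightarrow> nat \<Rightarrow> ('x, 'k) mpoly" where
  "gcomp a e v = (\<lambda>q. if a q \<le> e then hcomp (e - a q) (v q) else 0)"

text \<open>The case distinction matters: subtraction is truncated, so
  \<open>homog_part (e - a q)\<close> alone would admit constants where \<open>S(- a q)\<close> is
  zero in degree \<open>e\<close>.\<close>

definition hvec :: "(nat \<Rightarrow> nat) \<Rightarrow> nat \<Rightarrow> (nat \<Rightarrow> ('x::finite, 'k::field) mpoly) \<Rightarrow> bool" where
  "hvec a e v \<longleftrightarrow> (\<forall>q. v q \<in> (if a q \<le> e then homog_part (e - a q) else {0}))"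

lemma hvecD: "hvec a e v \<Longrightarrow> a q \<le> e \<Longrightarrow> v q \<in> homog_part (e - a q)"
  and hvecD0: "hvec a e v \<Longrightarrow> \<not> a q \<le> e \<Longrightarrow> v q = 0"
  unfolding hvec_def by (metis, metis singletonD)

lemma hvec_gcomp: "hvec a e (gcomp a e v)"
  by (simp add: hvec_def gcomp_def)

lemma gcomp_hvec: "hvec a e v \<Longrightarrow> gcomp a e v = v"
  by (auto simp: gcomp_def hcomp_of_homog_same fun_eq_iff hvecD hvecD0)

lemma hvec_diff: "hvec a e v \<Longrightarrow> hvec a e w \<Longrightarrow> hvec a e (\<lambda>p. v p - w p)"
  using hvecD[of a e v] hvecD[of a e w] hvecD0[of a e v] hvecD0[of a e w]
  by (simp add: hvec_def[of a e "\<lambda>p. v p - w p"] homog_part_diff)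

lemma hvec_smult:
  assumes "hvec a e v" "f \<in> homog_part d" shows "hvec a (e + d) (\<lambda>p. f * v p)"
  unfolding hvec_def
proof
  fix q show "f * v q \<in> (if a q \<le> e + d then homog_part (e + d - a q) else {0})"
  proof (cases "a q \<le> e")
    case True
    hence "v q \<in> homog_part (e - a q)" using assms(1) by (auto simp: hvec_def split: if_splits)
    hence "f * v q \<in> homog_part (d + (e - a q))" by (rule homog_part_mult[OF assms(2)])
    moreover have "d + (e - a q) = e + d - a q" using True by simp
    ultimately show ?thesis using True by simp
  next
    case False
    hence "v q = 0" using assms(1) by (auto simp: hvec_def split: if_splits)
    thus ?thesis by simp
  qed
qed

lemma gcomp_diff: "gcomp a e (\<lambda>p. v p - w p) = (\<lambda>p. gcomp a e v p - gcomp a e w p)"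
  by (auto simp: gcomp_def hcomp_add hcomp_diff)

lemma gcomp_smult:
  assumes "f \<in> homog_part d"
  shows "gcomp a (e + d) (\<lambda>p. f * v p) = (\<lambda>p. f * gcomp a e v p)"
proof
  fix q show "gcomp a (e + d) (\<lambda>p. f * v p) q = f * gcomp a e v q"
  proof (cases "a q \<le> e")
    case True
    hence "e + d - a q - d = e - a q" by simp
    thus ?thesis using True by (simp add: gcomp_def hcomp_mult[OF assms])
  next
    case False
    thus ?thesis by (auto simp: gcomp_def hcomp_mult[OF assms])
  qed
qed

lemma gcomp_free_module: "v \<in> free_module n \<Longrightarrow> gcomp a e v \<in> free_module n"
  by (auto simp: free_module_def gcomp_def)

lemma free_module_add: "v \<in> free_module n \<Longrightarrow> w \<in> free_module n \<Longrightarrow> (\<lambda>p. v p + w p) \<in> free_module n"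
  and free_module_diff: "v \<in> free_module n \<Longrightarrow> w \<in> free_module n \<Longrightarrow> (\<lambda>p. v p - w p) \<in> free_module n"
  and free_module_smult: "v \<in> free_module n \<Longrightarrow> (\<lambda>p. c * v p) \<in> free_module n"
  and free_module_0: "(\<lambda>p. 0) \<in> free_module n"
  by (auto simp: free_module_def)

lemma matrix_map_free_module: "matrix_map n s D v \<in> free_module n"
  by (auto simp: matrix_map_def free_module_def)

lemma matrix_map_add: "matrix_map n s D (\<lambda>p. v p + w p) = (\<lambda>p. matrix_map n s D v p + matrix_map n s D w p)"
  and matrix_map_diff: "matrix_map n s D (\<lambda>p. v p - w p) = (\<lambda>p. matrix_map n s D v p - matrix_map n s D w p)"
  and matrix_map_smult: "matrix_map n s D (\<lambda>p. c * v p) = (\<lambda>p. c * matrix_map n s D v p)"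
  and matrix_map_0: "matrix_map n s D (\<lambda>p. 0) = (\<lambda>p. 0)"
  by (auto simp: matrix_map_def ring_distribs sum.distrib sum_subtractf sum_distrib_left mult.left_commute)

definition graded_matrix :: "nat \<Rightarrow> (nat \<Rightarrow> nat) \<Rightarrow> nat \<Rightarrow> (nat \<Rightarrow> nat) \<Rightarrow>
    (nat \<Rightarrow> nat \<Rightarrow> ('x::finite, 'k::field) mpoly) \<Rightarrow> bool" where
  "graded_matrix n a s b D \<longleftrightarrow>
    (\<forall>p<n. \<forall>q<s. D p q \<in> (if a p \<le> b q then homog_part (b q - a p) else {0}))"

lemma gcomp_matrix_map:
  assumes "graded_matrix n a s b D"
  shows "gcomp a e (matrix_map n s D v) = matrix_map n s D (gcomp b e v)"
proof
  fix p
  have *: "(if a p \<le> e then hcomp (e - a p) (D p q * v q) else 0) = D p q * gcomp b e v q"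
    if "p < n" "q < s" for q
  proof (cases "a p \<le> b q")
    case True
    hence D: "D p q \<in> homog_part (b q - a p)"
      using assms that by (auto simp: graded_matrix_def split: if_splits)
    show ?thesis
    proof (cases "b q \<le> e")
      case be: True
      have "e - a p - (b q - a p) = e - b q" using be True by simp
      thus ?thesis using be True by (simp add: gcomp_def hcomp_mult[OF D])
    next
      case False
      thus ?thesis using True by (auto simp: gcomp_def hcomp_mult[OF D])
    qed
  next
    case False
    hence "D p q = 0" using assms that by (auto simp: graded_matrix_def split: if_splits)
    thus ?thesis by simp
  qed
  show "gcomp a e (matrix_map n s D v) p = matrix_map n s D (gcomp b e v) p"
  proof (cases "p < n")
    case True
    have "gcomp a e (matrix_map n s D v) p
        = (\<Sum>q<s. if a p \<le> e then hcomp (e - a p) (D p q * v q) else 0)"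
      using True by (simp add: gcomp_def matrix_map_def hcomp_sum)
    also have "\<dots> = (\<Sum>q<s. D p q * gcomp b e v q)" using * True by (intro sum.cong) auto
    finally show ?thesis using True by (simp add: matrix_map_def)
  qed (simp add: gcomp_def matrix_map_def)
qed

section \<open>Finite generation of graded submodules\<close>

definition gsubmod :: "nat \<Rightarrow> (nat \<Rightarrow> nat) \<Rightarrow> (nat \<Rightarrow> ('x::finite, 'k::field) mpoly) set \<Rightarrow> bool" where
  "gsubmod n a M \<longleftrightarrow> M \<subseteq> free_module n \<and> (\<lambda>_. 0) \<in> M \<and>
    (\<forall>v\<in>M. \<forall>w\<in>M. (\<lambda>p. v p + w p) \<in> M) \<and> (\<forall>v\<in>M. \<forall>c. (\<lambda>p. c * v p) \<in> M) \<and>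
    (\<forall>v\<in>M. \<forall>e. gcomp a e v \<in> M)"

lemma
  assumes "gsubmod n a M"
  shows gsubmod_free: "v \<in> M \<Longrightarrow> v \<in> free_module n"
    and gsubmod_0: "(\<lambda>_. 0) \<in> M"
    and gsubmod_add: "v \<in> M \<Longrightarrow> w \<in> M \<Longrightarrow> (\<lambda>p. v p + w p) \<in> M"
    and gsubmod_smult: "v \<in> M \<Longrightarrow> (\<lambda>p. c * v p) \<in> M"
    and gsubmod_gcomp: "v \<in> M \<Longrightarrow> gcomp a e v \<in> M"
  using assms by (auto simp: gsubmod_def)

lemma gsubmod_sum:
  assumes M: "gsubmod n a M" and "finite T" "\<And>i. i \<in> T \<Longrightarrow> G i \<in> M"
  shows "(\<lambda>p. \<Sum>i\<in>T. c i * G i p) \<in> M"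
  using assms(2,3)
proof (induction T rule: finite_induct)
  case empty thus ?case by (simp add: gsubmod_0[OF M])
next
  case (insert x T)
  thus ?case using gsubmod_add[OF M gsubmod_smult[OF M, of "G x" "c x"], of "\<lambda>p. \<Sum>i\<in>T. c i * G i p"]
    by simp
qed

lemma gsubmod_diff:
  assumes M: "gsubmod n a M" "v \<in> M" "w \<in> M" shows "(\<lambda>p. v p - w p) \<in> M"
  using gsubmod_add[OF M(1,2) gsubmod_smult[OF M(1,3), of "- 1"]] by simp

text \<open>The index set is an arbitrary finite set and not an initial segment, so that a single
  redundant generator can be deleted.\<close>

definition hgens :: "(nat \<Rightarrow> nat) \<Rightarrow> (nat \<Rightarrow> ('x::finite, 'k::field) mpoly) set \<Rightarrow> nat set \<Rightarrow>
    (nat \<Rightarrow> nat) \<Rightarrow> (nat \<Rightarrow> nat \<Rightarrow> ('x, 'k) mpoly) \<Rightarrow> bool" where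
  "hgens a M T b G \<longleftrightarrow> finite T \<and> (\<forall>i\<in>T. G i \<in> M \<and> hvec a (b i) (G i)) \<and>
    (\<forall>v\<in>M. \<exists>c. v = (\<lambda>p. \<Sum>i\<in>T. c i * G i p))"

lemma hidl_last_components:
  assumes M: "gsubmod (Suc n) a M"
  shows "hidl ((\<lambda>v. v n) ` M)"
  unfolding hidl_def
proof (intro conjI is_idlI ballI allI)
  show "0 \<in> (\<lambda>v. v n) ` M" using gsubmod_0[OF M] by force
next
  fix f g assume "f \<in> (\<lambda>v. v n) ` M" "g \<in> (\<lambda>v. v n) ` M"
  thus "f + g \<in> (\<lambda>v. v n) ` M" using gsubmod_add[OF M] by force
next
  fix f c assume "f \<in> (\<lambda>v. v n) ` M"
  thus "c * f \<in> (\<lambda>v. v n) ` M" using gsubmod_smult[OF M] by force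
next
  fix f d assume "f \<in> (\<lambda>v. v n) ` M"
  then obtain v where v: "v \<in> M" "f = v n" by blast
  have "hcomp d f = gcomp a (d + a n) v n" by (simp add: gcomp_def v)
  thus "hcomp d f \<in> (\<lambda>v. v n) ` M" using gsubmod_gcomp[OF M v(1)] by blast
qed

lemma sum_lessThan_add: "(\<Sum>i<s + t. F i) = (\<Sum>i<s. F i) + (\<Sum>i<t. F (s + i))"
  for s t :: nat by (induction t) (auto simp: add.assoc)

text \<open>Induction on the rank: the last entries of \<open>M\<close> form a homogeneous ideal,
  hence finitely many homogeneous vectors of \<open>M\<close> produce all last entries. What remains
  after subtracting a combination of them has last entry \<open>0\<close> and lies in rank
  \<open>n\<close>.\<close>

lemma gsubmod_finitely_generated:
  "gsubmod n a M \<Longrightarrow> \<exists>s b G. hgens a M {..<s} b G"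
proof (induction n arbitrary: M)
  case 0
  hence "M = {\<lambda>_. 0}" using gsubmod_free[OF 0] gsubmod_0[OF 0] by (auto simp: free_module_def fun_eq_iff)
  hence "hgens a M {..<0} b G" for b G by (simp add: hgens_def)
  thus ?case by blast
next
  case (Suc n)
  note M = Suc.prems
  obtain t g e where g: "\<And>i. i < t \<Longrightarrow> g i \<in> homog_part (e i)" "adjn {0} g t = (\<lambda>v. v n) ` M"
    using hidl_finitely_generated[OF hidl_last_components[OF M]] by metis
  have "\<exists>w. w \<in> M \<and> hvec a (e i + a n) w \<and> w n = g i" if i: "i < t" for i
  proof -
    have "g i \<in> (\<lambda>v. v n) ` M" using in_adjn[OF is_idl_zero i, of g] g(2) by simp
    then obtain v where v: "v \<in> M" "g i = v n" by blast
    \<comment> \<open>The last coordinate lives in \<open>S(- a n)\<close>, so a last entry of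
      degree \<open>e i\<close> belongs to a vector of degree \<open>e i + a n\<close>.\<close>
    have "gcomp a (e i + a n) v n = g i"
      using hcomp_of_homog_same[OF g(1)[OF i]] by (simp add: gcomp_def v)
    thus ?thesis using gsubmod_gcomp[OF M v(1)] hvec_gcomp by blast
  qed
  then obtain w where w: "\<And>i. i < t \<Longrightarrow> w i \<in> M \<and> hvec a (e i + a n) (w i) \<and> w i n = g i" by metis
  have "gsubmod n a (M \<inter> free_module n)"
    using M by (auto simp: gsubmod_def free_module_add free_module_smult free_module_0 gcomp_free_module)
  then obtain s b G where G: "hgens a (M \<inter> free_module n) {..<s} b G" using Suc.IH by blast
  define G' where "G' i = (if i < s then G i else w (i - s))" for i
  define b' where "b' i = (if i < s then b i else e (i - s) + a n)" for i
  have "hgens a M {..<s + t} b' G'"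
    unfolding hgens_def
  proof (intro conjI ballI)
    fix i assume i: "i \<in> {..<s + t}"
    have "G' i \<in> M \<and> hvec a (b' i) (G' i)"
    proof (cases "i < s")
      case True thus ?thesis using G by (auto simp: hgens_def G'_def b'_def)
    next
      case False
      hence "i - s < t" using i by auto
      thus ?thesis using w False by (auto simp: G'_def b'_def)
    qed
    thus "G' i \<in> M" "hvec a (b' i) (G' i)" by auto
  next
    fix v assume v: "v \<in> M"
    hence "v n \<in> adjn {0} g t" using g(2) by simp
    then obtain c where c: "v n = (\<Sum>i<t. c i * g i)" using adjn_zero_sum by blast
    let ?u = "\<lambda>p. v p - (\<Sum>i<t. c i * w i p)"
    have "(\<lambda>p. \<Sum>i<t. c i * w i p) \<in> M" using w by (intro gsubmod_sum[OF M]) auto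
    hence u: "?u \<in> M" by (rule gsubmod_diff[OF M v])
    moreover have "(\<Sum>i<t. c i * w i n) = v n" unfolding c using w by (intro sum.cong) auto
    hence un: "?u n = 0" by simp
    have "?u q = 0" if "q \<ge> n" for q
    proof (cases "q = n")
      case True show ?thesis unfolding True by (rule un)
    next
      case False
      hence "q \<ge> Suc n" using that by simp
      moreover have "\<forall>q\<ge>Suc n. ?u q = 0" using gsubmod_free[OF M u] unfolding free_module_def by (rule CollectD)
      ultimately show ?thesis by blast
    qed
    hence "?u \<in> free_module n" unfolding free_module_def by blast
    ultimately obtain d where d: "?u = (\<lambda>p. \<Sum>i<s. d i * G i p)" using G unfolding hgens_def by blast
    have "v p = (\<Sum>i<s + t. (if i < s then d i else c (i - s)) * G' i p)" for p
    proof -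
      have "(\<Sum>i<s + t. (if i < s then d i else c (i - s)) * G' i p)
          = (\<Sum>i<s. d i * G i p) + (\<Sum>i<t. c i * w i p)"
        by (simp add: sum_lessThan_add G'_def)
      thus ?thesis using fun_cong[OF d, of p] by (simp add: algebra_simps)
    qed
    thus "\<exists>c. v = (\<lambda>p. \<Sum>i<s + t. c i * G' i p)"
      by (intro exI[of _ "\<lambda>i. if i < s then d i else c (i - s)"] ext)
  qed auto
  thus ?case by blast
qed

lemma gsubmod_kernel:
  assumes D: "graded_matrix n a s b D"
  shows "gsubmod s b {v \<in> free_module s. matrix_map n s D v = (\<lambda>_. 0)}"
  unfolding gsubmod_def
proof (intro conjI ballI allI)
  fix v e assume v: "v \<in> {v \<in> free_module s. matrix_map n s D v = (\<lambda>_. 0)}"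
  hence "matrix_map n s D (gcomp b e v) = gcomp a e (\<lambda>_. 0)" using gcomp_matrix_map[OF D, of e v] by simp
  also have "\<dots> = (\<lambda>_. 0)" by (auto simp: gcomp_def)
  finally show "gcomp b e v \<in> {v \<in> free_module s. matrix_map n s D v = (\<lambda>_. 0)}"
    using v by (simp add: gcomp_free_module)
qed (auto simp: matrix_map_add matrix_map_smult matrix_map_0 free_module_add free_module_smult free_module_0)

text \<open>With the least possible number of homogeneous generators, no relation has an entry with
  nonzero constant term: otherwise the corresponding generator could be dropped.\<close>

lemma minimal_presentation:
  assumes M: "gsubmod n a M"
  shows "\<exists>s b D. graded_matrix n a s b D \<and> matrix_map n s D ` free_module s = M \<and>
    (\<forall>v\<in>free_module s. matrix_map n s D v = (\<lambda>_. 0) \<longrightarrow> (\<forall>q. lookup (v q) 0 = 0))"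
proof -
  define P where "P s \<longleftrightarrow> (\<exists>T b G. card T = s \<and> hgens a M T b G)" for s
  have "\<exists>s. P s" using gsubmod_finitely_generated[OF M] P_def by blast
  define s where "s = (LEAST s. P s)"
  have "P s" unfolding s_def using \<open>\<exists>s. P s\<close> by (metis LeastI)
  have min: "s \<le> card T" if "hgens a M T b G" for T b G
    unfolding s_def using that by (intro Least_le) (auto simp: P_def)
  obtain T b0 G0 where T: "card T = s" "hgens a M T b0 G0" using \<open>P s\<close> P_def by blast
  obtain \<sigma> where \<sigma>: "bij_betw \<sigma> {0..<s} T"
    using ex_bij_betw_nat_finite[of T] T by (auto simp: hgens_def)
  define b where "b i = b0 (\<sigma> i)" for i
  define G where "G i = G0 (\<sigma> i)" for i
  have \<sigma>T: "i < s \<Longrightarrow> \<sigma> i \<in> T" for i using \<sigma> by (auto simp: bij_betw_def)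
  have G: "hgens a M {..<s} b G"
    unfolding hgens_def
  proof (intro conjI ballI)
    fix v assume "v \<in> M"
    then obtain c where c: "v = (\<lambda>p. \<Sum>i\<in>T. c i * G0 i p)" using T unfolding hgens_def by blast
    have "(\<Sum>i\<in>T. c i * G0 i p) = (\<Sum>i<s. c (\<sigma> i) * G i p)" for p
      using sum.reindex_bij_betw[OF \<sigma>, of "\<lambda>i. c i * G0 i p"] by (simp add: G_def lessThan_atLeast0)
    thus "\<exists>c. v = (\<lambda>p. \<Sum>i<s. c i * G i p)" using c by auto
  qed (use T(2) \<sigma>T in \<open>auto simp: hgens_def b_def G_def\<close>)
  define D where "D p q = G q p" for p q
  have GM: "G i \<in> M" "hvec a (b i) (G i)" if "i < s" for i using G that by (auto simp: hgens_def)
  have Gz: "G i p = 0" if "i < s" "\<not> p < n" for i p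
    using gsubmod_free[OF M GM(1)[OF that(1)]] that(2) by (auto simp: free_module_def)
  have MD: "matrix_map n s D v = (\<lambda>p. \<Sum>i<s. v i * G i p)" for v
    using Gz by (auto simp: matrix_map_def D_def fun_eq_iff mult.commute)
  have "graded_matrix n a s b D" using GM(2) by (auto simp: graded_matrix_def D_def hvec_def)
  moreover have "matrix_map n s D ` free_module s = M"
  proof (intro equalityI subsetI)
    fix w assume "w \<in> matrix_map n s D ` free_module s"
    thus "w \<in> M" using GM(1) by (auto simp: MD intro!: gsubmod_sum[OF M])
  next
    fix w assume "w \<in> M"
    then obtain c where c: "w = (\<lambda>p. \<Sum>i<s. c i * G i p)" using G unfolding hgens_def by blast
    let ?c = "\<lambda>i. if i < s then c i else 0"
    have "w = matrix_map n s D ?c" unfolding MD c by (auto intro!: sum.cong)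
    moreover have "?c \<in> free_module s" by (simp add: free_module_def)
    ultimately show "w \<in> matrix_map n s D ` free_module s" by blast
  qed
  moreover have "lookup (v q) 0 = 0" if v: "v \<in> free_module s" "matrix_map n s D v = (\<lambda>_. 0)" for v q
  proof (rule ccontr)
    assume nz: "lookup (v q) 0 \<noteq> 0"
    hence q: "q < s" using v(1) by (cases "q < s") (auto simp: free_module_def)
    \<comment> \<open>The component of degree \<open>b q\<close> of a relation is again a relation,
      and its entry at \<open>q\<close> has degree \<open>0\<close>: it is the nonzero constant
      \<open>?k\<close>, so the relation can be solved for the generator \<open>G q\<close>.\<close>
    let ?u = "gcomp b (b q) v" and ?k = "lookup (v q) 0"
    have "matrix_map n s D ?u = gcomp a (b q) (\<lambda>_. 0)"
      using gcomp_matrix_map[OF \<open>graded_matrix n a s b D\<close>, of "b q" v] v(2) by simp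
    hence rel: "(\<Sum>i<s. ?u i * G i p) = 0" for p unfolding MD by (auto simp: gcomp_def fun_eq_iff)
    have uq: "?u q = mpoly_const ?k"
      by (rule poly_mapping_eqI) (auto simp: gcomp_def mpoly_const_def lookup_single when_def)
    let ?T = "{..<s} - {q}"
    define h where "h i = - (mpoly_const (1 / ?k) * ?u i)" for i
    have Gq: "G q p = (\<Sum>i\<in>?T. h i * G i p)" for p
    proof -
      have "?u q * G q p + (\<Sum>i\<in>?T. ?u i * G i p) = 0"
        using rel[of p] q by (subst (asm) sum.remove[of _ q]) auto
      hence "mpoly_const (1 / ?k) * (?u q * G q p) = - (mpoly_const (1 / ?k) * (\<Sum>i\<in>?T. ?u i * G i p))"
        by (simp add: eq_neg_iff_add_eq_0 ring_distribs(1)[symmetric])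
      moreover have "mpoly_const (1 / ?k) * (?u q * G q p) = G q p"
        using nz by (simp add: uq mult.assoc[symmetric] mpoly_const_mult[symmetric])
      ultimately show ?thesis
        by (simp add: h_def sum_negf sum_distrib_left mult.assoc)
    qed
    have "hgens a M ?T b G"
      unfolding hgens_def
    proof (intro conjI ballI)
      fix w assume "w \<in> M"
      then obtain c where c: "w = (\<lambda>p. \<Sum>i<s. c i * G i p)" using G unfolding hgens_def by blast
      have "w p = (\<Sum>i\<in>?T. (c i + c q * h i) * G i p)" for p
      proof -
        have "w p = c q * G q p + (\<Sum>i\<in>?T. c i * G i p)" unfolding c using q by (subst sum.remove[of _ q]) auto
        also have "c q * G q p = (\<Sum>i\<in>?T. c q * h i * G i p)" by (simp add: Gq sum_distrib_left mult.assoc)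
        finally show ?thesis by (simp add: sum.distrib[symmetric] algebra_simps)
      qed
      thus "\<exists>c. w = (\<lambda>p. \<Sum>i\<in>?T. c i * G i p)"
        by (intro exI[of _ "\<lambda>i. c i + c q * h i"] ext)
    qed (use G in \<open>auto simp: hgens_def\<close>)
    from min[OF this] q show False by simp
  qed
  ultimately show ?thesis by blast
qed

text \<open>In contrast to \<open>min_graded_resolution\<close>, this is a resolution of \<open>S/I\<close>: the module of index \<open>0\<close>
  is \<open>S\<close>, and all indices are shifted by one.\<close>

definition gres :: "('x::finite, 'k::field) mpoly set \<Rightarrow> (nat \<Rightarrow> nat) \<Rightarrow> (nat \<Rightarrow> nat \<Rightarrow> nat) \<Rightarrow>
    (nat \<Rightarrow> nat \<Rightarrow> nat \<Rightarrow> ('x, 'k) mpoly) \<Rightarrow> bool" where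
  "gres I N A D \<longleftrightarrow> N 0 = Suc 0 \<and> A 0 = (\<lambda>_. 0) \<and>
    (\<forall>i. graded_matrix (N i) (A i) (N (Suc i)) (A (Suc i)) (D i)) \<and>
    matrix_map (N 0) (N (Suc 0)) (D 0) ` free_module (N (Suc 0)) = {v \<in> free_module (Suc 0). v 0 \<in> I} \<and>
    (\<forall>i. {v \<in> free_module (N (Suc i)). matrix_map (N i) (N (Suc i)) (D i) v = (\<lambda>_. 0)} =
      matrix_map (N (Suc i)) (N (Suc (Suc i))) (D (Suc i)) ` free_module (N (Suc (Suc i)))) \<and>
    (\<forall>i. \<forall>p<N (Suc i). \<forall>q<N (Suc (Suc i)). lookup (D (Suc i) p q) 0 = 0)"

lemma gsubmod_of_hidl:
  assumes "hidl I" shows "gsubmod (Suc 0) (\<lambda>_. 0) {v \<in> free_module (Suc 0). v 0 \<in> I}"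
  using assms gcomp_free_module[of _ "Suc 0" "\<lambda>_. 0"] unfolding gsubmod_def
  by (auto simp: free_module_add free_module_smult free_module_0 hidl_hcomp gcomp_def
      intro: idl_0 idl_add idl_mult hidl_is_idl)

text \<open>One stage of the construction of a resolution: rank and shifts of the current free
  module, the graded submodule of it to be covered, then rank, shifts and matrix of a minimal
  presentation covering it.\<close>

type_synonym ('x, 'k) stage = "nat \<times> (nat \<Rightarrow> nat) \<times> (nat \<Rightarrow> ('x, 'k) mpoly) set \<times> nat \<times>
  (nat \<Rightarrow> nat) \<times> (nat \<Rightarrow> nat \<Rightarrow> ('x, 'k) mpoly)"

text \<open>Minimal presentations are strung together by dependent choice: \<open>Q\<close> says
  that a stage is minimally covered, \<open>R\<close> that the next stage has to cover the kernel of
  the present matrix.\<close>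

lemma gres_exists:
  fixes I :: "('x::finite, 'k::field) mpoly set"
  assumes "hidl I"
  shows "\<exists>N A D. gres I N A D"
proof -
  define Q :: "('x, 'k) stage \<Rightarrow> bool" where
    "Q = (\<lambda>(n, a, M, s, b, D). graded_matrix n a s b D \<and> matrix_map n s D ` free_module s = M \<and>
      (\<forall>v\<in>free_module s. matrix_map n s D v = (\<lambda>_. 0) \<longrightarrow> (\<forall>q. lookup (v q) 0 = 0)))"
  define R :: "('x, 'k) stage \<Rightarrow> ('x, 'k) stage \<Rightarrow> bool" where
    "R = (\<lambda>(n, a, M, s, b, D) (n', a', M', _). n' = s \<and> a' = b \<and>
      M' = {v \<in> free_module s. matrix_map n s D v = (\<lambda>_. 0)})"
  let ?M0 = "{v :: nat \<Rightarrow> ('x, 'k) mpoly. v \<in> free_module (Suc 0) \<and> v 0 \<in> I}"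
  let ?start = "\<lambda>x. fst x = Suc 0 \<and> fst (snd x) = (\<lambda>_. 0) \<and> fst (snd (snd x)) = ?M0"
  have "\<exists>f. \<forall>i. (Q (f i) \<and> (i = 0 \<longrightarrow> ?start (f i))) \<and> R (f i) (f (Suc i))"
  proof (rule dependent_nat_choice)
    obtain s b D where "Q (Suc 0, (\<lambda>_. 0), ?M0, s, b, D)"
      using minimal_presentation[OF gsubmod_of_hidl[OF assms]] unfolding Q_def by auto
    thus "\<exists>x. Q x \<and> ((0::nat) = 0 \<longrightarrow> ?start x)"
      by (intro exI[of _ "(Suc 0, (\<lambda>_. 0), ?M0, s, b, D)"]) simp
  next
    fix x :: "('x, 'k) stage" and i :: nat
    assume "Q x \<and> (i = 0 \<longrightarrow> ?start x)"
    moreover obtain n a M s b D where x: "x = (n, a, M, s, b, D)" by (metis prod.exhaust)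
    ultimately have "graded_matrix n a s b D" by (simp add: Q_def)
    from minimal_presentation[OF gsubmod_kernel[OF this]]
    obtain s' b' D' where "Q (s, b, {v \<in> free_module s. matrix_map n s D v = (\<lambda>_. 0)}, s', b', D')"
      unfolding Q_def by auto
    thus "\<exists>y. (Q y \<and> (Suc i = 0 \<longrightarrow> ?start y)) \<and> R x y"
      by (intro exI[of _ "(s, b, {v \<in> free_module s. matrix_map n s D v = (\<lambda>_. 0)}, s', b', D')"])
        (simp add: R_def x)
  qed
  then obtain f where f: "\<And>i. Q (f i)" "\<And>i. R (f i) (f (Suc i))" "fst (f 0) = Suc 0"
      "fst (snd (f 0)) = (\<lambda>_. 0)" "fst (snd (snd (f 0))) = ?M0" by blast
  define N where "N i = fst (f i)" for i
  define A where "A i = fst (snd (f i))" for i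
  define M where "M i = fst (snd (snd (f i)))" for i
  define D where "D i = snd (snd (snd (snd (snd (f i)))))" for i
  have NS: "N (Suc i) = fst (snd (snd (snd (f i))))" and AS: "A (Suc i) = fst (snd (snd (snd (snd (f i)))))"
    and MS: "M (Suc i) = {v \<in> free_module (N (Suc i)). matrix_map (N i) (N (Suc i)) (D i) v = (\<lambda>_. 0)}" for i
    using f(2)[of i] by (auto simp: R_def N_def A_def M_def D_def split: prod.splits)
  have fi: "f i = (N i, A i, M i, N (Suc i), A (Suc i), D i)" for i
    by (simp add: NS AS) (simp add: N_def A_def M_def D_def)
  have gm: "graded_matrix (N i) (A i) (N (Suc i)) (A (Suc i)) (D i)"
    and im: "matrix_map (N i) (N (Suc i)) (D i) ` free_module (N (Suc i)) = M i"
    and ker: "\<And>v q. v \<in> M (Suc i) \<Longrightarrow> lookup (v q) 0 = 0" for i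
    using f(1)[of i] unfolding Q_def MS by (auto simp: fi)
  have "lookup (D (Suc i) p q) 0 = 0" if "p < N (Suc i)" "q < N (Suc (Suc i))" for i p q
  proof -
    \<comment> \<open>The column \<open>q\<close> of \<open>D (Suc i)\<close> is the image of this
      unit vector, hence a relation of the stage before, and such relations have no constant
      terms.\<close>
    let ?u = "\<lambda>j. if j = q then 1 else 0"
    have "?u \<in> free_module (N (Suc (Suc i)))" using that by (auto simp: free_module_def)
    hence "matrix_map (N (Suc i)) (N (Suc (Suc i))) (D (Suc i)) ?u \<in> M (Suc i)" using im by blast
    from ker[OF this, of p] that show ?thesis by (simp add: matrix_map_def if_distrib cong: if_cong)
  qed
  hence "gres I N A D"
    unfolding gres_def using gm im[of 0] im f(3-5) MS by (auto simp: N_def[of 0] A_def[of 0] M_def[of 0])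
  thus ?thesis by blast
qed

lemma matrix_map_augmentation:
  "matrix_map (Suc 0) s D v = (\<lambda>p. if p = 0 then augmentation s (D 0) v else 0)"
  by (auto simp: matrix_map_def augmentation_def)

lemma augmentation_eq_0_iff:
  "augmentation s (D 0) v = 0 \<longleftrightarrow> matrix_map (Suc 0) s D v = (\<lambda>_. 0)"
  by (auto simp: matrix_map_augmentation fun_eq_iff)

lemma augmentation_image_iff:
  "augmentation s (D 0) ` free_module s = I \<longleftrightarrow>
    matrix_map (Suc 0) s D ` free_module s = {v \<in> free_module (Suc 0). v 0 \<in> I}"
proof
  assume *: "augmentation s (D 0) ` free_module s = I"
  show "matrix_map (Suc 0) s D ` free_module s = {v \<in> free_module (Suc 0). v 0 \<in> I}"
  proof (intro equalityI subsetI)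
    fix v assume "v \<in> matrix_map (Suc 0) s D ` free_module s"
    then obtain w where w: "w \<in> free_module s" "v = matrix_map (Suc 0) s D w" by blast
    have "v 0 = augmentation s (D 0) w" by (simp add: w(2) matrix_map_augmentation)
    thus "v \<in> {v \<in> free_module (Suc 0). v 0 \<in> I}"
      using * w matrix_map_free_module[of "Suc 0" s D w] by blast
  next
    fix v :: "nat \<Rightarrow> ('a, 'b) mpoly" assume v: "v \<in> {v \<in> free_module (Suc 0). v 0 \<in> I}"
    then obtain w where w: "w \<in> free_module s" "v 0 = augmentation s (D 0) w" using * by blast
    have "v p = matrix_map (Suc 0) s D w p" for p
      using v w(2) by (cases p) (auto simp: matrix_map_augmentation free_module_def)
    hence "v = matrix_map (Suc 0) s D w" by (rule ext)
    thus "v \<in> matrix_map (Suc 0) s D ` free_module s" using w(1) by (rule image_eqI)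
  qed
next
  assume *: "matrix_map (Suc 0) s D ` free_module s = {v \<in> free_module (Suc 0). v 0 \<in> I}"
  show "augmentation s (D 0) ` free_module s = I"
  proof (intro equalityI subsetI)
    fix f assume "f \<in> augmentation s (D 0) ` free_module s"
    then obtain v where "v \<in> free_module s" and f: "f = augmentation s (D 0) v" by blast
    hence "matrix_map (Suc 0) s D v \<in> {v \<in> free_module (Suc 0). v 0 \<in> I}" using * by blast
    thus "f \<in> I" by (simp add: matrix_map_augmentation f)
  next
    fix f assume "f \<in> I"
    hence "(\<lambda>p. if p = 0 then f else 0) \<in> {v \<in> free_module (Suc 0). v 0 \<in> I}"
      by (simp add: free_module_def)
    then obtain v where v: "v \<in> free_module s" "(\<lambda>p. if p = 0 then f else 0) = matrix_map (Suc 0) s D v"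
      unfolding *[symmetric] by blast
    from fun_cong[OF v(2), of 0] have "f = augmentation s (D 0) v" by (simp add: matrix_map_augmentation)
    thus "f \<in> augmentation s (D 0) ` free_module s" using v(1) by (rule image_eqI)
  qed
qed

lemma
  assumes "gres I N A D"
  shows gres_start: "N 0 = Suc 0" "A 0 = (\<lambda>_. 0)"
    and gres_graded: "graded_matrix (N i) (A i) (N (Suc i)) (A (Suc i)) (D i)"
    and gres_image: "matrix_map (N 0) (N (Suc 0)) (D 0) ` free_module (N (Suc 0)) = {v \<in> free_module (Suc 0). v 0 \<in> I}"
    and gres_exact: "{v \<in> free_module (N (Suc i)). matrix_map (N i) (N (Suc i)) (D i) v = (\<lambda>_. 0)} =
      matrix_map (N (Suc i)) (N (Suc (Suc i))) (D (Suc i)) ` free_module (N (Suc (Suc i)))"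
    and gres_minimal: "p < N (Suc i) \<Longrightarrow> q < N (Suc (Suc i)) \<Longrightarrow> lookup (D (Suc i) p q) 0 = 0"
  using assms unfolding gres_def by blast+

lemma min_graded_resolution_of_gres:
  assumes D: "gres I N A D"
  shows "min_graded_resolution I (\<lambda>i. N (Suc i)) (\<lambda>i. A (Suc i)) (D 0 0) (\<lambda>i. D (Suc i))"
  unfolding min_graded_resolution_def One_nat_def
proof (intro conjI allI impI)
  show "D 0 0 q \<in> homog_part (A (Suc 0) q)" if "q < N (Suc 0)" for q
    using gres_graded[OF D, of 0] that by (simp add: graded_matrix_def gres_start[OF D])
  show "D (Suc i) p q \<in> (if A (Suc i) p \<le> A (Suc (Suc i)) q
      then homog_part (A (Suc (Suc i)) q - A (Suc i) p) else {0})"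
    if "p < N (Suc i)" "q < N (Suc (Suc i))" for i p q
    using gres_graded[OF D, of "Suc i"] that unfolding graded_matrix_def by blast
  show "augmentation (N (Suc 0)) (D 0 0) ` free_module (N (Suc 0)) = I"
    unfolding augmentation_image_iff using gres_image[OF D] gres_start[OF D] by simp
  show "{v \<in> free_module (N (Suc 0)). augmentation (N (Suc 0)) (D 0 0) v = 0} =
      matrix_map (N (Suc 0)) (N (Suc (Suc 0))) (D (Suc 0)) ` free_module (N (Suc (Suc 0)))"
    unfolding augmentation_eq_0_iff using gres_exact[OF D, of 0] gres_start[OF D] by simp
  show "{v \<in> free_module (N (Suc (Suc i))). matrix_map (N (Suc i)) (N (Suc (Suc i))) (D (Suc i)) v = (\<lambda>_. 0)} =
      matrix_map (N (Suc (Suc i))) (N (Suc (Suc (Suc i)))) (D (Suc (Suc i))) ` free_module (N (Suc (Suc (Suc i))))" for i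
    by (rule gres_exact[OF D])
  show "D (Suc i) p q \<in> Idl\<^bsub>\<S>\<^esub> range mpoly_var" if "p < N (Suc i)" "q < N (Suc (Suc i))" for i p q
    unfolding in_maximal_iff using gres_minimal[OF D that] .
qed

text \<open>The ring \<open>S\<close>, with shift \<open>0\<close>, is put in front of the
  resolution of \<open>I\<close>, and the generators \<open>g\<close> become the single row of the
  first matrix.\<close>

lemma gres_of_min_graded_resolution:
  assumes "min_graded_resolution I r a g D"
  shows "gres I (case_nat (Suc 0) r) (case_nat (\<lambda>_. 0) a) (case_nat (\<lambda>_. g) D)"
proof -
  have h: "\<And>q. q < r 0 \<Longrightarrow> g q \<in> homog_part (a 0 q)"
    "\<And>i p q. p < r i \<Longrightarrow> q < r (Suc i) \<Longrightarrow>
       D i p q \<in> (if a i p \<le> a (Suc i) q then homog_part (a (Suc i) q - a i p) else {0})"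
    "augmentation (r 0) g ` free_module (r 0) = I"
    "{v \<in> free_module (r 0). augmentation (r 0) g v = 0} = matrix_map (r 0) (r (Suc 0)) (D 0) ` free_module (r (Suc 0))"
    "\<And>i. {v \<in> free_module (r (Suc i)). matrix_map (r i) (r (Suc i)) (D i) v = (\<lambda>_. 0)} =
      matrix_map (r (Suc i)) (r (Suc (Suc i))) (D (Suc i)) ` free_module (r (Suc (Suc i)))"
    "\<And>i p q. p < r i \<Longrightarrow> q < r (Suc i) \<Longrightarrow> lookup (D i p q) 0 = 0"
  proof -
    note m = assms[unfolded min_graded_resolution_def in_maximal_iff One_nat_def]
    show "\<And>q. q < r 0 \<Longrightarrow> g q \<in> homog_part (a 0 q)"
      "\<And>i p q. p < r i \<Longrightarrow> q < r (Suc i) \<Longrightarrow>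
       D i p q \<in> (if a i p \<le> a (Suc i) q then homog_part (a (Suc i) q - a i p) else {0})"
      using m[THEN conjunct1] m[THEN conjunct2, THEN conjunct1] by blast+
    show "augmentation (r 0) g ` free_module (r 0) = I"
      by (rule m[THEN conjunct2, THEN conjunct2, THEN conjunct1])
    show "{v \<in> free_module (r 0). augmentation (r 0) g v = 0} = matrix_map (r 0) (r (Suc 0)) (D 0) ` free_module (r (Suc 0))"
      by (rule m[THEN conjunct2, THEN conjunct2, THEN conjunct2, THEN conjunct1])
    show "{v \<in> free_module (r (Suc i)). matrix_map (r i) (r (Suc i)) (D i) v = (\<lambda>_. 0)} =
      matrix_map (r (Suc i)) (r (Suc (Suc i))) (D (Suc i)) ` free_module (r (Suc (Suc i)))" for i
      by (rule m[THEN conjunct2, THEN conjunct2, THEN conjunct2, THEN conjunct2, THEN conjunct1, THEN spec])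
    show "\<And>i p q. p < r i \<Longrightarrow> q < r (Suc i) \<Longrightarrow> lookup (D i p q) 0 = 0"
      using m[THEN conjunct2, THEN conjunct2, THEN conjunct2, THEN conjunct2, THEN conjunct2] by blast
  qed
  show ?thesis
    unfolding gres_def
  proof (intro conjI allI impI)
    fix i
    show "graded_matrix (case_nat (Suc 0) r i) (case_nat (\<lambda>_. 0) a i) (case_nat (Suc 0) r (Suc i))
        (case_nat (\<lambda>_. 0) a (Suc i)) (case_nat (\<lambda>_. g) D i)"
      using h(1) h(2) by (cases i) (simp_all add: graded_matrix_def)
    show "{v \<in> free_module (case_nat (Suc 0) r (Suc i)). matrix_map (case_nat (Suc 0) r i) (case_nat (Suc 0) r (Suc i))
        (case_nat (\<lambda>_. g) D i) v = (\<lambda>_. 0)} = matrix_map (case_nat (Suc 0) r (Suc i)) (case_nat (Suc 0) r (Suc (Suc i)))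
        (case_nat (\<lambda>_. g) D (Suc i)) ` free_module (case_nat (Suc 0) r (Suc (Suc i)))"
      using h(4) h(5) augmentation_eq_0_iff[of "r 0" "\<lambda>_. g"] by (cases i) simp_all
  next
    show "matrix_map (case_nat (Suc 0) r 0) (case_nat (Suc 0) r (Suc 0)) (case_nat (\<lambda>_. g) D 0) `
        free_module (case_nat (Suc 0) r (Suc 0)) = {v \<in> free_module (Suc 0). v 0 \<in> I}"
      using h(3) augmentation_image_iff[of "r 0" "\<lambda>_. g" I] by simp
  qed (use h(6) in auto)
qed

section \<open>Ideals generated by linear forms\<close>

lemma mpoly_induct [case_names const var add mult]:
  fixes f :: "('x::finite, 'k::field) mpoly"
  assumes const: "\<And>c. P (mpoly_const c)" and var: "\<And>x. P (mpoly_var x)"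
    and add: "\<And>f g. P f \<Longrightarrow> P g \<Longrightarrow> P (f + g)" and mult: "\<And>f g. P f \<Longrightarrow> P g \<Longrightarrow> P (f * g)"
  shows "P f"
proof -
  have mon: "P (single m 1)" for m
  proof (induction "mon_deg m" arbitrary: m)
    case 0
    thus ?case using const[of 1] by (simp add: mpoly_const_def)
  next
    case (Suc n)
    then obtain x where x: "lookup m x \<noteq> 0" by (metis poly_mapping_eqI lookup_zero mon_deg_eq_0_iff nat.distinct(1))
    let ?m = "m - single x 1"
    have m: "m = ?m + single x 1"
      using x by (intro poly_mapping_eqI) (auto simp: lookup_add lookup_minus lookup_single when_def)
    have "Suc n = mon_deg ?m + 1" using Suc.hyps(2) by (subst (asm) m) (simp only: mon_deg_add mon_deg_single)
    hence "P (single ?m 1)" using Suc.hyps(1) by simp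
    moreover have "single m 1 = single ?m 1 * (mpoly_var x :: ('x, 'k) mpoly)"
      by (subst m) (simp add: mpoly_var_def mult_single)
    ultimately show ?case using mult var by simp
  qed
  have "P (\<Sum>m\<in>A. single m (lookup f m))" if "finite A" for A
    using that
  proof (induction A rule: finite_induct)
    case empty thus ?case using const[of 0] by simp
  next
    case (insert m A)
    have "P (single m (lookup f m))" using mult[OF const mon] by (metis single_eq_const_mult)
    thus ?case using insert add by simp
  qed
  from this[OF finite_keys[of f]] show ?thesis by (simp add: sum_singles)
qed

lemma mpoly_const_diff: "mpoly_const (a - b) = mpoly_const a - mpoly_const b"
  by (simp add: mpoly_const_def single_diff)

lemma mpoly_var_nonzero: "mpoly_var x \<noteq> 0"
  by (metis lookup_single_eq lookup_zero mpoly_var_def zero_neq_one)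

lemma linear_form_add: "linear_form (\<lambda>x. c x + d x) = linear_form c + linear_form d"
  by (simp add: linear_form_def mpoly_const_add ring_distribs sum.distrib)

lemma linear_form_smult: "linear_form (\<lambda>x. t * c x) = mpoly_const t * linear_form c"
  by (simp add: linear_form_def mpoly_const_mult sum_distrib_left mult.assoc)

lemma linear_form_diff: "linear_form (\<lambda>x. c x - d x) = linear_form c - linear_form d"
  using linear_form_add[of "\<lambda>x. c x - d x" d] by simp

lemma linear_form_0: "linear_form (\<lambda>_. 0) = 0"
  by (simp add: linear_form_def)

lemma mpoly_var_linear_form: "mpoly_var x = linear_form (\<lambda>z. if z = x then 1 else 0)"
proof -
  have "linear_form (\<lambda>z. if z = x then 1 else 0) = (\<Sum>z\<in>UNIV. if z = x then mpoly_var x else 0)"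
    unfolding linear_form_def by (intro sum.cong) auto
  also have "\<dots> = mpoly_var x" by simp
  finally show ?thesis by (rule sym)
qed

lemma ev_linear_form: "ev mpoly_const s (linear_form c) = (\<Sum>x\<in>UNIV. mpoly_const (c x) * s x)"
  by (simp add: linear_form_def coeff_const.ev_sum coeff_const.ev_mult)

text \<open>A ring endomorphism \<open>\<tau>\<close> that is the identity modulo the ideal of the
  forms and vanishes on this ideal. It embeds the quotient into the polynomial ring;
  \<open>V\<close> is the set of variables that have not been eliminated.\<close>

definition elimination :: "(nat \<Rightarrow> ('x::finite, 'k::field) mpoly) \<Rightarrow> nat \<Rightarrow>
    (('x, 'k) mpoly \<Rightarrow> ('x, 'k) mpoly) \<Rightarrow> 'x set \<Rightarrow> bool" where
  "elimination y j \<tau> V \<longleftrightarrow>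
    (\<forall>f g. \<tau> (f + g) = \<tau> f + \<tau> g) \<and> (\<forall>f g. \<tau> (f * g) = \<tau> f * \<tau> g) \<and>
    (\<forall>f. \<tau> f - f \<in> adjn {0} y j) \<and> (\<forall>f\<in>adjn {0} y j. \<tau> f = 0) \<and>
    (\<forall>c. \<exists>c'. \<tau> (linear_form c) = linear_form c' \<and> (\<forall>x. x \<notin> V \<longrightarrow> c' x = 0)) \<and>
    card V + j = CARD('x) \<and> (\<forall>x\<in>V. \<tau> (mpoly_var x) = mpoly_var x)"

lemma
  fixes y :: "nat \<Rightarrow> ('x::finite, 'k::field) mpoly"
  assumes "elimination y j \<tau> V"
  shows elimination_add: "\<tau> (f + g) = \<tau> f + \<tau> g" and elimination_mult: "\<tau> (f * g) = \<tau> f * \<tau> g"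
    and elimination_cong: "\<tau> f - f \<in> adjn {0} y j" and elimination_ker: "f \<in> adjn {0} y j \<Longrightarrow> \<tau> f = 0"
    and elimination_linear: "\<exists>c'. \<tau> (linear_form c) = linear_form c' \<and> (\<forall>x. x \<notin> V \<longrightarrow> c' x = 0)"
    and elimination_card: "card V + j = CARD('x)"
    and elimination_var: "x \<in> V \<Longrightarrow> \<tau> (mpoly_var x) = mpoly_var x"
proof -
  note e = assms[unfolded elimination_def]
  note e1 = e[THEN conjunct1] and r1 = e[THEN conjunct2]
  note e2 = r1[THEN conjunct1] and r2 = r1[THEN conjunct2]
  note e3 = r2[THEN conjunct1] and r3 = r2[THEN conjunct2]
  note e4 = r3[THEN conjunct1] and r4 = r3[THEN conjunct2]
  note e5 = r4[THEN conjunct1] and r5 = r4[THEN conjunct2]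
  show "\<tau> (f + g) = \<tau> f + \<tau> g" "\<tau> (f * g) = \<tau> f * \<tau> g" "\<tau> f - f \<in> adjn {0} y j"
    "\<exists>c'. \<tau> (linear_form c) = linear_form c' \<and> (\<forall>x. x \<notin> V \<longrightarrow> c' x = 0)"
    "card V + j = CARD('x)"
    by (rule e1[THEN spec, THEN spec] e2[THEN spec, THEN spec] e3[THEN spec] e5[THEN spec] r5[THEN conjunct1])+
  show "f \<in> adjn {0} y j \<Longrightarrow> \<tau> f = 0" by (rule e4[THEN bspec])
  show "x \<in> V \<Longrightarrow> \<tau> (mpoly_var x) = mpoly_var x" by (rule r5[THEN conjunct2, THEN bspec])
qed

text \<open>Eliminating one variable for each of \<open>j\<close> independent linear forms gives an endomorphism of
  the polynomial ring with kernel the ideal generated by these forms.\<close>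

lemma linear_elimination:
  fixes y :: "nat \<Rightarrow> ('x::finite, 'k::field) mpoly"
  assumes "\<And>i. i < j \<Longrightarrow> y i \<in> homog_part 1" "\<And>i. i < j \<Longrightarrow> y i \<notin> adjn {0} y i"
  shows "\<exists>\<tau> V. elimination y j \<tau> V"
  using assms
proof (induction j)
  case 0
  have "elimination y 0 (\<lambda>f. f) UNIV" by (auto simp: elimination_def)
  thus ?case by blast
next
  case (Suc j)
  obtain \<tau> V where "elimination y j \<tau> V"
    using Suc.IH[OF Suc.prems(1)[OF less_SucI] Suc.prems(2)[OF less_SucI]] by blast
  note add = elimination_add[OF this] and mult = elimination_mult[OF this]
    and cong = elimination_cong[OF this] and ker = elimination_ker[OF this]
    and lin = elimination_linear[OF this] and card = elimination_card[OF this]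
    and vars = elimination_var[OF this]
  let ?J = "adjn {0} y j" and ?J' = "adjn {0} y (Suc j)"
  note J = is_idl_adjn[OF is_idl_zero, of y j] and J' = is_idl_adjn[OF is_idl_zero, of y "Suc j"]
  have yj: "y j \<in> homog_part 1" "y j \<notin> ?J" using Suc.prems by auto
  obtain c where c: "\<tau> (y j) = linear_form c" "\<And>x. x \<notin> V \<Longrightarrow> c x = 0"
    using lin homog_1_linear_form[OF yj(1)] by metis
  have "\<tau> (y j) \<noteq> 0"
  proof
    assume "\<tau> (y j) = 0"
    hence "- y j \<in> ?J" using cong[of "y j"] by simp
    thus False using yj(2) idl_uminus[OF J] by force
  qed
  then obtain x0 where x0: "c x0 \<noteq> 0" using c(1) linear_form_0 by (metis ext)
  hence x0X: "x0 \<in> V" using c(2) by blast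
  \<comment> \<open>The variable \<open>x0\<close> occurs in the linear form
    \<open>\<tau> (y j)\<close>; the substitution replaces \<open>x0\<close> by the solution of
    \<open>\<tau> (y j) = 0\<close> for it and fixes the other variables.\<close>
  define s where "s x = mpoly_var x - mpoly_const (if x = x0 then 1 / c x0 else 0) * \<tau> (y j)" for x
  define \<sigma> where "\<sigma> = ev mpoly_const s"
  have \<sigma>lin: "\<sigma> (linear_form d) = linear_form (\<lambda>x. d x - d x0 / c x0 * c x)" for d
  proof -
    have "\<sigma> (linear_form d) = linear_form d -
        (\<Sum>x\<in>UNIV. mpoly_const (d x) * (mpoly_const (if x = x0 then 1 / c x0 else 0) * \<tau> (y j)))"
      unfolding \<sigma>_def ev_linear_form s_def
      by (simp add: right_diff_distrib sum_subtractf linear_form_def)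
    also have "(\<Sum>x\<in>UNIV. mpoly_const (d x) * (mpoly_const (if x = x0 then 1 / c x0 else 0) * \<tau> (y j)))
        = (\<Sum>x\<in>UNIV. if x = x0 then mpoly_const (d x0 / c x0) * \<tau> (y j) else 0)"
      by (intro sum.cong refl) (auto simp: mult.assoc[symmetric] mpoly_const_mult[symmetric])
    also have "\<dots> = linear_form (\<lambda>x. d x0 / c x0 * c x)" by (simp add: c(1) linear_form_smult[symmetric])
    finally show ?thesis by (simp add: linear_form_diff)
  qed
  have \<sigma>y: "\<sigma> (\<tau> (y j)) = 0" using x0 by (simp add: c(1) \<sigma>lin linear_form_0)
  have "\<tau> (y j) \<in> ?J'"
  proof -
    have "\<tau> (y j) = (\<tau> (y j) - y j) + 1 * y j" by simp
    thus ?thesis using adjI[OF cong, of "y j" 1 "y j"] by simp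
  qed
  have \<sigma>cong: "\<sigma> f - f \<in> ?J'" for f
  proof (induction f rule: mpoly_induct)
    case (const k) show ?case by (simp add: \<sigma>_def idl_0[OF J'] del: adjn.simps)
  next
    case (var x)
    have "\<sigma> (mpoly_var x) - mpoly_var x = - (mpoly_const (if x = x0 then 1 / c x0 else 0) * \<tau> (y j))"
      by (simp add: \<sigma>_def s_def)
    thus ?case using idl_uminus[OF J' idl_mult[OF J' \<open>\<tau> (y j) \<in> ?J'\<close>]] by simp
  next
    case (add f g)
    have "\<sigma> (f + g) - (f + g) = (\<sigma> f - f) + (\<sigma> g - g)" by (simp add: \<sigma>_def coeff_const.ev_add)
    thus ?case using idl_add[OF J' add.IH] by (simp only:)
  next
    case (mult f g)
    have "\<sigma> (f * g) - f * g = \<sigma> f * (\<sigma> g - g) + g * (\<sigma> f - f)"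
      by (simp add: \<sigma>_def coeff_const.ev_mult algebra_simps)
    thus ?case using idl_add[OF J' idl_mult[OF J' mult.IH(2)] idl_mult[OF J' mult.IH(1)]] by (simp only:)
  qed
  have "elimination y (Suc j) (\<lambda>f. \<sigma> (\<tau> f)) (V - {x0})"
    unfolding elimination_def
  proof (intro conjI allI ballI)
    fix f
    have "\<sigma> (\<tau> f) - f = (\<sigma> (\<tau> f) - \<tau> f) + (\<tau> f - f)" by simp
    moreover have "\<tau> f - f \<in> ?J'" using cong subset_adj[of ?J "y j"] by auto
    ultimately show "\<sigma> (\<tau> f) - f \<in> ?J'" using idl_add[OF J' \<sigma>cong] by metis
  next
    fix f assume "f \<in> ?J'"
    then obtain g d where "g \<in> ?J" "f = g + d * y j" by (auto elim: adjE)
    thus "\<sigma> (\<tau> f) = 0"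
      using ker[of g] \<sigma>y by (simp add: add mult \<sigma>_def coeff_const.ev_add coeff_const.ev_mult)
  next
    fix d
    obtain d' where d': "\<tau> (linear_form d) = linear_form d'" "\<And>x. x \<notin> V \<Longrightarrow> d' x = 0" using lin by blast
    show "\<exists>c'. \<sigma> (\<tau> (linear_form d)) = linear_form c' \<and> (\<forall>x. x \<notin> V - {x0} \<longrightarrow> c' x = 0)"
      by (rule exI[of _ "\<lambda>x. d' x - d' x0 / c x0 * c x"]) (use x0 d' c(2) in \<open>auto simp: \<sigma>lin\<close>)
  next
    have "card V = Suc (card (V - {x0}))" using card.remove[of V x0] x0X by simp
    thus "card (V - {x0}) + Suc j = CARD('x)" using card by simp
  next
    fix x assume "x \<in> V - {x0}"
    thus "\<sigma> (\<tau> (mpoly_var x)) = mpoly_var x" using vars by (simp add: \<sigma>_def s_def)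
  qed (simp_all add: add mult \<sigma>_def coeff_const.ev_add coeff_const.ev_mult)
  thus ?case by blast
qed

text \<open>All three follow from the kernel of \<open>\<tau>\<close> being the ideal: it is prime
  since the target is a domain; a variable left in \<open>V\<close> is fixed by
  \<open>\<tau>\<close> and nonzero; and if \<open>V\<close> is empty, all linear forms map to
  \<open>0\<close>.\<close>

lemma
  fixes y :: "nat \<Rightarrow> ('x::finite, 'k::field) mpoly"
  assumes "\<And>i. i < j \<Longrightarrow> y i \<in> homog_part 1" "\<And>i. i < j \<Longrightarrow> y i \<notin> adjn {0} y i"
  shows linear_ideal_prime: "f * g \<in> adjn {0} y j \<Longrightarrow> f \<in> adjn {0} y j \<or> g \<in> adjn {0} y j"
    and linear_ideal_proper: "j < CARD('x) \<Longrightarrow> \<exists>x. mpoly_var x \<notin> adjn {0} y j"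
    and linear_ideal_maximal: "j = CARD('x) \<Longrightarrow> lookup h 0 = 0 \<Longrightarrow> h \<in> adjn {0} y j"
proof -
  let ?J = "adjn {0} y j"
  note J = is_idl_adjn[OF is_idl_zero, of y j]
  obtain \<tau> V where "elimination y j \<tau> V" using linear_elimination[OF assms] by blast
  note mult = elimination_mult[OF this] and cong = elimination_cong[OF this]
    and ker = elimination_ker[OF this] and lin = elimination_linear[OF this]
    and card = elimination_card[OF this] and vars = elimination_var[OF this]
  have zero: "f \<in> ?J" if "\<tau> f = 0" for f
    using idl_uminus[OF J cong[of f]] that by simp
  show "f * g \<in> ?J \<Longrightarrow> f \<in> ?J \<or> g \<in> ?J"
    using ker[of "f * g"] zero by (auto simp: mult mpoly_mult_eq_0_iff)
  show "\<exists>x. mpoly_var x \<notin> ?J" if "j < CARD('x)"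
  proof -
    have "V \<noteq> {}" using card that by auto
    then obtain x where "x \<in> V" by blast
    hence "\<tau> (mpoly_var x) \<noteq> 0" using vars mpoly_var_nonzero by metis
    thus ?thesis using ker by metis
  qed
  show "h \<in> ?J" if "j = CARD('x)" "lookup h 0 = 0"
  proof -
    have "V = {}" using card that(1) by simp
    hence "\<tau> (linear_form c) = 0" for c using lin[of c] linear_form_0 by (metis empty_iff ext)
    hence "range mpoly_var \<subseteq> ?J" using zero by (auto simp: mpoly_var_linear_form)
    hence "Idl\<^bsub>\<S>\<^esub> (range mpoly_var) \<subseteq> ?J" by (rule genideal_least[OF J])
    thus ?thesis using that(2) in_maximal_iff[of h] by blast
  qed
qed

lemma adjn_eq_sum: "is_idl J \<Longrightarrow> h \<in> adjn J y n \<longleftrightarrow> (\<exists>f\<in>J. h - f \<in> adjn {0} y n)"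
proof (induction n arbitrary: h)
  case 0
  show ?case by auto
next
  case (Suc n)
  show ?case
  proof
    assume "h \<in> adjn J y (Suc n)"
    then obtain g c where g: "g \<in> adjn J y n" "h = g + c * y n" by (auto elim: adjE)
    then obtain f where f: "f \<in> J" "g - f \<in> adjn {0} y n" using Suc by blast
    have "h - f = (g - f) + c * y n" using g(2) by simp
    hence "h - f \<in> adjn {0} y (Suc n)" by (metis adjI adjn.simps(2) f(2))
    thus "\<exists>f\<in>J. h - f \<in> adjn {0} y (Suc n)" using f(1) by blast
  next
    assume "\<exists>f\<in>J. h - f \<in> adjn {0} y (Suc n)"
    then obtain f g c where f: "f \<in> J" "g \<in> adjn {0} y n" "h - f = g + c * y n" by (auto elim: adjE)
    have "(f + g) - f \<in> adjn {0} y n" using f(2) by simp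
    hence "f + g \<in> adjn J y n" using Suc f(1) by blast
    moreover have "h = (f + g) + c * y n" using f(3) by (simp add: algebra_simps)
    ultimately show "h \<in> adjn J y (Suc n)" by (auto intro: adjI)
  qed
qed

section \<open>Almost regular linear forms\<close>

text \<open>A substitute for nonempty Zariski open sets, tested on lines only. It is preserved by
  finite intersections over an infinite field and by nonempty slices with coordinate subspaces, and
  it needs no equations for the complement.\<close>

definition line_generic :: "('x \<Rightarrow> 'k::field) set \<Rightarrow> bool" where
  "line_generic U \<longleftrightarrow> U \<noteq> {} \<and> (\<forall>c\<in>U. \<forall>v. finite {t. (\<lambda>x. c x + t * v x) \<notin> U})"

lemma line_generic_UNIV: "line_generic UNIV"
  by (simp add: line_generic_def)

text \<open>On the line through a point of \<open>U\<close> and a point of \<open>V\<close>, all but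
  finitely many points lie in either set, and the field is infinite. The parameter
  \<open>1 - t\<close> runs through the same line starting from the point of
  \<open>V\<close>.\<close>

lemma line_generic_Int:
  fixes U V :: "('x \<Rightarrow> 'k::field_char_0) set"
  assumes "line_generic U" "line_generic V" shows "line_generic (U \<inter> V)"
  unfolding line_generic_def
proof (intro conjI ballI allI)
  obtain c d where cd: "c \<in> U" "d \<in> V" using assms by (auto simp: line_generic_def)
  let ?p = "\<lambda>t x. c x + t * (d x - c x)"
  have "finite {t. ?p t \<notin> U}"
    using assms(1) cd(1) by (auto simp: line_generic_def)
  moreover have "finite {t. ?p t \<notin> V}"
  proof -
    have "finite {t. (\<lambda>x. d x + t * (c x - d x)) \<notin> V}" using assms(2) cd(2) by (auto simp: line_generic_def)
    moreover have "?p t = (\<lambda>x. d x + (1 - t) * (c x - d x))" for t by (auto simp: algebra_simps)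
    hence "{t. ?p t \<notin> V} \<subseteq> (\<lambda>t. 1 - t) ` {t. (\<lambda>x. d x + t * (c x - d x)) \<notin> V}"
      by (intro subsetI image_eqI[where x = "1 - _"]) auto
    ultimately show ?thesis using finite_surj by blast
  qed
  ultimately have "finite ({t. ?p t \<notin> U} \<union> {t. ?p t \<notin> V})" by simp
  then obtain t where "t \<notin> {t. ?p t \<notin> U} \<union> {t. ?p t \<notin> V}"
    using ex_new_if_finite[OF infinite_UNIV_char_0] by blast
  thus "U \<inter> V \<noteq> {}" by blast
next
  fix c v assume "c \<in> U \<inter> V"
  hence "finite ({t. (\<lambda>x. c x + t * v x) \<notin> U} \<union> {t. (\<lambda>x. c x + t * v x) \<notin> V})"
    using assms by (auto simp: line_generic_def)
  thus "finite {t. (\<lambda>x. c x + t * v x) \<notin> U \<inter> V}" by (rule finite_subset[rotated]) auto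
qed

text \<open>The linear forms in \<open>L\<close> form a linear subspace; a line with a point outside
  it meets it at most once.\<close>

lemma line_generic_not_in_ideal:
  assumes L: "is_idl L" and "linear_form c0 \<notin> L"
  shows "line_generic {c. linear_form c \<notin> L}"
  unfolding line_generic_def
proof (intro conjI ballI allI)
  show "{c. linear_form c \<notin> L} \<noteq> {}" using assms(2) by auto
  fix c v assume c: "c \<in> {c. linear_form c \<notin> L}"
  have eq: "s = t" if "linear_form (\<lambda>x. c x + s * v x) \<in> L" "linear_form (\<lambda>x. c x + t * v x) \<in> L" for s t
  proof (rule ccontr)
    assume "s \<noteq> t"
    have d: "linear_form (\<lambda>x. c x + s * v x) = linear_form c + mpoly_const s * linear_form v" for s
      by (simp add: linear_form_add linear_form_smult)
    have "mpoly_const (s - t) * linear_form v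
        = linear_form (\<lambda>x. c x + s * v x) - linear_form (\<lambda>x. c x + t * v x)"
      unfolding d by (simp add: mpoly_const_diff left_diff_distrib)
    hence "mpoly_const (s - t) * linear_form v \<in> L" using idl_diff[OF L that] by simp
    hence "mpoly_const (1 / (s - t)) * (mpoly_const (s - t) * linear_form v) \<in> L" by (rule idl_mult[OF L])
    hence "linear_form v \<in> L" using \<open>s \<noteq> t\<close> by (simp add: mult.assoc[symmetric] mpoly_const_mult[symmetric])
    hence "linear_form (\<lambda>x. c x + s * v x) - mpoly_const s * linear_form v \<in> L"
      by (intro idl_diff[OF L that(1)] idl_mult[OF L])
    thus False using c by (simp add: d)
  qed
  show "finite {t. (\<lambda>x. c x + t * v x) \<notin> {c. linear_form c \<notin> L}}"
  proof (cases "\<exists>t. linear_form (\<lambda>x. c x + t * v x) \<in> L")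
    case True
    then obtain t where "linear_form (\<lambda>x. c x + t * v x) \<in> L" by blast
    hence "{t. (\<lambda>x. c x + t * v x) \<notin> {c. linear_form c \<notin> L}} \<subseteq> {t}" using eq by auto
    thus ?thesis by (rule finite_subset) simp
  qed auto
qed

text \<open>The kernel of \<open>y\<close> on \<open>S/L\<close> may be nonzero, but only in
  finitely many degrees. Regularity itself is too much to ask: \<open>S/L\<close> may have depth
  \<open>0\<close>.\<close>

definition almost_regular :: "('x::finite, 'k::field) mpoly set \<Rightarrow> ('x, 'k) mpoly \<Rightarrow> bool" where
  "almost_regular L y \<longleftrightarrow> (\<exists>N. \<forall>e\<ge>N. \<forall>f\<in>homog_part e. y * f \<in> L \<longrightarrow> f \<in> L)"

text \<open>Multiplication by \<open>f\<close> gives the exact sequence \<open>0 \<rightarrow> S/(L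
  : f)(- d) \<rightarrow> S/L \<rightarrow> S/(L + \<langle>f\<rangle>) \<rightarrow> 0\<close>;
  injectivity in large degrees on the two ends implies it in the middle. The shift explains the
  bound \<open>N1 + d\<close>.\<close>

lemma almost_regular_extension:
  assumes L: "hidl L" and f: "f \<in> homog_part d"
    and y: "almost_regular {h. f * h \<in> L} y" "almost_regular (adj L f) y"
  shows "almost_regular L y"
proof -
  note idl = hidl_is_idl[OF L]
  obtain N1 N2 where N1: "\<And>e h. e \<ge> N1 \<Longrightarrow> h \<in> homog_part e \<Longrightarrow> f * (y * h) \<in> L \<Longrightarrow> f * h \<in> L"
    and N2: "\<And>e h. e \<ge> N2 \<Longrightarrow> h \<in> homog_part e \<Longrightarrow> y * h \<in> adj L f \<Longrightarrow> h \<in> adj L f"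
    using y unfolding almost_regular_def by blast
  have "h \<in> L" if e: "e \<ge> max (N1 + d) N2" and h: "h \<in> homog_part e" "y * h \<in> L" for e h
  proof -
    have "y * h \<in> adj L f" using h(2) subset_adj by blast
    hence "h \<in> adj L f" using N2[of e h] e h(1) by simp
    then obtain u q where u: "u \<in> L" "h = u + q * f" by (rule adjE)
    let ?q = "hcomp (e - d) q"
    have "h = hcomp e h" using hcomp_of_homog_same[OF h(1)] by simp
    also have "\<dots> = hcomp e u + f * ?q"
      using hcomp_mult[OF f, of e q] e by (simp add: u(2) hcomp_add mult.commute)
    finally have hq: "h = hcomp e u + f * ?q" .
    have uL: "hcomp e u \<in> L" by (rule hidl_hcomp[OF L u(1)])
    have "f * (y * ?q) = y * h - y * hcomp e u" by (subst hq) (simp add: algebra_simps)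
    hence "f * (y * ?q) \<in> L" using idl_diff[OF idl h(2) idl_mult[OF idl uL]] by metis
    moreover have "N1 \<le> e - d" using e by linarith
    ultimately have "f * ?q \<in> L" using N1[of "e - d" ?q] by simp
    thus "h \<in> L" using hq idl_add[OF idl uL] by metis
  qed
  thus ?thesis unfolding almost_regular_def by blast
qed

lemma hidl_colon:
  assumes L: "hidl L" and f: "f \<in> homog_part d" shows "hidl {h. f * h \<in> L}"
proof -
  note idl = hidl_is_idl[OF L]
  have "f * hcomp e h \<in> L" if "f * h \<in> L" for e h
    using hidl_hcomp[OF L that, of "d + e"] by (simp add: hcomp_mult[OF f])
  moreover have "f * (c * h) \<in> L" if "f * h \<in> L" for c h
    using idl_mult[OF idl that, of c] by (simp add: mult.left_commute)
  ultimately show ?thesis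
    unfolding hidl_def is_idl_def by (auto simp: idl_0[OF idl] ring_distribs intro: idl_add[OF idl])
qed

lemma homog_Suc_in_ideal:
  fixes L :: "('x::finite, 'k::field) mpoly set"
  assumes "is_idl L" "\<And>c. linear_form c \<in> L" "f \<in> homog_part (Suc e)"
  shows "f \<in> L"
proof -
  have "range mpoly_var \<subseteq> L" using assms(2) by (auto simp: mpoly_var_linear_form)
  hence "Idl\<^bsub>\<S>\<^esub> (range mpoly_var) \<subseteq> L" by (rule genideal_least[OF assms(1)])
  moreover have "lookup f 0 = 0" using lookup_homog_eq_0[OF assms(3), of 0] by simp
  ultimately show ?thesis using in_maximal_iff[of f] by blast
qed

text \<open>Noetherian induction takes the place of associated primes. If a form \<open>f\<close>
  outside \<open>L\<close> is a zero divisor modulo \<open>L\<close>, both \<open>L : f\<close> and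
  \<open>L + \<langle>f\<rangle>\<close> are strictly larger. Otherwise every linear form outside
  \<open>L\<close> is regular, and if there is none, \<open>S/L\<close> is zero in positive
  degrees.\<close>

lemma almost_regular_generic:
  fixes L :: "('x::finite, 'k::field_char_0) mpoly set"
  assumes "hidl L"
  shows "\<exists>U. line_generic U \<and> (\<forall>c\<in>U. almost_regular L (linear_form c))"
  using wf_hidl assms
proof (induction L rule: wf_induct_rule)
  case (less L)
  note L = less.prems and idl = hidl_is_idl[OF less.prems]
  show ?case
  proof (cases "\<exists>f g d. f \<in> homog_part d \<and> f \<notin> L \<and> g \<notin> L \<and> f * g \<in> L")
    case True
    then obtain f g d where f: "f \<in> homog_part d" "f \<notin> L" "g \<notin> L" "f * g \<in> L" by blast
    have h1: "hidl {h. f * h \<in> L}" by (rule hidl_colon[OF L f(1)])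
    have h2: "hidl (adj L f)" by (rule hidl_adj[OF L f(1)])
    have "L \<subset> {h. f * h \<in> L}" using f idl_mult[OF idl] by blast
    then obtain U where U: "line_generic U" "\<And>c. c \<in> U \<Longrightarrow> almost_regular {h. f * h \<in> L} (linear_form c)"
      using less.IH[of "{h. f * h \<in> L}"] L h1 by blast
    have "L \<subset> adj L f" using f(2) subset_adj[of L f] in_adj1[OF idl, of f] by blast
    then obtain V where V: "line_generic V" "\<And>c. c \<in> V \<Longrightarrow> almost_regular (adj L f) (linear_form c)"
      using less.IH[of "adj L f"] L h2 by blast
    have "almost_regular L (linear_form c)" if "c \<in> U \<inter> V" for c
      using almost_regular_extension[OF L f(1)] U(2) V(2) that by blast
    thus ?thesis using line_generic_Int[OF U(1) V(1)] by blast
  next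
    case prime: False
    show ?thesis
    proof (cases "\<exists>c. linear_form c \<notin> L")
      case True
      then obtain c0 where "linear_form c0 \<notin> L" by blast
      hence "line_generic {c. linear_form c \<notin> L}" by (rule line_generic_not_in_ideal[OF idl])
      moreover have "almost_regular L (linear_form c)" if "linear_form c \<notin> L" for c
        unfolding almost_regular_def using prime that linear_form_homog by blast
      ultimately show ?thesis by blast
    next
      case False
      have "almost_regular L y" for y :: "('x, 'k) mpoly"
        unfolding almost_regular_def
      proof (intro exI[of _ "Suc 0"] allI impI ballI)
        fix e and f :: "('x, 'k) mpoly" assume "Suc 0 \<le> e" "f \<in> homog_part e"
        thus "f \<in> L" using homog_Suc_in_ideal[OF idl, of f "e - 1"] False by auto
      qed
      thus ?thesis using line_generic_UNIV by blast
    qed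
  qed
qed

section \<open>Regularity and almost regular sequences\<close>

text \<open>The free resolution \<open>F\<close> of \<open>S/I\<close> is reduced modulo the ideals \<open>J j = \<langle>y 0, \<dots>, y (j - 1)\<rangle>\<close>.\<close>

locale resolution_sections =
  fixes I :: "('x::finite, 'k::field_char_0) mpoly set" and N A D and y :: "nat \<Rightarrow> ('x, 'k) mpoly"
  assumes res: "gres I N A D" and hidl_I: "hidl I"
    and y_linear: "\<And>i. i < CARD('x) \<Longrightarrow> y i \<in> homog_part 1"
    and y_indep: "\<And>i. i < CARD('x) \<Longrightarrow> y i \<notin> adjn {0} y i"
    and y_almost_regular: "\<And>i. i < CARD('x) \<Longrightarrow> almost_regular (adjn I y i) (y i)"
begin

definition J :: "nat \<Rightarrow> ('x, 'k) mpoly set" where "J j = adjn {0} y j"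

definition d :: "nat \<Rightarrow> (nat \<Rightarrow> ('x, 'k) mpoly) \<Rightarrow> nat \<Rightarrow> ('x, 'k) mpoly" where
  "d i = matrix_map (N i) (N (Suc i)) (D i)"

definition F :: "nat \<Rightarrow> (nat \<Rightarrow> ('x, 'k) mpoly) set" where "F i = free_module (N i)"

text \<open>\<open>bdry j i v\<close>: the class of \<open>v\<close> modulo \<open>J j\<close> is a boundary in degree \<open>i\<close>;
  \<open>acyclic j i e\<close>: the homology of \<open>F/J j F\<close> vanishes at \<open>F (i + 1)\<close> in degree \<open>e\<close>;
  \<open>injective j i e\<close>: multiplication by \<open>y j\<close> on the homology at \<open>F i\<close> is injective in degree \<open>e\<close>.\<close>

definition bdry :: "nat \<Rightarrow> nat \<Rightarrow> (nat \<Rightarrow> ('x, 'k) mpoly) \<Rightarrow> bool" where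
  "bdry j i v \<longleftrightarrow> (\<exists>w\<in>F (Suc i). \<forall>p. v p - d i w p \<in> J j)"

definition acyclic :: "nat \<Rightarrow> nat \<Rightarrow> nat \<Rightarrow> bool" where
  "acyclic j i e \<longleftrightarrow> (\<forall>v\<in>F (Suc i). hvec (A (Suc i)) e v \<longrightarrow> (\<forall>p. d i v p \<in> J j) \<longrightarrow> bdry j (Suc i) v)"

definition injective :: "nat \<Rightarrow> nat \<Rightarrow> nat \<Rightarrow> bool" where
  "injective j i e \<longleftrightarrow> (\<forall>v\<in>F i. hvec (A i) e v \<longrightarrow> bdry j i (\<lambda>p. y j * v p) \<longrightarrow> bdry j i v)"

lemma is_idl_J: "is_idl (J j)"
  unfolding J_def by (rule is_idl_adjn[OF is_idl_zero])

lemmas J_0 = idl_0[OF is_idl_J] and J_add = idl_add[OF is_idl_J] and J_mult = idl_mult[OF is_idl_J]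
  and J_diff = idl_diff[OF is_idl_J]

lemma hidl_J: "j \<le> CARD('x) \<Longrightarrow> hidl (J j)"
  unfolding J_def by (rule hidl_adjn[OF hidl_zero, where e = "\<lambda>_. 1"])
    (rule y_linear, erule less_le_trans, assumption)

lemma J_Suc: "J (Suc j) = adj (J j) (y j)"
  by (simp add: J_def)

lemma J_Suc_I: "f \<in> J j \<Longrightarrow> f + c * y j \<in> J (Suc j)"
  unfolding J_Suc by (rule adjI)

text \<open>On \<open>S\<close> itself, and hence on the free modules, the sequence is regular:
  \<open>J j\<close> is a prime ideal not containing \<open>y j\<close>. Only on \<open>S/I\<close>
  is it merely almost regular.\<close>

lemma y_cancel: "j < CARD('x) \<Longrightarrow> y j * f \<in> J j \<Longrightarrow> f \<in> J j"
  unfolding J_def using linear_ideal_prime[of j y "y j" f] y_linear y_indep by auto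

lemma J_maximal: "lookup f 0 = 0 \<Longrightarrow> f \<in> J (CARD('x))"
  unfolding J_def using linear_ideal_maximal[of "CARD('x)" y f] y_linear y_indep by blast

lemma J_constant_term:
  assumes "j \<le> CARD('x)" "f \<in> J j" shows "lookup f 0 = 0"
proof -
  have "hcomp 0 f \<in> J j" using assms hidl_hcomp[OF hidl_J] by blast
  have "J j \<subseteq> Idl\<^bsub>\<S>\<^esub> (range mpoly_var)"
    unfolding J_def
  proof (rule adjn_least[OF is_idl_genideal])
    show "{0} \<subseteq> Idl\<^bsub>\<S>\<^esub> (range mpoly_var :: ('x, 'k) mpoly set)" using idl_0[OF is_idl_genideal] by blast
    fix i assume "i < j"
    hence "y i \<in> homog_part 1" using assms(1) y_linear by simp
    hence "lookup (y i) 0 = 0" by (rule lookup_homog_eq_0) simp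
    thus "y i \<in> Idl\<^bsub>\<S>\<^esub> (range mpoly_var)" by (simp only: in_maximal_iff)
  qed
  thus ?thesis using assms(2) in_maximal_iff[of f] by blast
qed

lemma d_F: "d i v \<in> F i"
  unfolding d_def F_def by (rule matrix_map_free_module)

lemma d_diff: "d i (\<lambda>p. v p - w p) = (\<lambda>p. d i v p - d i w p)"
  and d_smult: "d i (\<lambda>p. c * v p) = (\<lambda>p. c * d i v p)"
  unfolding d_def by (rule matrix_map_diff matrix_map_smult)+

lemma d_gcomp: "gcomp (A i) e (d i v) = d i (gcomp (A (Suc i)) e v)"
  unfolding d_def by (rule gcomp_matrix_map[OF gres_graded[OF res]])

lemma d_J: "(\<And>p. v p \<in> J j) \<Longrightarrow> d i v p \<in> J j"
  unfolding d_def matrix_map_def by (auto intro!: idl_sum[OF is_idl_J] J_mult J_0)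

lemma exact: "v \<in> F (Suc i) \<Longrightarrow> d i v = (\<lambda>_. 0) \<longleftrightarrow> (\<exists>w\<in>F (Suc (Suc i)). v = d (Suc i) w)"
  using gres_exact[OF res, of i] unfolding F_def d_def by blast

lemma d_d: "w \<in> F (Suc (Suc i)) \<Longrightarrow> d i (d (Suc i) w) = (\<lambda>_. 0)"
  using exact[OF d_F] by blast

lemma F_diff: "v \<in> F i \<Longrightarrow> w \<in> F i \<Longrightarrow> (\<lambda>p. v p - w p) \<in> F i"
  and F_smult: "v \<in> F i \<Longrightarrow> (\<lambda>p. c * v p) \<in> F i"
  and F_gcomp: "v \<in> F i \<Longrightarrow> gcomp a e v \<in> F i"
  and F_0: "(\<lambda>_. 0) \<in> F i"
  unfolding F_def by (rule free_module_diff free_module_smult gcomp_free_module free_module_0; assumption?)+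

lemma hvec_y_mult: "j < CARD('x) \<Longrightarrow> hvec a e v \<Longrightarrow> hvec a (Suc e) (\<lambda>p. y j * v p)"
  using hvec_smult[of a e v "y j" 1] y_linear by simp

lemma gcomp_y_mult: "j < CARD('x) \<Longrightarrow> gcomp a (Suc e) (\<lambda>p. y j * v p) = (\<lambda>p. y j * gcomp a e v p)"
  using gcomp_smult[of "y j" 1 a e v] y_linear by simp

lemma gcomp_y_mult_0: "j < CARD('x) \<Longrightarrow> gcomp a 0 (\<lambda>p. y j * v p) = (\<lambda>_. 0)"
  by (auto simp: gcomp_def hcomp_mult[OF y_linear])

lemma J_gcomp: "j \<le> CARD('x) \<Longrightarrow> (\<And>p. v p \<in> J j) \<Longrightarrow> gcomp a e v p \<in> J j"
  by (auto simp: gcomp_def hidl_hcomp[OF hidl_J] J_0)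

section \<open>Homology of the reduced resolution\<close>

lemma bdry_homogeneous:
  assumes j: "j \<le> CARD('x)" and v: "bdry j i v" "hvec (A i) e v"
  obtains w where "w \<in> F (Suc i)" "hvec (A (Suc i)) e w" "\<And>p. v p - d i w p \<in> J j"
proof -
  obtain w where w: "w \<in> F (Suc i)" "\<And>p. v p - d i w p \<in> J j" using v(1) by (auto simp: bdry_def)
  have "gcomp (A i) e (\<lambda>p. v p - d i w p) p \<in> J j" for p by (rule J_gcomp[OF j]) (rule w(2))
  hence "v p - d i (gcomp (A (Suc i)) e w) p \<in> J j" for p
    by (simp add: gcomp_diff gcomp_hvec[OF v(2)] d_gcomp)
  thus thesis using that[OF F_gcomp[OF w(1)] hvec_gcomp] by blast
qed

lemma J_Suc_decompose:
  assumes "v \<in> F i" "\<And>p. v p \<in> J (Suc j)"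
  obtains u where "u \<in> F i" "\<And>p. v p - y j * u p \<in> J j"
proof -
  have "\<exists>c. v p - y j * c \<in> J j" for p
  proof -
    obtain g c where "g \<in> J j" "v p = g + c * y j" using assms(2)[of p] unfolding J_Suc by (rule adjE)
    hence "v p - y j * c \<in> J j" by (simp add: mult.commute)
    thus ?thesis by blast
  qed
  then obtain u where u: "\<And>p. v p - y j * u p \<in> J j" by metis
  let ?u = "\<lambda>p. if p < N i then u p else 0"
  have v0: "v p = 0" if "\<not> p < N i" for p using assms(1) that by (simp add: F_def free_module_def)
  show thesis
  proof (rule that)
    show "?u \<in> F i" by (simp add: F_def free_module_def)
    show "v p - y j * ?u p \<in> J j" for p using u[of p] v0[of p] J_0 by simp
  qed
qed

text \<open>The part \<open>H(i+1)(F/J j) \<rightarrow> H(i+1)(F/J (j+1)) \<rightarrow> H(i)(F/J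
  j)(- 1) \<rightarrow> H(i)(F/J j)\<close> of the long exact sequence of multiplication by
  \<open>y j\<close>, in degree \<open>e\<close>. The premise \<open>lower\<close> makes the last
  map injective in degree \<open>e - 1\<close>; it is empty for \<open>e = 0\<close>. The cycle
  condition on \<open>u\<close> is restricted to \<open>i = Suc k\<close>, as every element of
  \<open>F 0\<close> is a cycle.\<close>

lemma acyclic_Suc:
  assumes j: "j < CARD('x)" and ac: "acyclic j i e"
    and lower: "\<And>u e'. e = Suc e' \<Longrightarrow> u \<in> F i \<Longrightarrow> hvec (A i) e' u \<Longrightarrow> bdry j i (\<lambda>p. y j * u p) \<Longrightarrow>
      (\<And>k p. i = Suc k \<Longrightarrow> d k u p \<in> J j) \<Longrightarrow> bdry j i u"
  shows "acyclic (Suc j) i e"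
  unfolding acyclic_def
proof (intro ballI impI)
  fix v assume v: "v \<in> F (Suc i)" "hvec (A (Suc i)) e v" "\<forall>p. d i v p \<in> J (Suc j)"
  \<comment> \<open>The connecting homomorphism: the boundary of a cycle modulo
    \<open>J (Suc j)\<close> is \<open>y j\<close> times an element, whose component of degree
    \<open>e - 1\<close> represents the image of the class of \<open>v\<close>.\<close>
  obtain u0 where u0: "u0 \<in> F i" "\<And>p. d i v p - y j * u0 p \<in> J j"
    using J_Suc_decompose[OF d_F] v(3) by blast
  have dv: "gcomp (A i) e (d i v) = d i v" by (simp add: d_gcomp gcomp_hvec[OF v(2)])
  have u0': "gcomp (A i) e (\<lambda>p. d i v p - y j * u0 p) p \<in> J j" for p
    by (rule J_gcomp) (use j u0 in auto)
  have "\<exists>w\<in>F (Suc i). hvec (A (Suc i)) e (\<lambda>p. y j * w p) \<and> (\<forall>p. d i v p - y j * d i w p \<in> J j)"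
  proof (cases e)
    case 0
    have "d i v p \<in> J j" for p using u0'[of p] by (simp add: gcomp_diff dv 0 gcomp_y_mult_0[OF j] dv[unfolded 0])
    moreover have "d i (\<lambda>_. 0) = (\<lambda>_. 0)" using d_smult[of i 0 "\<lambda>_. 0"] by simp
    moreover have "hvec (A (Suc i)) e (\<lambda>_. 0)" by (simp add: hvec_def)
    ultimately show ?thesis using F_0 by (intro bexI[of _ "\<lambda>_. 0"]) auto
  next
    case (Suc e')
    define u where "u = gcomp (A i) e' u0"
    have u: "u \<in> F i" "hvec (A i) e' u" using F_gcomp[OF u0(1)] hvec_gcomp by (auto simp: u_def)
    have du: "d i v p - y j * u p \<in> J j" for p
      using u0'[of p] dv by (simp add: gcomp_diff Suc gcomp_y_mult[OF j] u_def)
    have "bdry j i (\<lambda>p. y j * u p)"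
      unfolding bdry_def
    proof (intro bexI[of _ v] allI)
      fix p show "y j * u p - d i v p \<in> J j" using idl_uminus[OF is_idl_J du[of p]] by simp
    qed (rule v(1))
    moreover have "d k u p \<in> J j" if k: "i = Suc k" for k p
    proof -
      have "d k (\<lambda>p. d i v p - y j * u p) p \<in> J j" by (rule d_J[OF du])
      hence "- (y j * d k u p) \<in> J j" using d_d[of v k] v(1) k by (simp add: d_diff d_smult)
      hence "y j * d k u p \<in> J j" using idl_uminus[OF is_idl_J] by force
      thus ?thesis by (rule y_cancel[OF j])
    qed
    ultimately have "bdry j i u" using lower[OF Suc u] by blast
    then obtain w where w: "w \<in> F (Suc i)" "hvec (A (Suc i)) e' w" "\<And>p. u p - d i w p \<in> J j"
      using bdry_homogeneous[of j i u e'] j u(2) by auto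
    have "d i v p - y j * d i w p \<in> J j" for p
    proof -
      have "d i v p - y j * d i w p = (d i v p - y j * u p) + y j * (u p - d i w p)" by (simp add: algebra_simps)
      thus ?thesis using J_add[OF du J_mult[OF w(3)]] by metis
    qed
    thus ?thesis using w(1) hvec_y_mult[OF j w(2)] Suc by blast
  qed
  then obtain w where w: "w \<in> F (Suc i)" "hvec (A (Suc i)) e (\<lambda>p. y j * w p)" "\<And>p. d i v p - y j * d i w p \<in> J j"
    by blast
  \<comment> \<open>The corrected vector is a cycle modulo \<open>J j\<close> and agrees with
    \<open>v\<close> modulo \<open>J (Suc j)\<close>.\<close>
  have "bdry j (Suc i) (\<lambda>p. v p - y j * w p)"
    using ac F_diff[OF v(1) F_smult[OF w(1)]] hvec_diff[OF v(2) w(2)] w(3)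
    unfolding acyclic_def by (simp add: d_diff d_smult)
  then obtain z where z: "z \<in> F (Suc (Suc i))" "\<And>p. v p - y j * w p - d (Suc i) z p \<in> J j"
    by (auto simp: bdry_def)
  have "v p - d (Suc i) z p \<in> J (Suc j)" for p
    using J_Suc_I[OF z(2), of p "w p"] by (simp add: algebra_simps)
  thus "bdry (Suc j) (Suc i) v" unfolding bdry_def using z(1) by blast
qed

lemma acyclic_0: "acyclic 0 i e"
  unfolding acyclic_def bdry_def
proof (intro ballI impI)
  fix v assume v: "v \<in> F (Suc i)" "\<forall>p. d i v p \<in> J 0"
  hence "d i v = (\<lambda>_. 0)" by (auto simp: J_def)
  then obtain w where "w \<in> F (Suc (Suc i))" "v = d (Suc i) w" using exact[OF v(1)] by blast
  thus "\<exists>w\<in>F (Suc (Suc i)). \<forall>p. v p - d (Suc i) w p \<in> J 0" by (metis J_0 diff_self)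
qed

text \<open>The homology at index \<open>0\<close> is \<open>S/(I + J j)\<close>. This is where
  statements on the reduced resolution turn into statements on the quotients of
  \<open>S/I\<close>.\<close>

lemma bdry_0_iff: "v \<in> F 0 \<Longrightarrow> bdry j 0 v \<longleftrightarrow> v 0 \<in> adjn I y j"
proof -
  assume v: "v \<in> F 0"
  have N0: "N 0 = Suc 0" by (rule gres_start[OF res])
  have im: "d 0 ` F (Suc 0) = {v \<in> free_module (Suc 0). v 0 \<in> I}"
    unfolding d_def F_def by (rule gres_image[OF res])
  show ?thesis
    unfolding adjn_eq_sum[OF hidl_is_idl[OF hidl_I]]
  proof
    assume "bdry j 0 v"
    then obtain w where "w \<in> F (Suc 0)" "\<And>p. v p - d 0 w p \<in> J j" by (auto simp: bdry_def)
    thus "\<exists>f\<in>I. v 0 - f \<in> adjn {0} y j" using im unfolding J_def by blast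
  next
    assume "\<exists>f\<in>I. v 0 - f \<in> adjn {0} y j"
    then obtain f where f: "f \<in> I" "v 0 - f \<in> J j" by (auto simp: J_def)
    let ?f = "\<lambda>p. if p = (0::nat) then f else 0"
    have "?f \<in> {v \<in> free_module (Suc 0). v 0 \<in> I}" using f(1) by (simp add: free_module_def)
    then obtain w where w: "w \<in> F (Suc 0)" "?f = d 0 w" using im by (metis (no_types, lifting) imageE)
    have "v p - d 0 w p \<in> J j" for p
    proof (cases p)
      case 0 thus ?thesis using f(2) fun_cong[OF w(2), of p] by simp
    next
      case (Suc q)
      hence "v p = 0" using v by (simp add: F_def N0 free_module_def)
      thus ?thesis using Suc fun_cong[OF w(2), of p] J_0 by simp
    qed
    thus "bdry j 0 v" unfolding bdry_def using w(1) by blast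
  qed
qed

lemma hvec_0: "hvec (A 0) e v \<Longrightarrow> v 0 \<in> homog_part e"
  using hvecD[of "A 0" e v 0] by (simp add: gres_start[OF res])

text \<open>In the exact sequence behind \<open>acyclic_Suc\<close>, the kernel of
  \<open>y j\<close> at index \<open>0\<close> vanishes in large degrees because \<open>y j\<close>
  is almost regular modulo \<open>adjn I y j\<close>; at a positive index the whole homology
  vanishes there by induction.\<close>

lemma acyclic_eventually: "j \<le> CARD('x) \<Longrightarrow> \<exists>M. \<forall>e\<ge>M. acyclic j i e"
proof (induction j arbitrary: i)
  case 0
  show ?case using acyclic_0 by blast
next
  case (Suc j)
  hence j: "j < CARD('x)" by simp
  obtain M where M: "\<And>e. e \<ge> M \<Longrightarrow> acyclic j i e" using Suc by (meson Suc_leD)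
  show ?case
  proof (cases i)
    case 0
    obtain N' where N': "\<And>e f. e \<ge> N' \<Longrightarrow> f \<in> homog_part e \<Longrightarrow> y j * f \<in> adjn I y j \<Longrightarrow> f \<in> adjn I y j"
      using y_almost_regular[OF j] unfolding almost_regular_def by blast
    have "acyclic (Suc j) i e" if e: "e \<ge> max M (Suc N')" for e
    proof (rule acyclic_Suc[OF j M])
      fix u e' assume u: "e = Suc e'" "u \<in> F i" "hvec (A i) e' u" "bdry j i (\<lambda>p. y j * u p)"
      have "y j * u 0 \<in> adjn I y j" using u F_smult[OF u(2), of "y j"] bdry_0_iff 0 by blast
      moreover have "u 0 \<in> homog_part e'" by (rule hvec_0[OF u(3)[unfolded 0]])
      ultimately have "u 0 \<in> adjn I y j" using N'[of e' "u 0"] u(1) e by simp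
      thus "bdry j i u" using bdry_0_iff u(2) 0 by blast
    qed (use e in simp)
    thus ?thesis by blast
  next
    case (Suc k)
    obtain M' where M': "\<And>e. e \<ge> M' \<Longrightarrow> acyclic j k e" using Suc.IH j by (meson less_imp_le)
    have "acyclic (Suc j) i e" if e: "e \<ge> max M (Suc M')" for e
    proof (rule acyclic_Suc[OF j M])
      fix u e' assume u: "e = Suc e'" "u \<in> F i" "hvec (A i) e' u" "\<And>k p. i = Suc k \<Longrightarrow> d k u p \<in> J j"
      have "acyclic j k e'" using M' u(1) e by simp
      thus "bdry j i u" using u(2-4) Suc unfolding acyclic_def by blast
    qed (use e in simp)
    thus ?thesis by blast
  qed
qed

text \<open>Each further form pushes nonzero homology up by at most one index, and \<open>F\<close>
  itself is exact at positive indices. This is the vanishing of \<open>Tor\<close> of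
  \<open>S/I\<close> and \<open>S/J j\<close> in indices above \<open>j\<close>, since
  \<open>y\<close> is regular on \<open>S\<close>.\<close>

lemma acyclic_above: "j \<le> CARD('x) \<Longrightarrow> j \<le> i \<Longrightarrow> acyclic j i e"
proof (induction j arbitrary: i e)
  case 0 show ?case by (rule acyclic_0)
next
  case (Suc j i e)
  then obtain k where k: "i = Suc k" "j \<le> k" by (metis Suc_le_D Suc_le_mono)
  show ?case
  proof (rule acyclic_Suc)
    show "j < CARD('x)" using Suc.prems by simp
    show "acyclic j i e" using Suc by simp
    fix u e' assume u: "u \<in> F i" "hvec (A i) e' u" "\<And>k p. i = Suc k \<Longrightarrow> d k u p \<in> J j"
    have "acyclic j k e'" using Suc k by simp
    thus "bdry j i u" using u k unfolding acyclic_def by blast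
  qed
qed

text \<open>Hilbert's syzygy theorem. Modulo all forms, that is modulo the maximal ideal, the
  differentials of a minimal resolution are zero, so a basis vector of \<open>F (Suc i)\<close> is a
  nonzero class, against \<open>acyclic_above\<close>.\<close>

lemma resolution_length:
  assumes i: "i \<ge> CARD('x)" shows "N (Suc i) = 0"
proof (rule ccontr)
  assume "N (Suc i) \<noteq> 0"
  \<comment> \<open>The entries of the first matrix \<open>D 0\<close> may be constants; there is at
    least one variable, so \<open>i\<close> is positive and \<open>D i\<close> is covered by
    minimality.\<close>
  obtain k where k: "i = Suc k" using i zero_less_card_finite[where 'a = 'x] by (cases i) auto
  let ?v = "\<lambda>p. if p = (0::nat) then 1 else (0 :: ('x, 'k) mpoly)"
  have v: "?v \<in> F (Suc i)" using \<open>N (Suc i) \<noteq> 0\<close> by (simp add: F_def free_module_def)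
  have "hvec (A (Suc i)) (A (Suc i) 0) ?v"
    using homog_part_const[of 1] by (simp add: hvec_def)
  moreover have "d i ?v p \<in> J (CARD('x))" for p
  proof -
    have "lookup (d i ?v p) 0 = 0"
      using gres_minimal[OF res, of p k 0] \<open>N (Suc i) \<noteq> 0\<close>
      by (simp add: d_def matrix_map_def if_distrib k cong: if_cong)
    thus ?thesis by (rule J_maximal)
  qed
  ultimately have "bdry (CARD('x)) (Suc i) ?v"
    using acyclic_above[OF order_refl i, of "A (Suc i) 0"] v unfolding acyclic_def by blast
  then obtain w where w: "\<And>p. ?v p - d (Suc i) w p \<in> J (CARD('x))" by (auto simp: bdry_def)
  have "lookup (1 - d (Suc i) w 0) 0 = 0" using J_constant_term[OF order_refl w[of 0]] by simp
  moreover have "lookup (d (Suc i) w 0) 0 = 0"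
  proof -
    note m = is_idl_genideal[of "range mpoly_var :: ('x, 'k) mpoly set"]
    have "D (Suc i) 0 q \<in> Idl\<^bsub>\<S>\<^esub> (range mpoly_var)" if "q < N (Suc (Suc i))" for q
      using gres_minimal[OF res, of 0 i q] that \<open>N (Suc i) \<noteq> 0\<close> by (simp add: in_maximal_iff)
    hence "d (Suc i) w 0 \<in> Idl\<^bsub>\<S>\<^esub> (range mpoly_var)"
      unfolding d_def matrix_map_def by (auto intro!: idl_sum[OF m] idl_mult2[OF m] idl_0[OF m])
    thus ?thesis by (simp only: in_maximal_iff)
  qed
  ultimately show False by (simp add: lookup_minus)
qed

text \<open>The next piece of the long exact sequence: the kernel of \<open>y j\<close> on the
  homology at \<open>F i\<close> in degree \<open>e\<close> is the image of the homology of
  \<open>F/J (Suc j)\<close> at \<open>F (Suc i)\<close> in degree \<open>e + 1\<close>.\<close>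

lemma injective_of_acyclic:
  assumes j: "j < CARD('x)" and ac: "acyclic (Suc j) i (Suc e)"
  shows "injective j i e"
  unfolding injective_def
proof (intro ballI impI)
  fix v assume v: "v \<in> F i" "hvec (A i) e v" "bdry j i (\<lambda>p. y j * v p)"
  obtain w where w: "w \<in> F (Suc i)" "hvec (A (Suc i)) (Suc e) w" "\<And>p. y j * v p - d i w p \<in> J j"
    using bdry_homogeneous[OF _ v(3) hvec_y_mult[OF j v(2)]] j by auto
  have "d i w p \<in> J (Suc j)" for p
  proof -
    have "- (y j * v p - d i w p) + v p * y j \<in> J (Suc j)"
      by (intro J_Suc_I idl_uminus[OF is_idl_J] w(3))
    thus ?thesis by (simp add: mult.commute)
  qed
  hence "bdry (Suc j) (Suc i) w" using ac w unfolding acyclic_def by blast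
  then obtain z where z: "z \<in> F (Suc (Suc i))" "\<And>p. w p - d (Suc i) z p \<in> J (Suc j)"
    by (auto simp: bdry_def)
  obtain u where u: "u \<in> F (Suc i)" "\<And>p. (w p - d (Suc i) z p) - y j * u p \<in> J j"
    using J_Suc_decompose[OF F_diff[OF w(1) d_F] z(2)] by blast
  have "d i (\<lambda>p. (w p - d (Suc i) z p) - y j * u p) p \<in> J j" for p by (rule d_J[OF u(2)])
  hence dw: "d i w p - y j * d i u p \<in> J j" for p using d_d[OF z(1)] by (simp add: d_diff d_smult)
  have "v p - d i u p \<in> J j" for p
  proof (rule y_cancel[OF j])
    have "y j * (v p - d i u p) = (y j * v p - d i w p) + (d i w p - y j * d i u p)" by (simp add: algebra_simps)
    thus "y j * (v p - d i u p) \<in> J j" using J_add[OF w(3) dw] by metis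
  qed
  thus "bdry j i v" unfolding bdry_def using u(1) by blast
qed

lemma acyclic_step_down:
  assumes j: "j < CARD('x)" and "acyclic j i (Suc e)" "injective j (Suc i) e"
  shows "acyclic j i e"
  unfolding acyclic_def
proof (intro ballI impI)
  fix v assume v: "v \<in> F (Suc i)" "hvec (A (Suc i)) e v" "\<forall>p. d i v p \<in> J j"
  hence "bdry j (Suc i) (\<lambda>p. y j * v p)"
    using assms(2) F_smult[OF v(1), of "y j"] hvec_y_mult[OF j v(2)] J_mult
    unfolding acyclic_def by (simp add: d_smult)
  thus "bdry j (Suc i) v" using assms(3) v unfolding injective_def by blast
qed

context
  fixes r :: int
  assumes bound: "\<And>i q. q < N (Suc i) \<Longrightarrow> int (A (Suc i) q) \<le> r + int i"
begin

text \<open>With all forms divided out, a vector of degree above all shifts has entries without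
  constant term, so it is zero modulo the maximal ideal. From there the induction descends on
  \<open>j\<close>; for each \<open>j\<close>, an inner one descends on the degree, starting at a
  degree from which vanishing is known.\<close>

lemma acyclic_regularity:
  assumes "j \<le> CARD('x)" "int e > r + int i" shows "acyclic j i e"
  using assms
proof (induction "CARD('x) - j" arbitrary: j i e)
  case 0
  hence j: "j = CARD('x)" by simp
  show ?case
    unfolding acyclic_def bdry_def
  proof (intro ballI impI)
    fix v assume v: "v \<in> F (Suc i)" "hvec (A (Suc i)) e v"
    have "v p \<in> J j" for p
    proof (cases "p < N (Suc i)")
      case True
      hence lt: "A (Suc i) p < e" using bound[OF True] 0(3) by linarith
      hence "v p \<in> homog_part (e - A (Suc i) p)" using hvecD[OF v(2)] by simp
      hence "lookup (v p) 0 = 0" by (rule lookup_homog_eq_0) (use lt in simp)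
      thus ?thesis unfolding j by (rule J_maximal)
    next
      case False thus ?thesis using v(1) J_0 by (simp add: F_def free_module_def)
    qed
    moreover have "d (Suc i) (\<lambda>_. 0) = (\<lambda>_. 0)" using d_smult[of "Suc i" 0 "\<lambda>_. 0"] by simp
    ultimately show "\<exists>w\<in>F (Suc (Suc i)). \<forall>p. v p - d (Suc i) w p \<in> J j"
      using F_0 by (intro bexI[of _ "\<lambda>_. 0"]) auto
  qed
next
  case (Suc n)
  hence j: "j < CARD('x)" by simp
  have IH: "acyclic (Suc j) i e" if "int e > r + int i" for i e using Suc.hyps that j by simp
  obtain M where M: "\<And>e. e \<ge> M \<Longrightarrow> acyclic j i e" using acyclic_eventually j by (meson less_imp_le)
  show ?case
    using Suc.prems(2)
  proof (induction "M - e" arbitrary: e)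
    case 0 thus ?case using M by simp
  next
    case (Suc m)
    have "acyclic j i (Suc e)" using Suc by simp
    \<comment> \<open>This needs the homology for \<open>Suc j\<close> at index and degree one
      higher than those of the goal twice in the index and once in the degree:
      \<open>acyclic (Suc j) (Suc i) (Suc e)\<close>, and the strict inequality with
      \<open>r + i\<close> is unchanged when \<open>e\<close> and \<open>i\<close> grow
      together.\<close>
    moreover have "injective j (Suc i) e"
      using injective_of_acyclic[OF j] IH[of "Suc i" "Suc e"] Suc.prems by simp
    ultimately show ?case by (rule acyclic_step_down[OF j])
  qed
qed

text \<open>Injectivity in degree \<open>e\<close> needs acyclicity in degree \<open>e + 1\<close>,
  so the strict bound \<open>e + 1 > r\<close> gives the closed range
  \<open>e \<ge> r\<close>.\<close>

lemma regular_above_regularity: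
  assumes j: "j < CARD('x)" and e: "int e \<ge> r" and f: "f \<in> homog_part e" "y j * f \<in> adjn I y j"
  shows "f \<in> adjn I y j"
proof -
  have "acyclic (Suc j) 0 (Suc e)" using acyclic_regularity[of "Suc j" 0 "Suc e"] j e by simp
  hence inj: "injective j 0 e" by (rule injective_of_acyclic[OF j])
  let ?v = "\<lambda>p. if p = (0::nat) then f else 0"
  have v: "?v \<in> F 0" by (simp add: F_def free_module_def gres_start[OF res])
  have "hvec (A 0) e ?v" using f(1) by (simp add: hvec_def gres_start[OF res])
  moreover have "bdry j 0 (\<lambda>p. y j * ?v p)" using bdry_0_iff[OF F_smult[OF v], of j] f(2) by simp
  ultimately have "bdry j 0 ?v" using inj v unfolding injective_def by blast
  thus ?thesis using bdry_0_iff[OF v, of j] by simp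
qed

end

end

section \<open>Hilbert functions\<close>

interpretation mv: vector_space "\<lambda>(c::'k::field) (f::('x::finite, 'k) mpoly). mpoly_const c * f"
  by standard (auto simp: ring_distribs mpoly_const_add mpoly_const_mult mult.assoc)

definition add_line :: "('x::finite, 'k::field) mpoly set \<Rightarrow> ('x, 'k) mpoly \<Rightarrow> ('x, 'k) mpoly set" where
  "add_line V v = {u + mpoly_const c * v | u c. u \<in> V}"

text \<open>The dimension of \<open>V/U\<close>, in the inductive form of \<open>dimension\<close> in HOL-Algebra, on which \<open>HF\<close> is
  based.\<close>

inductive codim :: "('x::finite, 'k::field) mpoly set \<Rightarrow> ('x, 'k) mpoly set \<Rightarrow> nat \<Rightarrow> bool" for U where
  codim_refl: "codim U U 0"
| codim_step: "codim U V n \<Longrightarrow> v \<notin> V \<Longrightarrow> codim U (add_line V v) (Suc n)"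

lemma codim_trans: "codim V W m \<Longrightarrow> codim U V n \<Longrightarrow> codim U W (n + m)"
  by (induction rule: codim.induct) (auto intro: codim_step)

lemma subspace_add_line:
  assumes V: "mv.subspace V" shows "mv.subspace (add_line V v)"
proof (rule mv.subspaceI)
  have "0 = 0 + mpoly_const 0 * v" by simp
  thus "0 \<in> add_line V v" unfolding add_line_def using mv.subspace_0[OF V] by blast
next
  fix f g assume "f \<in> add_line V v" "g \<in> add_line V v"
  then obtain a c b d where *: "a \<in> V" "b \<in> V" "f = a + mpoly_const c * v" "g = b + mpoly_const d * v"
    unfolding add_line_def by blast
  have "f + g = (a + b) + mpoly_const (c + d) * v" by (simp add: * mpoly_const_add algebra_simps)
  thus "f + g \<in> add_line V v" unfolding add_line_def using mv.subspace_add[OF V *(1,2)] by blast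
next
  fix e f assume "f \<in> add_line V v"
  then obtain a c where *: "a \<in> V" "f = a + mpoly_const c * v" unfolding add_line_def by blast
  have "mpoly_const e * f = mpoly_const e * a + mpoly_const (e * c) * v"
    by (simp add: * mpoly_const_mult algebra_simps)
  thus "mpoly_const e * f \<in> add_line V v" unfolding add_line_def using mv.subspace_scale[OF V *(1)] by blast
qed

lemma subset_add_line: "V \<subseteq> add_line V v"
proof
  fix f assume "f \<in> V"
  moreover have "f = f + mpoly_const 0 * v" by simp
  ultimately show "f \<in> add_line V v" unfolding add_line_def by blast
qed

lemma in_add_line: "mv.subspace V \<Longrightarrow> v \<in> add_line V v"
proof -
  assume "mv.subspace V"
  moreover have "v = 0 + mpoly_const 1 * v" by simp
  ultimately show ?thesis unfolding add_line_def using mv.subspace_0 by blast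
qed

lemma add_line_least: "mv.subspace W \<Longrightarrow> V \<subseteq> W \<Longrightarrow> v \<in> W \<Longrightarrow> add_line V v \<subseteq> W"
  unfolding add_line_def by (auto intro!: mv.subspace_add mv.subspace_scale)

lemma codim_subspace: "codim U V n \<Longrightarrow> mv.subspace U \<Longrightarrow> mv.subspace V \<and> U \<subseteq> V"
proof (induction rule: codim.induct)
  case (codim_step V n v)
  thus ?case using subspace_add_line subset_add_line by blast
qed simp

definition fin_span :: "('x::finite, 'k::field) mpoly set \<Rightarrow> bool" where
  "fin_span V \<longleftrightarrow> (\<exists>T. finite T \<and> V \<subseteq> mv.span T)"

lemma fin_span_mono: "V \<subseteq> W \<Longrightarrow> fin_span W \<Longrightarrow> fin_span V"
  unfolding fin_span_def by blast

lemma fin_span_independent: "fin_span V \<Longrightarrow> B \<subseteq> V \<Longrightarrow> mv.independent B \<Longrightarrow> finite B"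
  unfolding fin_span_def using mv.independent_span_bound by blast

lemma fin_span_basis:
  assumes "fin_span V"
  obtains B where "finite B" "B \<subseteq> V" "mv.independent B" "V \<subseteq> mv.span B" "card B = mv.dim V"
proof -
  obtain B where B: "B \<subseteq> V" "mv.independent B" "V \<subseteq> mv.span B" "card B = mv.dim V"
    by (rule mv.basis_exists[of V])
  show thesis by (rule that[OF fin_span_independent[OF assms B(1,2)] B])
qed

lemma card_le_dim:
  assumes "fin_span V" "B \<subseteq> V" "mv.independent B" shows "card B \<le> mv.dim V"
proof -
  obtain C where C: "finite C" "V \<subseteq> mv.span C" "card C = mv.dim V" using fin_span_basis[OF assms(1)] by metis
  have "B \<subseteq> mv.span C" using assms(2) C(2) by blast
  thus ?thesis using mv.independent_span_bound[OF C(1) assms(3)] C(3) by simp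
qed

lemma dim_add_line:
  assumes V: "mv.subspace V" "fin_span V" "v \<notin> V"
  shows "fin_span (add_line V v) \<and> mv.dim (add_line V v) = Suc (mv.dim V)"
proof -
  obtain B where B: "finite B" "B \<subseteq> V" "mv.independent B" "V \<subseteq> mv.span B" "card B = mv.dim V"
    using fin_span_basis[OF V(2)] by metis
  have "mv.span B \<subseteq> V" by (rule mv.span_minimal[OF B(2) V(1)])
  hence v: "v \<notin> mv.span B" using V(3) by blast
  have "insert v B \<subseteq> add_line V v" using B(2) subset_add_line[of V v] in_add_line[OF V(1), of v] by blast
  moreover have sp: "add_line V v \<subseteq> mv.span (insert v B)"
  proof (rule add_line_least[OF mv.subspace_span])
    show "V \<subseteq> mv.span (insert v B)" using B(4) mv.span_mono[of B "insert v B"] by blast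
    show "v \<in> mv.span (insert v B)" by (rule mv.span_base) simp
  qed
  moreover have "mv.independent (insert v B)" by (rule mv.independent_insertI[OF v B(3)])
  ultimately have "card (insert v B) = mv.dim (add_line V v)" by (rule mv.basis_card_eq_dim)
  moreover have "v \<notin> B" using V(3) B(2) by blast
  ultimately show ?thesis using B(1,5) sp unfolding fin_span_def by (metis card_insert_disjoint finite_insert)
qed

lemma codim_dim:
  "codim U V n \<Longrightarrow> mv.subspace U \<Longrightarrow> fin_span U \<Longrightarrow> fin_span V \<and> mv.dim V = mv.dim U + n"
proof (induction rule: codim.induct)
  case (codim_step V n v)
  thus ?case using dim_add_line[of V v] codim_subspace[of U V n] by simp
qed simp

lemma codim_exists:
  assumes U: "mv.subspace U" and V: "mv.subspace V" "fin_span V" and "U \<subseteq> V"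
  shows "\<exists>n. codim U V n"
proof -
  obtain B where B: "finite B" "B \<subseteq> V" "V \<subseteq> mv.span B" using fin_span_basis[OF V(2)] by metis
  have "\<exists>V' n. codim U V' n \<and> C \<subseteq> V' \<and> V' \<subseteq> V" if "finite C" "C \<subseteq> V" for C
    using that
  proof (induction C rule: finite_induct)
    case empty thus ?case using codim_refl assms(4) by blast
  next
    case (insert v C)
    then obtain V' n where V': "codim U V' n" "C \<subseteq> V'" "V' \<subseteq> V" by blast
    note sub = conjunct1[OF codim_subspace[OF V'(1) U]]
    show ?case
    proof (cases "v \<in> V'")
      case True thus ?thesis using V' by blast
    next
      case False
      have "insert v C \<subseteq> add_line V' v" using V'(2) subset_add_line[of V' v] in_add_line[OF sub, of v] by blast
      moreover have "add_line V' v \<subseteq> V" using add_line_least[OF V(1) V'(3)] insert.prems by blast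
      ultimately show ?thesis using codim_step[OF V'(1) False] by blast
    qed
  qed
  from this[OF B(1,2)] obtain V' n where V': "codim U V' n" "B \<subseteq> V'" "V' \<subseteq> V" by blast
  have "mv.span B \<subseteq> V'" using V'(2) conjunct1[OF codim_subspace[OF V'(1) U]] by (rule mv.span_minimal)
  hence "V' = V" using B(3) V'(3) by blast
  thus ?thesis using V'(1) by blast
qed

text \<open>Rank and nullity for the map induced by \<open>y\<close> from \<open>V/U\<close> to the
  quotient by \<open>W\<close>: \<open>m\<close> is the dimension of the image, and equality with
  \<open>n\<close> is injectivity.\<close>

lemma codim_mult:
  assumes "codim U V n" and U: "mv.subspace U" and W: "mv.subspace W" and yU: "\<And>u. u \<in> U \<Longrightarrow> y * u \<in> W"
  shows "\<exists>m\<le>n. codim W {w + y * v | w v. w \<in> W \<and> v \<in> V} m \<and>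
    (m = n \<longleftrightarrow> (\<forall>v\<in>V. y * v \<in> W \<longrightarrow> v \<in> U))"
  using assms(1)
proof (induction rule: codim.induct)
  case codim_refl
  have "{w + y * v | w v. w \<in> W \<and> v \<in> U} = W"
  proof (intro equalityI subsetI)
    fix f assume "f \<in> W"
    moreover have "f = f + y * 0" by simp
    ultimately show "f \<in> {w + y * v | w v. w \<in> W \<and> v \<in> U}" using mv.subspace_0[OF U] by blast
  qed (auto intro!: mv.subspace_add[OF W] yU)
  thus ?case using codim.codim_refl[of W] by (intro exI[of _ 0]) auto
next
  case (codim_step V n v)
  let ?W = "{w + y * v | w v. w \<in> W \<and> v \<in> V}"
  obtain m where m: "m \<le> n" "codim W ?W m" "m = n \<longleftrightarrow> (\<forall>v\<in>V. y * v \<in> W \<longrightarrow> v \<in> U)"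
    using codim_step.IH by blast
  have V: "mv.subspace V" "U \<subseteq> V" using codim_subspace[OF codim_step.hyps(1) U] by auto
  have W': "mv.subspace ?W" using codim_subspace[OF m(2) W] by blast
  have eq: "{w + y * u | w u. w \<in> W \<and> u \<in> add_line V v} = add_line ?W (y * v)"
  proof (intro equalityI subsetI)
    fix f assume "f \<in> {w + y * u | w u. w \<in> W \<and> u \<in> add_line V v}"
    then obtain w u c where *: "w \<in> W" "u \<in> V" "f = w + y * (u + mpoly_const c * v)"
      unfolding add_line_def by blast
    have "f = (w + y * u) + mpoly_const c * (y * v)" by (simp add: * algebra_simps)
    thus "f \<in> add_line ?W (y * v)" unfolding add_line_def using *(1,2) by blast
  next
    fix f assume "f \<in> add_line ?W (y * v)"
    then obtain w u c where *: "w \<in> W" "u \<in> V" "f = w + y * u + mpoly_const c * (y * v)"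
      unfolding add_line_def by blast
    have "f = w + y * (u + mpoly_const c * v)" by (simp add: * algebra_simps)
    thus "f \<in> {w + y * u | w u. w \<in> W \<and> u \<in> add_line V v}" unfolding add_line_def using *(1,2) by blast
  qed
  show ?case
  proof (cases "y * v \<in> ?W")
    case True
    have "add_line ?W (y * v) = ?W"
      by (rule equalityI[OF add_line_least[OF W' order_refl True] subset_add_line])
    moreover obtain w u where wu: "w \<in> W" "u \<in> V" "y * v = w + y * u" using True by blast
    \<comment> \<open>The new vector adds nothing to the image, so its difference to a preimage
      already present is a kernel element outside \<open>U\<close>.\<close>
    have "v - u \<in> add_line V v"
    proof -
      have "v - u = - u + mpoly_const 1 * v" by simp
      thus ?thesis unfolding add_line_def using mv.subspace_neg[OF V(1) wu(2)] by blast
    qed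
    moreover have "y * (v - u) = w" using wu(3) by (simp add: algebra_simps)
    moreover have "v - u \<notin> U"
    proof
      assume "v - u \<in> U"
      hence "(v - u) + u \<in> V" using V wu(2) mv.subspace_add by blast
      thus False using codim_step.hyps(2) by simp
    qed
    ultimately have "\<not> (\<forall>v\<in>add_line V v. y * v \<in> W \<longrightarrow> v \<in> U)" using wu(1) by metis
    thus ?thesis unfolding eq \<open>add_line ?W (y * v) = ?W\<close> using m(1,2) by (intro exI[of _ m]) auto
  next
    case False
    have "(\<forall>u\<in>add_line V v. y * u \<in> W \<longrightarrow> u \<in> U) \<longleftrightarrow> (\<forall>v\<in>V. y * v \<in> W \<longrightarrow> v \<in> U)"
    proof
      assume h: "\<forall>v\<in>V. y * v \<in> W \<longrightarrow> v \<in> U"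
      show "\<forall>u\<in>add_line V v. y * u \<in> W \<longrightarrow> u \<in> U"
      proof (intro ballI impI)
        fix u assume u: "u \<in> add_line V v" "y * u \<in> W"
        then obtain u0 c where u0: "u0 \<in> V" "u = u0 + mpoly_const c * v" unfolding add_line_def by blast
        have "c = 0"
        proof (rule ccontr)
          assume c: "c \<noteq> 0"
          have "- (mpoly_const (1 / c) * u0) \<in> V" by (intro mv.subspace_neg[OF V(1)] mv.subspace_scale[OF V(1)] u0(1))
          moreover have "mpoly_const (1 / c) * (y * u) \<in> W" by (rule mv.subspace_scale[OF W u(2)])
          moreover have "y * v = mpoly_const (1 / c) * (y * u) + y * (- (mpoly_const (1 / c) * u0))"
          proof -
            have "mpoly_const (1 / c) * (y * u) = y * (mpoly_const (1 / c) * u0) + (mpoly_const (1 / c) * mpoly_const c) * (y * v)"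
              by (simp add: u0(2) algebra_simps)
            also have "mpoly_const (1 / c) * mpoly_const c = (1 :: ('a, 'b) mpoly)"
              using c by (simp add: mpoly_const_mult[symmetric])
            finally show ?thesis by (simp add: algebra_simps)
          qed
          ultimately have "y * v \<in> ?W" by blast
          thus False using False by blast
        qed
        hence "u = u0" by (simp add: u0(2))
        thus "u \<in> U" using h u(2) u0(1) by blast
      qed
    qed (use subset_add_line in blast)
    thus ?thesis unfolding eq using codim.codim_step[OF m(2) False] m(1,3)
      by (intro exI[of _ "Suc m"]) simp
  qed
qed

lemma subspace_homog: "mv.subspace (homog_part d)"
  by (rule mv.subspaceI) (auto intro: homog_part_add homog_part_const_mult)

lemma fin_span_homog: "fin_span (homog_part d :: ('x::finite, 'k::field) mpoly set)"
  unfolding fin_span_def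
proof (intro exI conjI subsetI)
  let ?T = "(\<lambda>m. single m 1) ` {m. mon_deg m = d} :: ('x, 'k) mpoly set"
  show "finite ?T" by (rule finite_imageI[OF finite_mon_deg])
  fix f :: "('x, 'k) mpoly" assume f: "f \<in> homog_part d"
  have "(\<Sum>m\<in>keys f. single m (lookup f m)) \<in> mv.span ?T"
  proof (rule mv.span_sum)
    fix m assume "m \<in> keys f"
    hence "single m 1 \<in> ?T" using f by (auto simp: homog_part_def)
    hence "mpoly_const (lookup f m) * single m 1 \<in> mv.span ?T" by (intro mv.span_scale mv.span_base)
    thus "single m (lookup f m) \<in> mv.span ?T" by (metis single_eq_const_mult)
  qed
  thus "f \<in> mv.span ?T" by (simp add: sum_singles)
qed

lemma subspace_idl_homog: "is_idl J \<Longrightarrow> mv.subspace (J \<inter> homog_part d)"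
  by (rule mv.subspaceI) (auto intro: idl_0 idl_add idl_mult homog_part_add homog_part_const_mult)

lemma fin_span_idl_homog: "fin_span (J \<inter> homog_part d)"
  by (rule fin_span_mono[OF _ fin_span_homog]) auto

section \<open>Hilbert functions as codimensions\<close>

abbreviation coset :: "'a::comm_ring_1 set \<Rightarrow> 'a \<Rightarrow> 'a set" where
  "coset J f \<equiv> J +>\<^bsub>ring_of_type_algebra\<^esub> f"

lemma coset_eq: "coset J f = (\<lambda>j. j + f) ` J"
  by (auto simp: a_r_coset_def')

lemma coset_eq_iff:
  assumes J: "is_idl J"
  shows "coset J f = coset J g \<longleftrightarrow> f - g \<in> J"
proof
  assume "coset J f = coset J g"
  moreover have "0 + f \<in> coset J f" unfolding coset_eq using idl_0[OF J] by blast
  ultimately obtain j where "j \<in> J" "f = j + g" unfolding coset_eq by auto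
  thus "f - g \<in> J" by simp
next
  assume fg: "f - g \<in> J"
  show "coset J f = coset J g"
    unfolding coset_eq
  proof (intro equalityI subsetI)
    fix h assume "h \<in> (\<lambda>j. j + f) ` J"
    then obtain j where "j \<in> J" "h = (j + (f - g)) + g" by auto
    thus "h \<in> (\<lambda>j. j + g) ` J" using idl_add[OF J _ fg] by blast
  next
    fix h assume "h \<in> (\<lambda>j. j + g) ` J"
    then obtain j where "j \<in> J" "h = (j - (f - g)) + f" by auto
    thus "h \<in> (\<lambda>j. j + f) ` J" using idl_diff[OF J _ fg] by blast
  qed
qed

lemma quot_ops:
  assumes J: "is_idl (J :: 'a::comm_ring_1 set)"
  defines "R \<equiv> ring_of_type_algebra Quot J"
  shows "cring R" "coset J f \<otimes>\<^bsub>R\<^esub> coset J g = coset J (f * g)"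
    "coset J f \<oplus>\<^bsub>R\<^esub> coset J g = coset J (f + g)"
    "\<zero>\<^bsub>R\<^esub> = coset J 0" "\<one>\<^bsub>R\<^esub> = coset J 1"
    "carrier R = range (coset J)"
proof -
  interpret ideal J "ring_of_type_algebra :: 'a ring" using J by (simp add: ideal_iff_is_idl)
  show "cring R" unfolding R_def by (rule quotient_is_cring[OF cring_from_type_algebra])
  show "coset J f \<otimes>\<^bsub>R\<^esub> coset J g = coset J (f * g)"
    using rcoset_mult_add[of f g] by (simp add: R_def FactRing_def)
  show "coset J f \<oplus>\<^bsub>R\<^esub> coset J g = coset J (f + g)"
    using a_rcos_sum[of f g] by (simp add: R_def FactRing_def)
  show "\<zero>\<^bsub>R\<^esub> = coset J 0" by (simp add: R_def FactRing_def coset_eq)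
  show "\<one>\<^bsub>R\<^esub> = coset J 1" by (simp add: R_def FactRing_def)
  show "carrier R = range (coset J)"
    by (auto simp: R_def FactRing_def A_RCOSETS_def' )
qed

text \<open>Passing to cosets turns a chain of steps of \<open>codim\<close> into a chain of line
  extensions in the quotient ring. The value of \<open>dim\<close> also requires uniqueness of the
  dimension, which is available over a subfield.\<close>

lemma HF_codim:
  fixes J :: "('x::finite, 'k::field) mpoly set"
  assumes J: "is_idl J" and n: "codim (J \<inter> homog_part d) (homog_part d) n"
  shows "HF J d = n"
proof -
  define R where "R = \<S> Quot J"
  define co where "co f = coset J f" for f
  define K where "K = range (\<lambda>c. co (mpoly_const c))"
  note ops = quot_ops[OF J, folded R_def, folded co_def]
  interpret R: cring R by (rule ops(1))
  have co_eq: "co f = co g \<longleftrightarrow> f - g \<in> J" for f g unfolding co_def by (rule coset_eq_iff[OF J])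
  have dimV: "R.dimension m K (co ` V)" if "codim (J \<inter> homog_part d) V m" "V \<subseteq> homog_part d" for V m
    using that
  proof (induction rule: codim.induct)
    case codim_refl
    have "co f = co 0" if "f \<in> J" for f using that by (simp add: co_eq)
    moreover have "0 \<in> J \<inter> homog_part d" using idl_0[OF J] by simp
    ultimately have "co ` (J \<inter> homog_part d) = {\<zero>\<^bsub>R\<^esub>}" unfolding ops(4) by blast
    thus ?case using R.zero_dim[of K] by simp
  next
    case (codim_step V m v)
    have V: "mv.subspace V" "J \<inter> homog_part d \<subseteq> V"
      using codim_subspace[OF codim_step.hyps(1) subspace_idl_homog[OF J]] by auto
    have Vd: "V \<subseteq> homog_part d" "v \<in> homog_part d"
      using codim_step.prems subset_add_line[of V v] in_add_line[OF V(1), of v] by blast+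
    have "co v \<notin> co ` V"
    proof
      assume "co v \<in> co ` V"
      then obtain u where u: "u \<in> V" "v - u \<in> J" by (auto simp: co_eq)
      hence "v - u \<in> V" using Vd homog_part_diff V(2) by blast
      hence "(v - u) + u \<in> V" using mv.subspace_add[OF V(1)] u(1) by blast
      thus False using codim_step.hyps(2) by simp
    qed
    moreover have "co v \<in> carrier R" unfolding ops(6) by blast
    ultimately have "R.dimension (Suc m) K (R.line_extension K (co v) (co ` V))"
      using codim_step.IH[OF Vd(1)] by (intro R.Suc_dim)
    moreover have "R.line_extension K (co v) (co ` V) = co ` add_line V v"
    proof (intro equalityI subsetI)
      fix x assume "x \<in> R.line_extension K (co v) (co ` V)"
      then obtain c u where "u \<in> V" "x = co (mpoly_const c) \<otimes>\<^bsub>R\<^esub> co v \<oplus>\<^bsub>R\<^esub> co u"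
        unfolding R.line_extension_mem_iff K_def by blast
      hence "x = co (u + mpoly_const c * v)" "u + mpoly_const c * v \<in> add_line V v"
        unfolding add_line_def by (auto simp: ops add.commute)
      thus "x \<in> co ` add_line V v" by blast
    next
      fix x assume "x \<in> co ` add_line V v"
      then obtain c u where "u \<in> V" "x = co (u + mpoly_const c * v)" unfolding add_line_def by blast
      hence "x = co (mpoly_const c) \<otimes>\<^bsub>R\<^esub> co v \<oplus>\<^bsub>R\<^esub> co u" by (simp add: ops add.commute)
      thus "x \<in> R.line_extension K (co v) (co ` V)"
        unfolding R.line_extension_mem_iff K_def using \<open>u \<in> V\<close> by blast
    qed
    ultimately show ?case by simp
  qed
  have dim: "R.dimension n K (co ` homog_part d)" by (rule dimV[OF n]) simp
  have unique: "m = n" if m: "R.dimension m K (co ` homog_part d)" for m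
  proof (cases "1 \<in> J")
    \<comment> \<open>Here the quotient is the zero ring and the image of the coefficients is not a
      subfield; all line extensions are impossible, so the dimension can only be
      \<open>0\<close>.\<close>
    case True
    hence "co f = co 0" for f using idl_mult[OF J, of 1 f] by (simp add: co_eq)
    hence carr: "carrier R = {\<zero>\<^bsub>R\<^esub>}" unfolding ops by auto
    have "k = 0 \<and> E = {\<zero>\<^bsub>R\<^esub>}" if "R.dimension k K E" for k E
      using that by (induction rule: R.dimension.induct) (auto simp: carr)
    thus ?thesis using m dim by blast
  next
    case False
    have "field (ring_of_type_algebra :: 'k ring)" by (rule field_from_type_algebra)
    hence sub: "subfield (carrier (ring_of_type_algebra :: 'k ring)) ring_of_type_algebra"
      by (rule field.carrier_is_subfield)
    have "(\<lambda>c. co (mpoly_const c)) \<in> ring_hom (ring_of_type_algebra :: 'k ring) R"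
      by (rule ring_hom_memI) (auto simp: ops mpoly_const_mult mpoly_const_add)
    hence hom: "ring_hom_ring (ring_of_type_algebra :: 'k ring) R (\<lambda>c. co (mpoly_const c))"
      using R.ring_axioms ring_from_type_algebra by (intro ring_hom_ringI2)
    have "\<one>\<^bsub>R\<^esub> \<noteq> \<zero>\<^bsub>R\<^esub>" using False by (simp add: ops co_eq)
    from ring_hom_ring.img_is_subfield(2)[OF hom sub this]
    have "subfield K R" by (simp add: K_def)
    thus ?thesis using R.dimension_is_inj m dim by blast
  qed
  have "HF J d = R.dim K (co ` homog_part d)"
    by (simp add: HF_def R_def K_def co_def quot_grading_def)
  also have "\<dots> = n" unfolding R.dim_def using dim unique by blast
  finally show ?thesis .
qed

lemma codim_HF:
  assumes "is_idl J" shows "codim (J \<inter> homog_part d) (homog_part d) (HF J d)"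
proof -
  obtain n where "codim (J \<inter> homog_part d) (homog_part d) n"
    using codim_exists[OF subspace_idl_homog[OF assms] subspace_homog fin_span_homog] by auto
  thus ?thesis using HF_codim[OF assms] by blast
qed

lemma HF_dim:
  fixes J :: "('x::finite, 'k::field) mpoly set"
  assumes "is_idl J"
  shows "mv.dim (homog_part d :: ('x, 'k) mpoly set) = mv.dim (J \<inter> homog_part d) + HF J d"
  using codim_dim[OF codim_HF[OF assms] subspace_idl_homog[OF assms] fin_span_idl_homog] by blast

definition full_rank_at :: "('x::finite, 'k::field) mpoly set \<Rightarrow> ('x, 'k) mpoly \<Rightarrow> nat \<Rightarrow> bool" where
  "full_rank_at J y d \<longleftrightarrow> (\<forall>f\<in>homog_part d. y * f \<in> J \<longrightarrow> f \<in> J) \<or>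
    (\<forall>g\<in>homog_part (Suc d). \<exists>f\<in>homog_part d. g - y * f \<in> J)"

lemma adj_homog:
  assumes J: "hidl J" and y: "y \<in> homog_part 1"
  shows "adj J y \<inter> homog_part (Suc d) = {w + y * v | w v. w \<in> J \<inter> homog_part (Suc d) \<and> v \<in> homog_part d}"
proof (intro equalityI subsetI)
  fix f assume f: "f \<in> adj J y \<inter> homog_part (Suc d)"
  then obtain g c where g: "g \<in> J" "f = g + c * y" by (auto elim: adjE)
  have "f = hcomp (Suc d) f" using f hcomp_of_homog_same by fastforce
  also have "\<dots> = hcomp (Suc d) g + y * hcomp d c"
    using hcomp_mult[OF y, of "Suc d" c] by (simp add: g(2) hcomp_add mult.commute)
  finally show "f \<in> {w + y * v | w v. w \<in> J \<inter> homog_part (Suc d) \<and> v \<in> homog_part d}"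
    using hidl_hcomp[OF J g(1)] by blast
next
  fix f assume "f \<in> {w + y * v | w v. w \<in> J \<inter> homog_part (Suc d) \<and> v \<in> homog_part d}"
  then obtain w v where "w \<in> J" "w \<in> homog_part (Suc d)" "v \<in> homog_part d" "f = w + y * v" by blast
  thus "f \<in> adj J y \<inter> homog_part (Suc d)"
    using adjI[of w J v y] homog_part_mult[OF y, of v d] by (auto simp: mult.commute intro: homog_part_add)
qed

text \<open>Multiplication by \<open>y\<close> has rank \<open>m \<le> HF J d\<close> and cokernel
  \<open>(S/(J + \<langle>y\<rangle>))\<close> in degree \<open>d + 1\<close>, of dimension
  \<open>HF J (Suc d) - m\<close>. The bound is attained iff \<open>m\<close> equals one of the two
  dimensions, that is iff the map is injective or surjective.\<close>

lemma
  assumes J: "hidl J" and y: "y \<in> homog_part 1"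
  shows HF_adj_ge: "int (HF (adj J y) (Suc d)) \<ge> max (int (HF J (Suc d)) - int (HF J d)) 0"
    and HF_adj_eq_iff: "int (HF (adj J y) (Suc d)) = max (int (HF J (Suc d)) - int (HF J d)) 0 \<longleftrightarrow>
      full_rank_at J y d"
proof -
  note idl = hidl_is_idl[OF J] and idl' = is_idl_adj[OF hidl_is_idl[OF J], of y]
  let ?W = "J \<inter> homog_part (Suc d)" and ?A = "adj J y \<inter> homog_part (Suc d)"
  have "y * u \<in> ?W" if "u \<in> J \<inter> homog_part d" for u
    using that idl_mult[OF idl] homog_part_mult[OF y, of u d] by auto
  from codim_mult[OF codim_HF[OF idl] subspace_idl_homog[OF idl] subspace_idl_homog[OF idl, of "Suc d"] this]
  obtain m where m: "m \<le> HF J d" "codim ?W ?A m"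
      "m = HF J d \<longleftrightarrow> (\<forall>v\<in>homog_part d. y * v \<in> ?W \<longrightarrow> v \<in> J \<inter> homog_part d)"
    unfolding adj_homog[OF J y] by blast
  have "codim ?W (homog_part (Suc d)) (m + HF (adj J y) (Suc d))"
    by (rule codim_trans[OF codim_HF[OF idl'] m(2)])
  hence hf: "HF J (Suc d) = m + HF (adj J y) (Suc d)" by (rule HF_codim[OF idl])
  show "int (HF (adj J y) (Suc d)) \<ge> max (int (HF J (Suc d)) - int (HF J d)) 0" using hf m(1) by simp
  have inj: "m = HF J d \<longleftrightarrow> (\<forall>f\<in>homog_part d. y * f \<in> J \<longrightarrow> f \<in> J)"
    unfolding m(3) using homog_part_mult[OF y] by auto
  have "HF (adj J y) (Suc d) = 0 \<longleftrightarrow> ?A = homog_part (Suc d)"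
  proof
    assume "HF (adj J y) (Suc d) = 0"
    hence "codim ?A (homog_part (Suc d)) 0" using codim_HF[OF idl', of "Suc d"] by simp
    thus "?A = homog_part (Suc d)" by (cases rule: codim.cases) auto
  next
    assume "?A = homog_part (Suc d)"
    thus "HF (adj J y) (Suc d) = 0" using HF_codim[OF idl', of "Suc d" 0] codim_refl[of ?A] by simp
  qed
  also have "\<dots> \<longleftrightarrow> (\<forall>g\<in>homog_part (Suc d). \<exists>f\<in>homog_part d. g - y * f \<in> J)"
  proof
    assume A: "?A = homog_part (Suc d)"
    show "\<forall>g\<in>homog_part (Suc d). \<exists>f\<in>homog_part d. g - y * f \<in> J"
    proof
      fix g :: "('a, 'b) mpoly" assume "g \<in> homog_part (Suc d)"
      then obtain w v where "w \<in> J" "v \<in> homog_part d" "g = w + y * v" using A adj_homog[OF J y, of d] by blast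
      thus "\<exists>f\<in>homog_part d. g - y * f \<in> J" by (intro bexI[of _ v]) auto
    qed
  next
    assume h: "\<forall>g\<in>homog_part (Suc d). \<exists>f\<in>homog_part d. g - y * f \<in> J"
    have "g \<in> adj J y" if g: "g \<in> homog_part (Suc d)" for g
    proof -
      obtain f where "g - y * f \<in> J" using h g by blast
      from adjI[OF this, of f y] show ?thesis by (simp add: mult.commute)
    qed
    thus "?A = homog_part (Suc d)" by blast
  qed
  finally show "int (HF (adj J y) (Suc d)) = max (int (HF J (Suc d)) - int (HF J d)) 0 \<longleftrightarrow> full_rank_at J y d"
    unfolding full_rank_at_def inj[symmetric] using hf m(1) by auto
qed

lemma adj_homog_0:
  assumes J: "hidl J" and y: "y \<in> homog_part 1"
  shows "adj J y \<inter> homog_part 0 = J \<inter> homog_part 0"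
proof (intro equalityI subsetI)
  fix f assume f: "f \<in> adj J y \<inter> homog_part 0"
  then obtain g c where g: "g \<in> J" "f = g + c * y" by (auto elim: adjE)
  have "f = hcomp 0 f" using f hcomp_of_homog_same by fastforce
  also have "\<dots> = hcomp 0 g" using hcomp_mult[OF y, of 0 c] by (simp add: g(2) hcomp_add mult.commute)
  finally have "f \<in> J" by (simp only: hidl_hcomp[OF J g(1)])
  thus "f \<in> J \<inter> homog_part 0" using f by blast
qed (use subset_adj in blast)

lemma HF_adj_0:
  assumes J: "hidl J" and y: "y \<in> homog_part 1"
  shows "HF (adj J y) 0 = HF J 0"
  using HF_codim[OF is_idl_adj[OF hidl_is_idl[OF J]]] codim_HF[OF hidl_is_idl[OF J], of 0]
    adj_homog_0[OF assms] by metis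

section \<open>Generic linear forms\<close>

definition polyfun :: "'v set \<Rightarrow> (('v \<Rightarrow> 'k::field) \<Rightarrow> 'k) \<Rightarrow> bool" where
  "polyfun V f \<longleftrightarrow> (\<exists>p. (\<forall>m\<in>keys p. keys m \<subseteq> V) \<and> f = (\<lambda>a. mpoly_eval a p))"

lemma polyfun_const: "polyfun V (\<lambda>a. c)"
  unfolding polyfun_def
proof (intro exI conjI)
  show "\<forall>m\<in>keys (mpoly_const c). keys m \<subseteq> V" by (simp add: mpoly_const_def)
  show "(\<lambda>a. c) = (\<lambda>a. mpoly_eval a (mpoly_const c))" by simp
qed

lemma polyfun_var: "v \<in> V \<Longrightarrow> polyfun V (\<lambda>a. a v)"
  unfolding polyfun_def
proof (intro exI conjI)
  assume "v \<in> V"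
  thus "\<forall>m\<in>keys (mpoly_var v). keys m \<subseteq> V" by (simp add: mpoly_var_def)
  show "(\<lambda>a. a v) = (\<lambda>a. mpoly_eval a (mpoly_var v))" by simp
qed

lemma polyfun_add: "polyfun V f \<Longrightarrow> polyfun V g \<Longrightarrow> polyfun V (\<lambda>a. f a + g a)"
proof -
  assume "polyfun V f" "polyfun V g"
  then obtain p q where p: "\<forall>m\<in>keys p. keys m \<subseteq> V" "f = (\<lambda>a. mpoly_eval a p)"
    and q: "\<forall>m\<in>keys q. keys m \<subseteq> V" "g = (\<lambda>a. mpoly_eval a q)" unfolding polyfun_def by blast
  have "\<forall>m\<in>keys (p + q). keys m \<subseteq> V" using keys_add[of p q] p(1) q(1) by blast
  moreover have "(\<lambda>a. f a + g a) = (\<lambda>a. mpoly_eval a (p + q))" by (simp add: p(2) q(2) mpoly_eval_add)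
  ultimately show ?thesis unfolding polyfun_def by blast
qed

lemma polyfun_mult: "polyfun V f \<Longrightarrow> polyfun V g \<Longrightarrow> polyfun V (\<lambda>a. f a * g a)"
proof -
  assume "polyfun V f" "polyfun V g"
  then obtain p q where p: "\<And>m. m \<in> keys p \<Longrightarrow> keys m \<subseteq> V" "f = (\<lambda>a. mpoly_eval a p)"
    and q: "\<And>m. m \<in> keys q \<Longrightarrow> keys m \<subseteq> V" "g = (\<lambda>a. mpoly_eval a q)" unfolding polyfun_def by blast
  have "keys m \<subseteq> V" if m: "m \<in> keys (p * q)" for m
  proof -
    obtain a b where "m = a + b" "a \<in> keys p" "b \<in> keys q" using keys_mult[of p q] m by blast
    thus ?thesis using keys_add[of a b] p(1) q(1) by blast
  qed
  moreover have "(\<lambda>a. f a * g a) = (\<lambda>a. mpoly_eval a (p * q))" by (simp add: p(2) q(2) mpoly_eval_mult)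
  ultimately show ?thesis unfolding polyfun_def by blast
qed

lemma polyfun_diff: "polyfun V f \<Longrightarrow> polyfun V g \<Longrightarrow> polyfun V (\<lambda>a. f a - g a)"
  using polyfun_add[OF _ polyfun_mult[OF polyfun_const[of V "- 1"], of g], of f] by simp

lemma polyfun_sum: "(\<And>i. i \<in> A \<Longrightarrow> polyfun V (f i)) \<Longrightarrow> polyfun V (\<lambda>a. \<Sum>i\<in>A. f i a)"
  by (induction A rule: infinite_finite_induct) (auto intro: polyfun_const polyfun_add)

text \<open>Points of \<open>zariski_open\<close> sets are extensional functions on
  \<open>V\<close>, whereas generic choices are made among total functions; this passes from one to
  the other.\<close>

lemma polyfun_restrict:
  assumes "polyfun V f" shows "f (restrict a V) = f a"
proof -
  obtain p where p: "\<forall>m\<in>keys p. keys m \<subseteq> V" "f = (\<lambda>a. mpoly_eval a p)" using assms unfolding polyfun_def by blast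
  have "(\<Prod>v\<in>keys m. restrict a V v ^ lookup m v) = (\<Prod>v\<in>keys m. a v ^ lookup m v)" if "m \<in> keys p" for m
    using p(1) that by (intro prod.cong) auto
  thus ?thesis unfolding p(2) mpoly_eval_def by (intro sum.cong) auto
qed

text \<open>Restricted to a line, \<open>f\<close> becomes the univariate polynomial
  \<open>q\<close>; it is nonzero at \<open>t = 0\<close>, so it has finitely many roots.\<close>

lemma line_generic_polyfun:
  assumes f: "polyfun V f" and "f a0 \<noteq> 0"
  shows "line_generic {a. f a \<noteq> 0}"
  unfolding line_generic_def
proof (intro conjI ballI allI)
  show "{a. f a \<noteq> 0} \<noteq> {}" using assms(2) by blast
  fix c v assume c: "c \<in> {a. f a \<noteq> 0}"
  obtain p where p: "f = (\<lambda>a. mpoly_eval a p)" using f unfolding polyfun_def by blast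
  define q where "q = (\<Sum>m\<in>keys p. [:lookup p m:] * (\<Prod>x\<in>keys m. [:c x, v x:] ^ lookup m x))"
  have q: "poly q t = f (\<lambda>x. c x + t * v x)" for t
    by (simp add: q_def p mpoly_eval_def poly_sum poly_prod)
  have "poly q 0 \<noteq> 0" using c by (simp add: q)
  hence "q \<noteq> 0" by auto
  hence "finite {t. poly q t = 0}" by (rule poly_roots_finite)
  thus "finite {t. (\<lambda>x. c x + t * v x) \<notin> {a. f a \<noteq> 0}}" by (simp add: q)
qed

lemma line_generic_INT:
  fixes U :: "'i \<Rightarrow> ('x \<Rightarrow> 'k::field_char_0) set"
  shows "finite A \<Longrightarrow> (\<And>i. i \<in> A \<Longrightarrow> line_generic (U i)) \<Longrightarrow> line_generic (\<Inter>i\<in>A. U i)"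
  by (induction A rule: finite_induct) (auto intro: line_generic_Int line_generic_UNIV)

text \<open>Independence of a family and not of a set: while the parameter varies two members may
  coincide, which must count as a dependence.\<close>

definition indep_family :: "'b set \<Rightarrow> ('b \<Rightarrow> ('x::finite, 'k::field) mpoly) \<Rightarrow> bool" where
  "indep_family B v \<longleftrightarrow> (\<forall>l. (\<Sum>b\<in>B. mpoly_const (l b) * v b) = 0 \<longrightarrow> (\<forall>b\<in>B. l b = 0))"

lemma indep_familyD: "indep_family B v \<Longrightarrow> (\<Sum>b\<in>B. mpoly_const (l b) * v b) = 0 \<Longrightarrow> b \<in> B \<Longrightarrow> l b = 0"
  unfolding indep_family_def by blast

lemma card_indep_family_le:
  fixes v :: "'b \<Rightarrow> ('x::finite, 'k::field) mpoly"
  assumes B: "finite B" "indep_family B v" and W: "fin_span W" "\<And>b. b \<in> B \<Longrightarrow> v b \<in> W"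
  shows "card B \<le> mv.dim W"
proof -
  have inj: "inj_on v B"
  proof (rule inj_onI, rule ccontr)
    fix b c assume bc: "b \<in> B" "c \<in> B" "v b = v c" "b \<noteq> c"
    let ?l = "\<lambda>x. if x = b then 1 else if x = c then - 1 else (0 :: 'k)"
    have "(\<Sum>x\<in>B. mpoly_const (?l x) * v x)
        = (\<Sum>x\<in>B. (if x = b then v b else 0) + (if x = c then - v c else 0))"
      using bc(4) by (intro sum.cong) (auto simp: mpoly_const_uminus)
    also have "\<dots> = 0" using B(1) bc by (simp add: sum.distrib)
    finally have "?l b = 0" using indep_familyD[OF B(2), of ?l b] bc(1) by blast
    thus False by simp
  qed
  have "mv.independent (v ` B)"
  proof (rule mv.independent_if_scalars_zero)
    fix l x assume l: "(\<Sum>x\<in>v ` B. mpoly_const (l x) * x) = 0" "x \<in> v ` B"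
    have "(\<Sum>b\<in>B. mpoly_const (l (v b)) * v b) = 0" using l(1) by (simp add: sum.reindex[OF inj])
    thus "l x = 0" using indep_familyD[OF B(2), of "\<lambda>b. l (v b)"] l(2) by blast
  qed (use B(1) in simp)
  moreover have "v ` B \<subseteq> W" using W(2) by blast
  ultimately have "card (v ` B) \<le> mv.dim W" by (intro card_le_dim[OF W(1)])
  thus ?thesis by (simp add: card_image[OF inj])
qed

text \<open>Linear independence of vectors depending polynomially on a parameter is an open condition:
  a step of Gaussian elimination without divisions reduces the number of vectors.\<close>

lemma generic_independence:
  fixes G :: "'b \<Rightarrow> ('v \<Rightarrow> 'k) \<Rightarrow> ('x::finite, 'k::field) mpoly"
  assumes "finite B" "\<And>b m. b \<in> B \<Longrightarrow> polyfun V (\<lambda>a. lookup (G b a) m)" "indep_family B (\<lambda>b. G b a0)"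
  shows "\<exists>P. polyfun V P \<and> P a0 \<noteq> 0 \<and> (\<forall>a. P a \<noteq> 0 \<longrightarrow> indep_family B (\<lambda>b. G b a))"
  using assms
proof (induction B arbitrary: G rule: finite_induct)
  case empty
  show ?case using polyfun_const[of V 1] by (intro exI[of _ "\<lambda>_. 1"]) (auto simp: indep_family_def)
next
  case (insert b B)
  note ind = indep_familyD[OF insert.prems(2)]
  have "G b a0 \<noteq> 0"
  proof
    assume z: "G b a0 = 0"
    have "(\<Sum>c\<in>insert b B. mpoly_const (if c = b then 1 else 0) * G c a0) = 0"
      by (rule sum.neutral) (auto simp: z)
    from ind[OF this, of b] show False by simp
  qed
  then obtain m where m: "lookup (G b a0) m \<noteq> 0" by (metis poly_mapping_eqI lookup_zero)
  define s where "s c a = lookup (G c a) m" for c a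
  \<comment> \<open>Cross-multiplication with the pivot, the coefficient of \<open>G b\<close> at
    \<open>m\<close>: the coefficient of \<open>G' c\<close> at \<open>m\<close> is zero, and the
    entries stay polynomial in the parameter. The pivot returns as a factor of the final
    polynomial.\<close>
  define G' where "G' c a = mpoly_const (s b a) * G c a - mpoly_const (s c a) * G b a" for c a
  have pf: "polyfun V (s c)" if "c \<in> insert b B" for c unfolding s_def using insert.prems(1)[OF that] .
  have comb: "(\<Sum>c\<in>B. mpoly_const (l c) * G' c a) =
      mpoly_const (s b a) * (\<Sum>c\<in>B. mpoly_const (l c) * G c a) - mpoly_const (\<Sum>c\<in>B. l c * s c a) * G b a" for l a
  proof -
    have sm: "mpoly_const (\<Sum>c\<in>C. h c) = (\<Sum>c\<in>C. mpoly_const (h c) :: ('x, 'k) mpoly)" for C and h :: "'b \<Rightarrow> 'k"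
      by (induction C rule: infinite_finite_induct) (auto simp: mpoly_const_add)
    show ?thesis unfolding G'_def sm
      by (simp add: sum_distrib_left sum_distrib_right right_diff_distrib sum_subtractf mpoly_const_mult ac_simps)
  qed
  have full: "(\<Sum>c\<in>insert b B. mpoly_const (l c) * G c a)
      = mpoly_const (l b) * G b a + (\<Sum>c\<in>B. mpoly_const (l c) * G c a)" for l a
    using insert.hyps by simp
  have "indep_family B (\<lambda>c. G' c a0)"
    unfolding indep_family_def
  proof (intro allI impI ballI)
    fix l c assume l: "(\<Sum>c\<in>B. mpoly_const (l c) * G' c a0) = 0" "c \<in> B"
    let ?l = "\<lambda>c. if c = b then - (\<Sum>c\<in>B. l c * s c a0) else s b a0 * l c"
    have "(\<Sum>c\<in>B. mpoly_const (?l c) * G c a0) = (\<Sum>c\<in>B. mpoly_const (s b a0) * (mpoly_const (l c) * G c a0))"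
    proof (intro sum.cong refl)
      fix x assume "x \<in> B"
      hence "x \<noteq> b" using insert.hyps(2) by blast
      thus "mpoly_const (?l x) * G x a0 = mpoly_const (s b a0) * (mpoly_const (l x) * G x a0)"
        by (simp only: if_False mpoly_const_mult mult.assoc)
    qed
    hence "(\<Sum>c\<in>insert b B. mpoly_const (?l c) * G c a0) = 0"
      using l(1) unfolding full comb by (simp add: mpoly_const_uminus sum_distrib_left)
    moreover have "c \<noteq> b" using l(2) insert.hyps(2) by blast
    ultimately show "l c = 0" using ind[of ?l c] l(2) m by (simp add: s_def)
  qed
  moreover have "polyfun V (\<lambda>a. lookup (G' c a) k)" if "c \<in> B" for c k
    unfolding G'_def using that insert.prems(1) pf
    by (simp add: lookup_minus polyfun_diff polyfun_mult)
  ultimately obtain P where P: "polyfun V P" "P a0 \<noteq> 0" "\<And>a. P a \<noteq> 0 \<Longrightarrow> indep_family B (\<lambda>c. G' c a)"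
    using insert.IH[of G'] by blast
  have "indep_family (insert b B) (\<lambda>c. G c a)" if a: "P a * s b a \<noteq> 0" for a
    unfolding indep_family_def
  proof (intro allI impI)
    fix l assume "(\<Sum>c\<in>insert b B. mpoly_const (l c) * G c a) = 0"
    hence l: "(\<Sum>c\<in>B. mpoly_const (l c) * G c a) = - (mpoly_const (l b) * G b a)"
      unfolding full by (simp add: eq_neg_iff_add_eq_0 add.commute)
    have "(\<Sum>c\<in>B. l c * s c a) = lookup (\<Sum>c\<in>B. mpoly_const (l c) * G c a) m"
      by (simp add: lookup_sum s_def)
    also have "\<dots> = - (l b * s b a)" by (simp add: l s_def)
    finally have ls: "(\<Sum>c\<in>B. l c * s c a) = - (l b * s b a)" .
    have "(\<Sum>c\<in>B. mpoly_const (l c) * G' c a) = 0"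
      unfolding comb l ls by (simp add: mpoly_const_uminus mpoly_const_mult)
    hence z: "\<forall>c\<in>B. l c = 0" using P(3)[of a] a indep_familyD by fastforce
    hence "l b * s b a = 0" using ls by simp
    thus "\<forall>c\<in>insert b B. l c = 0" using z a by simp
  qed
  moreover have "polyfun V (\<lambda>a. P a * s b a)" by (rule polyfun_mult[OF P(1) pf]) simp
  moreover have "P a0 * s b a0 \<noteq> 0" using P(2) m by (simp add: s_def)
  ultimately show ?case by (intro exI[of _ "\<lambda>a. P a * s b a"]) blast
qed

text \<open>The spanning set consists of elements independent of \<open>y\<close> and of products
  that are linear in the coefficients of \<open>y\<close>. This is what lets a basis be deformed
  together with the forms.\<close>

lemma adjn_homog_span:
  fixes I :: "('x::finite, 'k::field) mpoly set"
  assumes I: "hidl I" and y: "\<And>i. i < n \<Longrightarrow> y i \<in> homog_part 1"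
  shows "adjn I y n \<inter> homog_part d \<subseteq>
    mv.span ((I \<inter> homog_part d) \<union> {single m 1 * y i | i m. i < n \<and> Suc (mon_deg m) = d})"
  using y
proof (induction n)
  case 0
  show ?case by (simp add: mv.span_base subset_iff)
next
  case (Suc n)
  let ?X = "\<lambda>n. (I \<inter> homog_part d) \<union> {single m 1 * y i | i m. i < n \<and> Suc (mon_deg m) = d}"
  have J: "hidl (adjn I y n)"
    by (rule hidl_adjn[OF I, where e = "\<lambda>_. 1"]) (use Suc.prems in simp)
  have yn: "y n \<in> homog_part 1" using Suc.prems by simp
  have "?X n \<subseteq> ?X (Suc n)" by (blast intro: less_SucI)
  hence "mv.span (?X n) \<subseteq> mv.span (?X (Suc n))" by (rule mv.span_mono)
  moreover have "adjn I y n \<inter> homog_part d \<subseteq> mv.span (?X n)"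
    by (rule Suc.IH) (use Suc.prems in simp)
  ultimately have IH: "adjn I y n \<inter> homog_part d \<subseteq> mv.span (?X (Suc n))" by (rule order_trans[rotated])
  show ?case
  proof (cases d)
    case 0
    thus ?thesis using IH adj_homog_0[OF J yn] by simp
  next
    case (Suc e)
    show ?thesis
    proof
      fix f assume "f \<in> adjn I y (Suc n) \<inter> homog_part d"
      hence "f \<in> adj (adjn I y n) (y n) \<inter> homog_part (Suc e)" by (simp add: Suc)
      then obtain w v where f: "w \<in> adjn I y n \<inter> homog_part d" "v \<in> homog_part e" "f = w + y n * v"
        unfolding adj_homog[OF J yn] Suc by blast
      have "mpoly_const (lookup v m) * (single m 1 * y n) \<in> mv.span (?X (Suc n))" if "m \<in> keys v" for m
      proof (intro mv.span_scale mv.span_base)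
        have "mon_deg m = e" using that f(2) by (auto simp: homog_part_def)
        thus "single m 1 * y n \<in> ?X (Suc n)" using Suc by blast
      qed
      hence "(\<Sum>m\<in>keys v. mpoly_const (lookup v m) * (single m 1 * y n)) \<in> mv.span (?X (Suc n))"
        by (rule mv.span_sum)
      also have "(\<Sum>m\<in>keys v. mpoly_const (lookup v m) * (single m 1 * y n)) = (\<Sum>m\<in>keys v. single m (lookup v m)) * y n"
        unfolding sum_distrib_right by (intro sum.cong refl) (metis mult.assoc single_eq_const_mult)
      finally have "v * y n \<in> mv.span (?X (Suc n))" by (simp only: sum_singles)
      moreover have "w \<in> mv.span (?X (Suc n))" using IH f(1) by blast
      ultimately have "w + v * y n \<in> mv.span (?X (Suc n))" by (intro mv.span_add)
      thus "f \<in> mv.span (?X (Suc n))" by (simp only: f(3) mult.commute)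
    qed
  qed
qed

section \<open>Minimal and generic sections\<close>

definition lin_seq :: "(nat \<times> 'x \<Rightarrow> 'k::field) \<Rightarrow> nat \<Rightarrow> ('x::finite, 'k) mpoly" where
  "lin_seq a i = linear_form (\<lambda>x. a (i, x))"

lemma lin_seq_homog: "lin_seq a i \<in> homog_part 1"
  unfolding lin_seq_def by (rule linear_form_homog)

text \<open>By semicontinuity this minimum is the generic value. As a minimum it bounds the sections
  by arbitrary forms, in particular by the witnesses of the Lefschetz property.\<close>

definition min_section :: "('x::finite, 'k::field) mpoly set \<Rightarrow> nat \<Rightarrow> nat \<Rightarrow> nat" where
  "min_section I n d = (LEAST h. \<exists>a. HF (adjn I (lin_seq a) n) d = h)"

lemma min_section_le:
  assumes "\<And>i. i < n \<Longrightarrow> y i \<in> homog_part 1"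
  shows "min_section I n d \<le> HF (adjn I y n) d"
proof -
  let ?a = "\<lambda>(i, x). lookup (y i) (single x 1)"
  have "adjn I (lin_seq ?a) n = adjn I y n"
    by (rule adjn_cong) (use homog_1_linear_form[OF assms] in \<open>simp add: lin_seq_def\<close>)
  thus ?thesis unfolding min_section_def by (intro Least_le) metis
qed

text \<open>At a point \<open>a0\<close> attaining the minimum, the degree \<open>d\<close> part of
  the ideal has the largest dimension. A basis of it taken from \<open>Z\<close> deforms
  polynomially with the forms and stays independent where some polynomial does not vanish, so the
  dimension cannot drop there.\<close>

lemma min_section_generic:
  fixes I :: "('x::finite, 'k::field) mpoly set"
  assumes I: "hidl I"
  shows "\<exists>P a0. polyfun ({..<n} \<times> UNIV) P \<and> P a0 \<noteq> 0 \<and>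
    (\<forall>a. P a \<noteq> 0 \<longrightarrow> HF (adjn I (lin_seq a) n) d = min_section I n d)"
proof -
  have "\<exists>a0. HF (adjn I (lin_seq a0) n) d = min_section I n d"
    unfolding min_section_def by (rule LeastI_ex) blast
  then obtain a0 where a0: "HF (adjn I (lin_seq a0) n) d = min_section I n d" by blast
  define W where "W a = adjn I (lin_seq a) n \<inter> homog_part d" for a
  define Z where "Z = (I \<inter> homog_part d) \<union> {single m 1 * lin_seq a0 i | i m. i < n \<and> Suc (mon_deg m) = d}"
  have idl: "is_idl (adjn I (lin_seq a) n)" for a by (rule is_idl_adjn[OF hidl_is_idl[OF I]])
  have inW: "single m 1 * lin_seq a i \<in> W a" if "i < n" "Suc (mon_deg m) = d" for a i m
  proof -
    have "single m 1 * lin_seq a i \<in> homog_part (mon_deg m + 1)"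
      by (rule homog_part_mult[OF homog_part_single lin_seq_homog])
    moreover have "single m 1 * lin_seq a i \<in> adjn I (lin_seq a) n"
      by (rule idl_mult[OF idl in_adjn[OF hidl_is_idl[OF I] that(1)]])
    ultimately show ?thesis using that(2) by (simp add: W_def)
  qed
  have IW: "I \<inter> homog_part d \<subseteq> W a" for a unfolding W_def using subset_adjn by blast
  have finW: "fin_span (W a)" for a unfolding W_def by (rule fin_span_idl_homog)
  have ZW: "Z \<subseteq> W a0" unfolding Z_def using IW inW by blast
  have WZ: "W a0 \<subseteq> mv.span Z" unfolding W_def Z_def by (rule adjn_homog_span[OF I lin_seq_homog])
  obtain B where B: "B \<subseteq> Z" "mv.independent B" "Z \<subseteq> mv.span B"
    using mv.maximal_independent_subset[of Z] by blast
  have BW: "B \<subseteq> W a0" using B(1) ZW by blast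
  have finB: "finite B" by (rule fin_span_independent[OF finW BW B(2)])
  have "mv.span Z \<subseteq> mv.span B" by (rule mv.span_minimal[OF B(3) mv.subspace_span])
  hence "W a0 \<subseteq> mv.span B" using WZ by blast
  from mv.basis_card_eq_dim[OF BW this B(2)] have cardB: "card B = mv.dim (W a0)" .
  \<comment> \<open>A basis vector from \<open>I\<close> is kept constant; a product of a monomial
    and a form moves with the form.\<close>
  have "\<exists>g. g a0 = b \<and> (\<forall>a. g a \<in> W a) \<and> (\<forall>k. polyfun ({..<n} \<times> UNIV) (\<lambda>a. lookup (g a) k))" if b: "b \<in> B" for b
  proof (cases "b \<in> I \<inter> homog_part d")
    case True
    thus ?thesis using IW by (intro exI[of _ "\<lambda>_. b"]) (auto intro: polyfun_const)
  next
    case False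
    then obtain i m where im: "i < n" "Suc (mon_deg m) = d" "b = single m 1 * lin_seq a0 i"
      using b B(1) unfolding Z_def by blast
    have eq: "(\<lambda>a. lookup (single m 1 * lin_seq a i) k)
        = (\<lambda>a. \<Sum>x\<in>UNIV. a (i, x) * lookup (single m 1 * mpoly_var x) k)" for k
      by (rule ext) (simp add: lin_seq_def linear_form_def sum_distrib_left lookup_sum mult.left_commute[of _ "mpoly_const _"])
    have "polyfun ({..<n} \<times> UNIV) (\<lambda>a. lookup (single m 1 * lin_seq a i) k)" for k
      unfolding eq by (intro polyfun_sum polyfun_mult polyfun_const polyfun_var) (use im(1) in simp)
    thus ?thesis using im inW by (intro exI[of _ "\<lambda>a. single m 1 * lin_seq a i"]) blast
  qed
  then obtain G where G: "\<And>b. b \<in> B \<Longrightarrow> G b a0 = b" "\<And>b a. b \<in> B \<Longrightarrow> G b a \<in> W a"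
      "\<And>b k. b \<in> B \<Longrightarrow> polyfun ({..<n} \<times> UNIV) (\<lambda>a. lookup (G b a) k)" by metis
  have "indep_family B (\<lambda>b. G b a0)"
    unfolding indep_family_def
  proof (intro allI impI ballI)
    fix l b assume l: "(\<Sum>b\<in>B. mpoly_const (l b) * G b a0) = 0" "b \<in> B"
    have "(\<Sum>b\<in>B. mpoly_const (l b) * b) = 0" using l(1) G(1) by (simp cong: sum.cong)
    thus "l b = 0" using mv.independentD[OF B(2) finB order_refl] l(2) by blast
  qed
  from generic_independence[OF finB G(3) this]
  obtain P where P: "polyfun ({..<n} \<times> UNIV) P" "P a0 \<noteq> 0" "\<And>a. P a \<noteq> 0 \<Longrightarrow> indep_family B (\<lambda>b. G b a)" by blast
  have "HF (adjn I (lin_seq a) n) d = min_section I n d" if a: "P a \<noteq> 0" for a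
  proof (rule antisym)
    have "mv.dim (W a0) \<le> mv.dim (W a)"
      unfolding cardB[symmetric] by (rule card_indep_family_le[OF finB P(3)[OF a] finW G(2)])
    thus "HF (adjn I (lin_seq a) n) d \<le> min_section I n d"
      using HF_dim[OF idl, of d a0] HF_dim[OF idl, of d a] by (simp add: a0 W_def)
  qed (rule min_section_le[OF lin_seq_homog])
  thus ?thesis using P(1,2) by blast
qed

text \<open>The definite description in \<open>generic_value\<close> is well defined because two
  nonempty open sets meet, so no other value can be constant on an open set.\<close>

lemma sectional_matrix_eq_min_section:
  fixes I :: "('x::finite, 'k::field_char_0) mpoly set"
  assumes I: "hidl I" and n: "n \<le> CARD('x)"
  shows "sectional_matrix I (CARD('x) - n) d = min_section I n d"
proof -
  let ?V = "{..<n} \<times> (UNIV :: 'x set)"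
  have nn: "CARD('x) - (CARD('x) - n) = n" using n by simp
  have adjn: "I <+>\<^bsub>\<S>\<^esub> Idl\<^bsub>\<S>\<^esub> ((\<lambda>i. linear_form (\<lambda>x. a (i, x))) ` {..<n}) = adjn I (lin_seq a) n" for a :: "nat \<times> 'x \<Rightarrow> 'k"
    using add_idl_genideal[OF hidl_is_idl[OF I], of "lin_seq a" n] by (simp add: lin_seq_def[abs_def])
  obtain P a0 where P: "polyfun ?V P" "P a0 \<noteq> 0"
      "\<And>a. P a \<noteq> 0 \<Longrightarrow> HF (adjn I (lin_seq a) n) d = min_section I n d"
    using min_section_generic[OF I, of n d] by blast
  obtain p where p: "\<forall>m\<in>keys p. keys m \<subseteq> ?V" "P = (\<lambda>a. mpoly_eval a p)" using P(1) unfolding polyfun_def by blast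
  let ?U = "{a \<in> ?V \<rightarrow>\<^sub>E UNIV. \<exists>q\<in>{p}. mpoly_eval a q \<noteq> 0}"
  have "zariski_open ?V ?U" unfolding zariski_open_def using p(1) by blast
  moreover have "restrict a0 ?V \<in> ?U" using P(2) polyfun_restrict[OF P(1), of a0] by (auto simp: p(2))
  moreover have "HF (adjn I (lin_seq a) n) d = min_section I n d" if "a \<in> ?U" for a
    using P(3)[of a] that by (simp add: p(2))
  moreover have "h = min_section I n d"
    if U: "zariski_open ?V U" "U \<noteq> {}" "\<forall>a\<in>U. HF (adjn I (lin_seq a) n) d = h" for U h
  proof -
    obtain Q where Q: "\<forall>p\<in>Q. \<forall>m\<in>keys p. keys m \<subseteq> ?V" "U = {a \<in> ?V \<rightarrow>\<^sub>E UNIV. \<exists>p\<in>Q. mpoly_eval a p \<noteq> 0}"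
      using U(1) unfolding zariski_open_def by blast
    obtain b q where q: "q \<in> Q" "mpoly_eval b q \<noteq> 0" using U(2) Q(2) by blast
    have pq: "polyfun ?V (\<lambda>a. mpoly_eval a q)" unfolding polyfun_def using Q(1) q(1) by blast
    have "line_generic ({a. P a \<noteq> 0} \<inter> {a. mpoly_eval a q \<noteq> 0})"
      by (rule line_generic_Int[OF line_generic_polyfun[of ?V P a0, OF P(1,2)]
            line_generic_polyfun[of ?V "\<lambda>a. mpoly_eval a q" b, OF pq q(2)]])
    then obtain a where a: "P a \<noteq> 0" "mpoly_eval a q \<noteq> 0" unfolding line_generic_def by blast
    let ?a = "restrict a ?V"
    have "mpoly_eval ?a q \<noteq> 0" using a(2) polyfun_restrict[OF pq, of a] by simp
    hence "?a \<in> U" unfolding Q(2) using q(1) by auto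
    moreover have "P ?a \<noteq> 0" using a(1) polyfun_restrict[OF P(1), of a] by simp
    ultimately show ?thesis using U(3) P(3) by metis
  qed
  ultimately show ?thesis
    unfolding sectional_matrix_def generic_value_def nn adjn
    by (intro the_equality) blast+
qed

text \<open>One sequence has to meet all conditions at once. The degrees are bounded by
  \<open>N\<close> since only finitely many open conditions can be intersected: over a countable
  field infinitely many may exclude every point. Being almost regular depends on the earlier forms,
  so the forms are chosen successively, inside \<open>W\<close>.\<close>

lemma generic_sequence:
  fixes I :: "('x::finite, 'k::field_char_0) mpoly set"
  assumes I: "hidl I"
  shows "\<exists>y. (\<forall>i<CARD('x). y i \<in> homog_part 1 \<and> y i \<notin> adjn {0} y i \<and> almost_regular (adjn I y i) (y i)) \<and>
    (\<forall>n\<le>CARD('x). \<forall>d\<le>N. HF (adjn I y n) d = min_section I n d)"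
proof -
  obtain P a0 where P: "\<And>n d. polyfun ({..<n} \<times> UNIV) (P n d)" "\<And>n d. P n d (a0 n d) \<noteq> 0"
      "\<And>n d a. P n d a \<noteq> 0 \<Longrightarrow> HF (adjn I (lin_seq a) n) d = min_section I n d"
    using min_section_generic[OF I] by metis
  define W where "W = (\<Inter>(n, d)\<in>{..CARD('x)} \<times> {..N}. {a. P n d a \<noteq> 0})"
  have W: "line_generic W"
    unfolding W_def
  proof (rule line_generic_INT)
    fix nd :: "nat \<times> nat"
    show "line_generic (case nd of (n, d) \<Rightarrow> {a. P n d a \<noteq> 0})"
      using line_generic_polyfun[OF P(1) P(2)] by (cases nd) simp
  qed simp
  define good where "good a i \<longleftrightarrow> lin_seq a i \<notin> adjn {0} (lin_seq a) i \<and>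
    almost_regular (adjn I (lin_seq a) i) (lin_seq a i)" for a i
  have "\<exists>a\<in>W. \<forall>i<j. good a i" if "j \<le> CARD('x)" for j
    using that
  proof (induction j)
    case 0
    thus ?case using W by (auto simp: line_generic_def)
  next
    case (Suc j)
    then obtain a where a: "a \<in> W" "\<And>i. i < j \<Longrightarrow> good a i" by auto
    \<comment> \<open>Replaces the form with index \<open>j\<close> only: the conditions on earlier
      forms persist, and the later forms remain free to be changed.\<close>
    define upd where "upd c = (\<lambda>(i, x). if i = j then c x else a (i, x))" for c
    have upd_seq: "lin_seq (upd c) i = (if i = j then linear_form c else lin_seq a i)" for c i
      by (simp add: lin_seq_def upd_def)
    have upd_adjn: "adjn J (lin_seq (upd c)) i = adjn J (lin_seq a) i" if "i \<le> j" for c i J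
      using that by (intro adjn_cong) (simp add: upd_seq)
    \<comment> \<open>A slice of \<open>W\<close>: a line in the coordinates of the form
      \<open>j\<close> is a line of the whole space, moving in no other coordinate.\<close>
    have U1: "line_generic {c. upd c \<in> W}"
      unfolding line_generic_def
    proof (intro conjI ballI allI)
      have "upd (\<lambda>x. a (j, x)) = a" by (auto simp: upd_def)
      thus "{c. upd c \<in> W} \<noteq> {}" using a(1) by (metis empty_iff mem_Collect_eq)
      fix c v :: "'x \<Rightarrow> 'k" assume c: "c \<in> {c. upd c \<in> W}"
      let ?v = "\<lambda>p. if fst p = j then v (snd p) else 0"
      have "upd (\<lambda>x. c x + t * v x) = (\<lambda>p. upd c p + t * ?v p)" for t by (auto simp: upd_def fun_eq_iff)
      moreover have "\<forall>v. finite {t. (\<lambda>p. upd c p + t * v p) \<notin> W}"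
        using W c unfolding line_generic_def by blast
      from this[THEN spec, of ?v] have "finite {t. (\<lambda>p. upd c p + t * ?v p) \<notin> W}" .
      ultimately show "finite {t. (\<lambda>x. c x + t * v x) \<notin> {c. upd c \<in> W}}" by simp
    qed
    obtain x where "mpoly_var x \<notin> adjn {0} (lin_seq a) j"
      using linear_ideal_proper[of j "lin_seq a"] lin_seq_homog a(2) Suc.prems by (auto simp: good_def)
    hence U2: "line_generic {c. linear_form c \<notin> adjn {0} (lin_seq a) j}"
      unfolding mpoly_var_linear_form by (rule line_generic_not_in_ideal[OF is_idl_adjn[OF is_idl_zero]])
    have "hidl (adjn I (lin_seq a) j)" by (rule hidl_adjn[OF I lin_seq_homog])
    then obtain U where U: "line_generic U" "\<And>c. c \<in> U \<Longrightarrow> almost_regular (adjn I (lin_seq a) j) (linear_form c)"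
      using almost_regular_generic by blast
    have "line_generic ({c. upd c \<in> W} \<inter> ({c. linear_form c \<notin> adjn {0} (lin_seq a) j} \<inter> U))"
      by (intro line_generic_Int U1 U2 U(1))
    then obtain c where c: "upd c \<in> W" "linear_form c \<notin> adjn {0} (lin_seq a) j" "c \<in> U"
      unfolding line_generic_def by blast
    have "good (upd c) i" if "i < Suc j" for i
    proof (cases "i = j")
      case True
      thus ?thesis using c(2) U(2)[OF c(3)] by (simp add: good_def upd_adjn upd_seq)
    next
      case False
      thus ?thesis using a(2)[of i] that by (simp add: good_def upd_adjn upd_seq)
    qed
    thus ?case using c(1) by blast
  qed
  then obtain a where a: "a \<in> W" "\<And>i. i < CARD('x) \<Longrightarrow> good a i" by blast
  have "HF (adjn I (lin_seq a) n) d = min_section I n d" if "n \<le> CARD('x)" "d \<le> N" for n d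
    using a(1) that P(3) unfolding W_def by blast
  thus ?thesis using a(2) lin_seq_homog unfolding good_def by (intro exI[of _ "lin_seq a"]) blast
qed

text \<open>A maximum is an upper bound only for a finite set: \<open>resolution_length\<close>
  leaves finitely many indices, and each free module has finitely many shifts.
  \<open>A (Suc i)\<close> are the shifts of the module with index \<open>i\<close> in the
  resolution of \<open>I\<close>.\<close>

lemma regularity_bound:
  fixes I :: "('x::finite, 'k::field_char_0) mpoly set"
  assumes I: "hidl I"
  shows "\<exists>N A D. gres I N A D \<and> (\<forall>i q. q < N (Suc i) \<longrightarrow> int (A (Suc i) q) \<le> regularity I + int i)"
proof -
  let ?Q = "\<lambda>\<beta>. \<exists>r a g D. min_graded_resolution I r a g D \<and> \<beta> = (\<lambda>i j. card {q. q < r i \<and> a i q = j})"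
  have "\<exists>\<beta>. ?Q \<beta>" using gres_exists[OF I] min_graded_resolution_of_gres by blast
  hence "?Q (graded_betti I)" unfolding graded_betti_def by (rule someI_ex)
  then obtain r a g D where res: "min_graded_resolution I r a g D"
    and betti: "graded_betti I = (\<lambda>i j. card {q. q < r i \<and> a i q = j})" by blast
  define N where "N = case_nat (Suc 0) r"
  define A where "A = case_nat (\<lambda>_. 0) a"
  have gres: "gres I N A (case_nat (\<lambda>_. g) D)"
    unfolding N_def A_def by (rule gres_of_min_graded_resolution[OF res])
  obtain y where y: "\<forall>i<CARD('x). y i \<in> homog_part 1 \<and> y i \<notin> adjn {0} y i \<and> almost_regular (adjn I y i) (y i)"
    using generic_sequence[OF I, of 0] by blast
  interpret resolution_sections I N A "case_nat (\<lambda>_. g) D" y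
    by unfold_locales (use gres I y in auto)
  have r0: "r i = 0" if "i \<ge> CARD('x)" for i using resolution_length[OF that] by (simp add: N_def)
  have nz: "graded_betti I i j \<noteq> 0 \<longleftrightarrow> (\<exists>q<r i. a i q = j)" for i j
    unfolding betti by auto
  let ?S = "{int (Max {j. graded_betti I i j \<noteq> 0}) - int i | i. \<exists>j. graded_betti I i j \<noteq> 0}"
  have "?S \<subseteq> (\<lambda>i. int (Max {j. graded_betti I i j \<noteq> 0}) - int i) ` {..<CARD('x)}"
  proof
    fix s assume "s \<in> ?S"
    then obtain i j where s: "s = int (Max {j. graded_betti I i j \<noteq> 0}) - int i" and "graded_betti I i j \<noteq> 0"
      by blast
    then obtain q where "q < r i" unfolding nz by blast
    hence "i \<in> {..<CARD('x)}" using r0[of i] by (cases "i < CARD('x)") auto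
    thus "s \<in> (\<lambda>i. int (Max {j. graded_betti I i j \<noteq> 0}) - int i) ` {..<CARD('x)}" unfolding s by (rule imageI)
  qed
  hence fin: "finite ?S" by (rule finite_subset) simp
  have "int (A (Suc i) q) \<le> regularity I + int i" if q: "q < N (Suc i)" for i q
  proof -
    have q': "q < r i" using q by (simp add: N_def)
    have "{j. graded_betti I i j \<noteq> 0} \<subseteq> a i ` {..<r i}" unfolding nz by auto
    hence "finite {j. graded_betti I i j \<noteq> 0}" by (rule finite_subset) simp
    moreover have "a i q \<in> {j. graded_betti I i j \<noteq> 0}" unfolding nz using q' by blast
    ultimately have "a i q \<le> Max {j. graded_betti I i j \<noteq> 0}" by (rule Max_ge)
    moreover have "int (Max {j. graded_betti I i j \<noteq> 0}) - int i \<in> ?S" using q' nz by blast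
    hence "int (Max {j. graded_betti I i j \<noteq> 0}) - int i \<le> regularity I"
      unfolding regularity_def by (rule Max_ge[OF fin])
    ultimately show ?thesis by (simp add: A_def)
  qed
  thus ?thesis using gres by blast
qed

section \<open>The weak Lefschetz property in terms of the polynomial ring\<close>

text \<open>Stated over any commutative ring, since it is applied both to \<open>S\<close> and to
  \<open>S/I\<close>. Differences appear because \<open>A\<close> is just a set of representatives,
  with no closure property.\<close>

lemma (in ideal) full_rank_quotient_iff:
  assumes R: "cring R" and l: "l \<in> carrier R" and G: "A \<subseteq> carrier R" "B \<subseteq> carrier R"
    and lAB: "\<And>f. f \<in> A \<Longrightarrow> l \<otimes> f \<in> B"
  shows "full_rank (\<lambda>x. (I +> l) \<otimes>\<^bsub>R Quot I\<^esub> x) ((\<lambda>f. I +> f) ` A) ((\<lambda>f. I +> f) ` B) \<longleftrightarrow>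
    (\<forall>f\<in>A. \<forall>g\<in>A. l \<otimes> (f \<ominus> g) \<in> I \<longrightarrow> f \<ominus> g \<in> I) \<or> (\<forall>g\<in>B. \<exists>f\<in>A. g \<ominus> l \<otimes> f \<in> I)"
proof -
  interpret R: cring R by (rule R)
  have eq: "I +> f = I +> g \<longleftrightarrow> f \<ominus> g \<in> I" if "f \<in> carrier R" "g \<in> carrier R" for f g
    using quotient_eq_iff_same_a_r_cos[OF ideal_axioms that] by simp
  have mult: "(I +> l) \<otimes>\<^bsub>R Quot I\<^esub> (I +> f) = I +> (l \<otimes> f)" if "f \<in> carrier R" for f
    using rcoset_mult_add[OF l that] by (simp add: FactRing_def)
  have "inj_on (\<lambda>x. (I +> l) \<otimes>\<^bsub>R Quot I\<^esub> x) ((\<lambda>f. I +> f) ` A) \<longleftrightarrow>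
      (\<forall>f\<in>A. \<forall>g\<in>A. I +> (l \<otimes> f) = I +> (l \<otimes> g) \<longrightarrow> I +> f = I +> g)"
  proof -
    have "inj_on (\<lambda>x. (I +> l) \<otimes>\<^bsub>R Quot I\<^esub> x) ((\<lambda>f. I +> f) ` A) \<longleftrightarrow>
        (\<forall>f\<in>A. \<forall>g\<in>A. (I +> l) \<otimes>\<^bsub>R Quot I\<^esub> (I +> f) = (I +> l) \<otimes>\<^bsub>R Quot I\<^esub> (I +> g) \<longrightarrow> I +> f = I +> g)"
      unfolding inj_on_def by blast
    also have "\<dots> \<longleftrightarrow> (\<forall>f\<in>A. \<forall>g\<in>A. I +> (l \<otimes> f) = I +> (l \<otimes> g) \<longrightarrow> I +> f = I +> g)"
    proof (intro ball_cong refl)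
      fix f g assume "f \<in> A" "g \<in> A"
      hence "f \<in> carrier R" "g \<in> carrier R" using G(1) by auto
      thus "((I +> l) \<otimes>\<^bsub>R Quot I\<^esub> (I +> f) = (I +> l) \<otimes>\<^bsub>R Quot I\<^esub> (I +> g) \<longrightarrow> I +> f = I +> g) \<longleftrightarrow>
          (I +> (l \<otimes> f) = I +> (l \<otimes> g) \<longrightarrow> I +> f = I +> g)" by (simp only: mult)
    qed
    finally show ?thesis .
  qed
  also have "\<dots> \<longleftrightarrow> (\<forall>f\<in>A. \<forall>g\<in>A. l \<otimes> (f \<ominus> g) \<in> I \<longrightarrow> f \<ominus> g \<in> I)"
  proof (intro ball_cong refl)
    fix f g assume "f \<in> A" "g \<in> A"
    hence c: "f \<in> carrier R" "g \<in> carrier R" using G(1) by auto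
    have "l \<otimes> (f \<ominus> g) = l \<otimes> f \<ominus> l \<otimes> g" using l c by (simp add: a_minus_def r_distr r_minus)
    thus "(I +> (l \<otimes> f) = I +> (l \<otimes> g) \<longrightarrow> I +> f = I +> g) \<longleftrightarrow> (l \<otimes> (f \<ominus> g) \<in> I \<longrightarrow> f \<ominus> g \<in> I)"
      using eq l c by simp
  qed
  finally have inj: "inj_on (\<lambda>x. (I +> l) \<otimes>\<^bsub>R Quot I\<^esub> x) ((\<lambda>f. I +> f) ` A) \<longleftrightarrow>
      (\<forall>f\<in>A. \<forall>g\<in>A. l \<otimes> (f \<ominus> g) \<in> I \<longrightarrow> f \<ominus> g \<in> I)" .
  have im: "(\<lambda>x. (I +> l) \<otimes>\<^bsub>R Quot I\<^esub> x) ` (\<lambda>f. I +> f) ` A = (\<lambda>f. I +> (l \<otimes> f)) ` A"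
    unfolding image_image using mult G(1) by (intro image_cong) auto
  have "(\<lambda>f. I +> (l \<otimes> f)) ` A \<subseteq> (\<lambda>f. I +> f) ` B" using lAB by blast
  hence "(\<lambda>f. I +> (l \<otimes> f)) ` A = (\<lambda>f. I +> f) ` B \<longleftrightarrow> (\<forall>g\<in>B. \<exists>f\<in>A. I +> g = I +> (l \<otimes> f))"
    by (auto simp: image_iff set_eq_iff subset_iff)
  also have "\<dots> \<longleftrightarrow> (\<forall>g\<in>B. \<exists>f\<in>A. g \<ominus> l \<otimes> f \<in> I)"
  proof (intro ball_cong bex_cong refl)
    fix g f assume "g \<in> B" "f \<in> A"
    hence "g \<in> carrier R" "l \<otimes> f \<in> carrier R" using G l by auto
    thus "I +> g = I +> (l \<otimes> f) \<longleftrightarrow> g \<ominus> l \<otimes> f \<in> I" by (rule eq)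
  qed
  finally show ?thesis unfolding full_rank_def inj im by blast
qed

lemma minus_poly_ring [simp]: "(f :: 'a::comm_ring_1) \<ominus>\<^bsub>ring_of_type_algebra\<^esub> g = f - g"
proof -
  interpret cring "ring_of_type_algebra :: 'a ring" by (rule cring_from_type_algebra)
  have "\<ominus>\<^bsub>ring_of_type_algebra\<^esub> g = - g" by (rule minus_equality) auto
  thus ?thesis by (simp add: a_minus_def)
qed

lemma injective_diff_iff:
  "(\<forall>f\<in>homog_part d. \<forall>g\<in>homog_part d. y * (f - g) \<in> J \<longrightarrow> f - g \<in> J) \<longleftrightarrow>
    (\<forall>f\<in>homog_part d. y * f \<in> J \<longrightarrow> f \<in> J)" (is "?L \<longleftrightarrow> ?R")
proof
  assume ?L
  thus ?R using bspec[OF bspec[OF \<open>?L\<close>], of _ 0] by simp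
qed (use homog_part_diff in blast)

lemma full_rank_at_iff_quotient:
  fixes J :: "('x::finite, 'k::field) mpoly set"
  assumes J: "is_idl J" and y: "y \<in> homog_part 1"
  shows "full_rank (\<lambda>x. (coset J y) \<otimes>\<^bsub>\<S> Quot J\<^esub> x) (quot_grading \<S> J homog_part d) (quot_grading \<S> J homog_part (Suc d)) \<longleftrightarrow>
    full_rank_at J y d"
proof -
  interpret ideal J "\<S> :: ('x, 'k) mpoly ring" using J by (simp add: ideal_iff_is_idl)
  have yd: "y * f \<in> homog_part (Suc d)" if "f \<in> homog_part d" for f
    using homog_part_mult[OF y that] by simp
  show ?thesis
    using injective_diff_iff[of d y J] full_rank_quotient_iff[OF cring_from_type_algebra, of y "homog_part d" "homog_part (Suc d)"] yd
    unfolding quot_grading_def full_rank_at_def by simp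
qed

lemma WLP_with_quotient_iff:
  fixes J :: "('x::finite, 'k::field) mpoly set"
  assumes J: "is_idl J" and y: "y \<in> homog_part 1"
  shows "WLP_with (\<S> Quot J) (quot_grading \<S> J homog_part) (coset J y) \<longleftrightarrow> (\<forall>d. full_rank_at J y d)"
  unfolding WLP_with_def full_rank_at_iff_quotient[OF J y] using y by (auto simp: quot_grading_def)

lemma genideal_quotient:
  fixes I :: "('x::finite, 'k::field) mpoly set"
  assumes I: "is_idl I"
  shows "Idl\<^bsub>\<S> Quot I\<^esub> ((\<lambda>i. coset I (y i)) ` {..<n}) = coset I ` adjn I y n" (is "?L = ?R")
proof -
  let ?Q = "\<S> Quot I"
  note ops = quot_ops[OF I]
  interpret Q: cring ?Q by (rule ops(1))
  note J = is_idl_adjn[OF I, of y n]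
  have sub: "(\<lambda>i. coset I (y i)) ` {..<n} \<subseteq> carrier ?Q" unfolding ops(6) by blast
  have idL: "ideal ?L ?Q" by (rule Q.genideal_ideal[OF sub])
  show ?thesis
  proof
    have neg: "\<ominus>\<^bsub>?Q\<^esub> (coset I f) = coset I (- f)" for f
      by (rule Q.minus_equality) (auto simp: ops)
    have "ideal ?R ?Q"
    proof (rule idealI[OF Q.ring_axioms])
      show "subgroup ?R (add_monoid ?Q)"
      proof (rule Q.add.subgroupI)
        show "?R \<subseteq> carrier ?Q" unfolding ops(6) by blast
        show "?R \<noteq> {}" using idl_0[OF J] by blast
        show "\<ominus>\<^bsub>?Q\<^esub> a \<in> ?R" if "a \<in> ?R" for a using that idl_uminus[OF J] by (auto simp: neg)
        show "a \<oplus>\<^bsub>?Q\<^esub> b \<in> ?R" if "a \<in> ?R" "b \<in> ?R" for a b using that idl_add[OF J] by (auto simp: ops)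
      qed
    next
      fix a x assume "a \<in> ?R" "x \<in> carrier ?Q"
      then obtain f g where "f \<in> adjn I y n" "a = coset I f" "x = coset I g" unfolding ops(6) by blast
      thus "x \<otimes>\<^bsub>?Q\<^esub> a \<in> ?R" "a \<otimes>\<^bsub>?Q\<^esub> x \<in> ?R"
        using idl_mult[OF J, of f g] idl_mult2[OF J, of f g] by (auto simp: ops)
    qed
    thus "?L \<subseteq> ?R" by (rule Q.genideal_minimal) (use in_adjn[OF I] in blast)
    let ?K = "{f. coset I f \<in> ?L}"
    interpret L: ideal ?L ?Q by (rule idL)
    have "is_idl ?K"
    proof (rule is_idlI)
      show "0 \<in> ?K" using additive_subgroup.zero_closed[OF L.is_additive_subgroup] by (simp add: ops)
      show "f + g \<in> ?K" if "f \<in> ?K" "g \<in> ?K" for f g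
        using additive_subgroup.a_closed[OF L.is_additive_subgroup] that by (simp add: ops(3)[symmetric])
      show "c * f \<in> ?K" if "f \<in> ?K" for f c
        using L.I_l_closed[of "coset I f" "coset I c"] that by (simp add: ops(2)[symmetric] ops(6))
    qed
    moreover have "I \<subseteq> ?K"
    proof
      fix f assume "f \<in> I"
      hence "coset I f = \<zero>\<^bsub>?Q\<^esub>" unfolding ops(4) coset_eq_iff[OF I] by simp
      thus "f \<in> ?K" using additive_subgroup.zero_closed[OF L.is_additive_subgroup] by simp
    qed
    moreover have "y i \<in> ?K" if "i < n" for i using Q.genideal_self[OF sub] that by blast
    ultimately have "adjn I y n \<subseteq> ?K" by (rule adjn_least)
    thus "?R \<subseteq> ?L" by blast
  qed
qed

text \<open>The third isomorphism theorem at the level of membership: as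
  \<open>I \<subseteq> J\<close>, a class modulo \<open>I\<close> lies in \<open>K\<close> iff its
  representatives lie in \<open>J\<close>, so all conditions lift to \<open>S\<close>.\<close>

lemma WLP_with_iterated_quotient_iff:
  fixes I :: "('x::finite, 'k::field) mpoly set"
  assumes I: "is_idl I" and J: "is_idl J" and IJ: "I \<subseteq> J" and y: "y \<in> homog_part 1"
  defines "K \<equiv> coset I ` J"
  assumes K: "ideal K (\<S> Quot I)"
  shows "WLP_with ((\<S> Quot I) Quot K) (quot_grading (\<S> Quot I) K (quot_grading \<S> I homog_part))
      (K +>\<^bsub>\<S> Quot I\<^esub> (coset I y)) \<longleftrightarrow> (\<forall>d. full_rank_at J y d)"
proof -
  let ?Q = "\<S> Quot I"
  note ops = quot_ops[OF I]
  interpret Q: cring ?Q by (rule ops(1))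
  interpret K: ideal K ?Q by (rule K)
  have inK: "coset I f \<in> K \<longleftrightarrow> f \<in> J" for f
  proof
    assume "coset I f \<in> K"
    then obtain g where "g \<in> J" "f - g \<in> I" unfolding K_def by (auto simp: coset_eq_iff[OF I])
    thus "f \<in> J" using IJ idl_diff_cancel[OF J] by blast
  qed (auto simp: K_def)
  have neg: "\<ominus>\<^bsub>?Q\<^esub> (coset I f) = coset I (- f)" for f
    by (rule Q.minus_equality) (auto simp: ops)
  have minus: "(coset I f) \<ominus>\<^bsub>?Q\<^esub> (coset I g) = coset I (f - g)" for f g
    by (simp add: a_minus_def neg ops)
  have "full_rank (\<lambda>x. (K +>\<^bsub>?Q\<^esub> (coset I y)) \<otimes>\<^bsub>?Q Quot K\<^esub> x)
      ((\<lambda>f. K +>\<^bsub>?Q\<^esub> f) ` quot_grading \<S> I homog_part d) ((\<lambda>f. K +>\<^bsub>?Q\<^esub> f) ` quot_grading \<S> I homog_part (Suc d))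
      \<longleftrightarrow> full_rank_at J y d" for d
  proof -
    have "y * f \<in> homog_part (Suc d)" if "f \<in> homog_part d" for f
      using homog_part_mult[OF y that] by simp
    thus ?thesis
      using injective_diff_iff[of d y J] unfolding quot_grading_def
      by (subst K.full_rank_quotient_iff[OF ops(1)])
         (auto simp: ops(6) ops(2) minus inK full_rank_at_def)
  qed
  moreover have "K +>\<^bsub>?Q\<^esub> (coset I y) \<in> quot_grading ?Q K (quot_grading \<S> I homog_part) 1"
    using y by (auto simp: quot_grading_def)
  ultimately show ?thesis unfolding WLP_with_def quot_grading_def[of ?Q] by blast
qed

text \<open>Lefschetz elements are classes of linear forms and lift to \<open>S\<close>, where the
  iterated quotients become quotients by \<open>adjn I y i\<close>. The elements are numbered from
  \<open>1\<close> in \<open>k_WLP\<close> and from \<open>0\<close> here, hence the index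
  \<open>i - 1\<close>.\<close>

lemma k_WLP_iff:
  fixes I :: "('x::finite, 'k::field) mpoly set"
  assumes I: "is_idl I" and k: "1 \<le> k"
  shows "k_WLP (\<S> Quot I) (quot_grading \<S> I homog_part) k \<longleftrightarrow>
    (\<exists>y. (\<forall>i<k. y i \<in> homog_part 1) \<and> (\<forall>i<k. \<forall>d. full_rank_at (adjn I y i) (y i) d))"
proof -
  let ?Q = "\<S> Quot I" and ?co = "coset I" and ?G = "quot_grading \<S> I homog_part"
  let ?W = "\<lambda>y i. let J = Idl\<^bsub>?Q\<^esub> ((\<lambda>i. ?co (y (i - 1))) ` {1..<i}) in
         WLP_with (?Q Quot J) (quot_grading ?Q J ?G) (J +>\<^bsub>?Q\<^esub> ?co (y (i - 1)))"
  have main: "(WLP_with ?Q ?G (?co (y 0)) \<and>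
      (\<forall>i\<in>{2..k}. ?W y i)) \<longleftrightarrow> (\<forall>i<k. \<forall>d. full_rank_at (adjn I y i) (y i) d)"
    if "\<forall>i<k. y i \<in> homog_part 1" for y :: "nat \<Rightarrow> ('x, 'k) mpoly"
  proof -
    note y = that[rule_format]
    have "WLP_with ?Q ?G (?co (y 0)) \<longleftrightarrow> (\<forall>d. full_rank_at (adjn I y 0) (y 0) d)"
      using WLP_with_quotient_iff[OF I y[of 0]] k by simp
    moreover have "?W y i \<longleftrightarrow>
        (\<forall>d. full_rank_at (adjn I y (i - 1)) (y (i - 1)) d)" if i: "i \<in> {2..k}" for i
    proof -
      have "(\<lambda>i. ?co (y (i - 1))) ` {1..<i} = (\<lambda>i. ?co (y i)) ` (\<lambda>i. i - 1) ` {1..<i}" by (simp add: image_image)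
      also have "(\<lambda>i. i - 1) ` {1..<i} = {..<i - 1}"
        by (auto simp: image_iff intro!: bexI[of _ "Suc _"])
      finally have gen: "Idl\<^bsub>?Q\<^esub> ((\<lambda>i. ?co (y (i - 1))) ` {1..<i}) = ?co ` adjn I y (i - 1)"
        using genideal_quotient[OF I, of y "i - 1"] by simp
      interpret Q: cring ?Q by (rule quot_ops(1)[OF I])
      have "ideal (Idl\<^bsub>?Q\<^esub> ((\<lambda>i. ?co (y (i - 1))) ` {1..<i})) ?Q"
        by (rule Q.genideal_ideal) (auto simp: quot_ops(6)[OF I])
      hence "ideal (?co ` adjn I y (i - 1)) ?Q" by (simp only: gen)
      moreover have "i - 1 < k" using i by auto
      hence "y (i - 1) \<in> homog_part 1" by (rule y)
      ultimately show ?thesis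
        unfolding gen Let_def
        by (intro WLP_with_iterated_quotient_iff[OF I is_idl_adjn[OF I] subset_adjn])
    qed
    ultimately have "(WLP_with ?Q ?G (?co (y 0)) \<and>
      (\<forall>i\<in>{2..k}. ?W y i)) \<longleftrightarrow> (\<forall>d. full_rank_at (adjn I y 0) (y 0) d) \<and> (\<forall>i\<in>{2..k}. \<forall>d. full_rank_at (adjn I y (i - 1)) (y (i - 1)) d)"
      by simp
    also have "\<dots> \<longleftrightarrow> (\<forall>i<k. \<forall>d. full_rank_at (adjn I y i) (y i) d)"
    proof
      assume h: "(\<forall>d. full_rank_at (adjn I y 0) (y 0) d) \<and> (\<forall>i\<in>{2..k}. \<forall>d. full_rank_at (adjn I y (i - 1)) (y (i - 1)) d)"
      show "\<forall>i<k. \<forall>d. full_rank_at (adjn I y i) (y i) d"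
      proof (intro allI impI)
        fix i d assume "i < k"
        show "full_rank_at (adjn I y i) (y i) d"
        proof (cases i)
          case 0 thus ?thesis using conjunct1[OF h] by blast
        next
          case (Suc j)
          hence "Suc i \<in> {2..k}" using \<open>i < k\<close> by simp
          from bspec[OF conjunct2[OF h] this] show ?thesis by simp
        qed
      qed
    next
      assume h: "\<forall>i<k. \<forall>d. full_rank_at (adjn I y i) (y i) d"
      have "full_rank_at (adjn I y (i - 1)) (y (i - 1)) d" if "i \<in> {2..k}" for i d
      proof -
        have "i - 1 < k" using that by auto
        thus ?thesis using h by blast
      qed
      moreover have "0 < k" using k by simp
      ultimately show "(\<forall>d. full_rank_at (adjn I y 0) (y 0) d) \<and> (\<forall>i\<in>{2..k}. \<forall>d. full_rank_at (adjn I y (i - 1)) (y (i - 1)) d)"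
        using h by blast
    qed
    finally show ?thesis .
  qed
  show ?thesis
  proof
    assume "k_WLP ?Q ?G k"
    then obtain ls where ls: "\<And>i. i \<in> {1..k} \<Longrightarrow> ls i \<in> ?G 1"
        "WLP_with ?Q ?G (ls 1)"
        "\<forall>i\<in>{2..k}. let J = Idl\<^bsub>?Q\<^esub> (ls ` {1..<i}) in
           WLP_with (?Q Quot J) (quot_grading ?Q J ?G) (J +>\<^bsub>?Q\<^esub> ls i)"
      unfolding k_WLP_def by blast
    have "\<exists>y. y \<in> homog_part 1 \<and> ls (Suc i) = ?co y" if "i < k" for i
      using ls(1)[of "Suc i"] that unfolding quot_grading_def by auto
    then obtain y where y: "\<And>i. i < k \<Longrightarrow> y i \<in> homog_part 1 \<and> ls (Suc i) = ?co (y i)" by metis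
    have lsy: "ls i = ?co (y (i - 1))" if "i \<in> {1..k}" for i
    proof -
      have "i - 1 < k" "Suc (i - 1) = i" using that by auto
      thus ?thesis using y[of "i - 1"] by simp
    qed
    have "WLP_with ?Q ?G (?co (y 0))" using ls(2) lsy[of 1] k by simp
    moreover have "\<forall>i\<in>{2..k}. ?W y i"
    proof
      fix i assume i: "i \<in> {2..k}"
      have "ls ` {1..<i} = (\<lambda>i. ?co (y (i - 1))) ` {1..<i}" using i lsy by (intro image_cong) auto
      moreover have "ls i = ?co (y (i - 1))" using i lsy by simp
      ultimately show "?W y i"
        using bspec[OF ls(3) i] by simp
    qed
    ultimately have "\<forall>i<k. \<forall>d. full_rank_at (adjn I y i) (y i) d" using main[of y] y by blast
    thus "\<exists>y. (\<forall>i<k. y i \<in> homog_part 1) \<and> (\<forall>i<k. \<forall>d. full_rank_at (adjn I y i) (y i) d)" using y by blast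
  next
    assume "\<exists>y. (\<forall>i<k. y i \<in> homog_part 1) \<and> (\<forall>i<k. \<forall>d. full_rank_at (adjn I y i) (y i) d)"
    then obtain y where y: "\<And>i. i < k \<Longrightarrow> y i \<in> homog_part 1" "\<forall>i<k. \<forall>d. full_rank_at (adjn I y i) (y i) d" by blast
    let ?ls = "\<lambda>i. ?co (y (i - 1))"
    have "\<forall>i<k. y i \<in> homog_part 1" using y(1) by blast
    note m = iffD2[OF main[OF this] y(2)]
    show "k_WLP ?Q ?G k"
      unfolding k_WLP_def
    proof (intro exI[of _ ?ls] conjI ballI)
      fix i assume "i \<in> {1..k}"
      hence "i - 1 < k" by auto
      from y(1)[OF this] show "?ls i \<in> ?G 1" by (auto simp: quot_grading_def)
    next
      show "WLP_with ?Q ?G (?ls 1)" using conjunct1[OF m] by simp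
    next
      fix i assume "i \<in> {2..k}"
      thus "?W y i"
        by (rule bspec[OF conjunct2[OF m]])
    qed
  qed
qed

text \<open>Full rank gives the least value that \<open>HF_adj_ge\<close> permits, given the Hilbert
  function one step before; that one agrees with the Hilbert function of a generic sequence by
  induction. So the section is no larger than the generic one, which is minimal. The generic
  sequence \<open>z\<close> depends on \<open>d\<close>.\<close>

lemma full_rank_sequence_HF:
  fixes I :: "('x::finite, 'k::field_char_0) mpoly set"
  assumes I: "hidl I" and k: "k \<le> CARD('x)" and y: "\<And>i. i < k \<Longrightarrow> y i \<in> homog_part 1"
    and fr: "\<And>i d. i < k \<Longrightarrow> full_rank_at (adjn I y i) (y i) d"
  shows "n \<le> k \<Longrightarrow> HF (adjn I y n) d = min_section I n d"
proof (induction n arbitrary: d)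
  case 0
  obtain z where "\<forall>n\<le>CARD('x). \<forall>d'\<le>d. HF (adjn I z n) d' = min_section I n d'"
    using generic_sequence[OF I, of d] by blast
  hence "HF (adjn I z 0) d = min_section I 0 d" by blast
  thus ?case by simp
next
  case (Suc n)
  obtain z where z: "\<And>i. i < CARD('x) \<Longrightarrow> z i \<in> homog_part 1"
    and min: "\<And>n e. n \<le> CARD('x) \<Longrightarrow> e \<le> d \<Longrightarrow> HF (adjn I z n) e = min_section I n e"
    using generic_sequence[OF I, of d] by blast
  have n: "n < k" "n < CARD('x)" using Suc.prems k by auto
  have hy: "hidl (adjn I y n)" by (rule hidl_adjn[OF I, where e = "\<lambda>_. 1"]) (use y n in simp)
  have hz: "hidl (adjn I z n)" by (rule hidl_adjn[OF I, where e = "\<lambda>_. 1"]) (use z n in simp)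
  have IH: "HF (adjn I y n) e = HF (adjn I z n) e" if "e \<le> d" for e
    using Suc.IH[of e] min[of n e] n that by simp
  have "HF (adjn I y (Suc n)) d \<le> HF (adjn I z (Suc n)) d"
  proof (cases d)
    case 0
    thus ?thesis using HF_adj_0[OF hy y[OF n(1)]] HF_adj_0[OF hz z[OF n(2)]] IH[of 0] by simp
  next
    case (Suc e)
    have "int (HF (adj (adjn I y n) (y n)) (Suc e)) = max (int (HF (adjn I z n) (Suc e)) - int (HF (adjn I z n) e)) 0"
      using HF_adj_eq_iff[OF hy y[OF n(1)], of e] fr[OF n(1)] IH[of e] IH[of "Suc e"] Suc by simp
    thus ?thesis using HF_adj_ge[OF hz z[OF n(2)], of e] Suc by simp
  qed
  moreover have "HF (adjn I z (Suc n)) d = min_section I (Suc n) d" using min[of "Suc n" d] n by simp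
  moreover have "min_section I (Suc n) d \<le> HF (adjn I y (Suc n)) d"
    by (rule min_section_le) (use y Suc.prems in simp)
  ultimately show ?case by simp
qed

theorem theorem6p7:
  fixes I :: "('x::finite, 'k::field_char_0) mpoly set" and k :: nat
  assumes "homogeneous_ideal I" and "I \<noteq> {0}"
    and "1 \<le> k" and "k \<le> CARD('x)"
  shows "k_WLP (\<S> Quot I) (quot_grading \<S> I homog_part) k \<longleftrightarrow>
    (\<forall>d j. int d \<le> regularity I \<and> j \<le> k - 1 \<longrightarrow>
       int (sectional_matrix I (CARD('x) - j - 1) d) =
       max (int (sectional_matrix I (CARD('x) - j) d) -
              (if d = 0 then 0 else int (sectional_matrix I (CARD('x) - j) (d - 1)))) 0)"
proof -
  have I: "hidl I" by (rule homogeneous_ideal_hidl[OF assms(1)])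
  note idl = hidl_is_idl[OF I]
  let ?eq = "\<lambda>d j. int (min_section I (Suc j) d) =
    max (int (min_section I j d) - (if d = 0 then 0 else int (min_section I j (d - 1)))) 0"
  have sm: "sectional_matrix I (CARD('x) - j - 1) d = min_section I (Suc j) d"
    "sectional_matrix I (CARD('x) - j) d = min_section I j d" if "j \<le> k - 1" for j d
  proof -
    have j: "Suc j \<le> CARD('x)" using that assms(3,4) by simp
    show "sectional_matrix I (CARD('x) - j - 1) d = min_section I (Suc j) d"
      using sectional_matrix_eq_min_section[OF I j, of d] by simp
    show "sectional_matrix I (CARD('x) - j) d = min_section I j d"
      using sectional_matrix_eq_min_section[OF I, of j d] j by simp
  qed
  have rhs: "(\<forall>d j. int d \<le> regularity I \<and> j \<le> k - 1 \<longrightarrow>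
       int (sectional_matrix I (CARD('x) - j - 1) d) =
       max (int (sectional_matrix I (CARD('x) - j) d) -
              (if d = 0 then 0 else int (sectional_matrix I (CARD('x) - j) (d - 1)))) 0) \<longleftrightarrow>
    (\<forall>d j. int d \<le> regularity I \<and> j < k \<longrightarrow> ?eq d j)"
  proof -
    have "j \<le> k - 1 \<longleftrightarrow> j < k" for j using assms(3) by auto
    thus ?thesis using sm by (simp cong: if_cong)
  qed
  show ?thesis
    unfolding k_WLP_iff[OF idl assms(3)] rhs
  proof
    assume "\<exists>y. (\<forall>i<k. y i \<in> homog_part 1) \<and> (\<forall>i<k. \<forall>d. full_rank_at (adjn I y i) (y i) d)"
    then obtain y where y: "\<And>i. i < k \<Longrightarrow> y i \<in> homog_part 1"
      and fr: "\<And>i d. i < k \<Longrightarrow> full_rank_at (adjn I y i) (y i) d" by blast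
    have HF: "HF (adjn I y n) d = min_section I n d" if "n \<le> k" for n d
      by (rule full_rank_sequence_HF[OF I assms(4) y fr that])
    show "\<forall>d j. int d \<le> regularity I \<and> j < k \<longrightarrow> ?eq d j"
    proof (intro allI impI, elim conjE)
      fix d j assume j: "j < k"
      have hy: "hidl (adjn I y j)" by (rule hidl_adjn[OF I, where e = "\<lambda>_. 1"]) (use y j in simp)
      show "?eq d j"
      proof (cases d)
        \<comment> \<open>A linear form leaves degree \<open>0\<close> unchanged, and the maximum
          with \<open>0\<close> is harmless as Hilbert functions are nonnegative.\<close>
        case 0
        thus ?thesis using HF_adj_0[OF hy y[OF j]] HF[of j 0] HF[of "Suc j" 0] j by simp
      next
        case (Suc e)
        thus ?thesis
          using HF_adj_eq_iff[OF hy y[OF j], of e] fr[OF j, of e] HF[of j] HF[of "Suc j"] j by simp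
      qed
    qed
  next
    assume eq: "\<forall>d j. int d \<le> regularity I \<and> j < k \<longrightarrow> ?eq d j"
    \<comment> \<open>The equations involve degrees up to \<open>regularity I\<close> only, so a
      sequence generic up to this degree is available.\<close>
    obtain z where z: "\<And>i. i < CARD('x) \<Longrightarrow> z i \<in> homog_part 1 \<and> z i \<notin> adjn {0} z i \<and> almost_regular (adjn I z i) (z i)"
      and min: "\<And>n e. n \<le> CARD('x) \<Longrightarrow> int e \<le> regularity I \<Longrightarrow> HF (adjn I z n) e = min_section I n e"
      using generic_sequence[OF I, of "nat (regularity I)"] by (metis nat_int nat_mono)
    obtain N A D where res: "gres I N A D"
      and bound: "\<And>i q. q < N (Suc i) \<Longrightarrow> int (A (Suc i) q) \<le> regularity I + int i"
      using regularity_bound[OF I] by blast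
    interpret resolution_sections I N A D z
      by unfold_locales (use res I z in auto)
    have "full_rank_at (adjn I z i) (z i) d" if i: "i < k" for i d
    \<comment> \<open>From \<open>regularity I\<close> on, multiplication is injective; below it,
      the equation in degree \<open>Suc d\<close> is one of those assumed and gives full rank out of
      degree \<open>d\<close>.\<close>
    proof (cases "int d \<ge> regularity I")
      case True
      thus ?thesis
        unfolding full_rank_at_def using regular_above_regularity[OF bound, of i d] i assms(4) by auto
    next
      case False
      have i': "i < CARD('x)" using i assms(4) by simp
      have hz: "hidl (adjn I z i)" by (rule hidl_adjn[OF I, where e = "\<lambda>_. 1"]) (use z i' in simp)
      have d: "int d \<le> regularity I" "int (Suc d) \<le> regularity I" using False by simp_all
      have "?eq (Suc d) i" using eq i d(2) by blast
      hence "int (HF (adj (adjn I z i) (z i)) (Suc d)) = max (int (HF (adjn I z i) (Suc d)) - int (HF (adjn I z i) d)) 0"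
        using min[of i d] min[of i "Suc d"] min[of "Suc i" "Suc d"] i' d by simp
      thus ?thesis using HF_adj_eq_iff[OF hz, of "z i" d] z[OF i'] by blast
    qed
    thus "\<exists>y. (\<forall>i<k. y i \<in> homog_part 1) \<and> (\<forall>i<k. \<forall>d. full_rank_at (adjn I y i) (y i) d)"
      using z assms(4) by (intro exI[of _ z]) auto
  qed
qed

end
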